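(* For every fixed integer $q\ge 2$, the min-max edge $q$-coloring problem is NP-hard. This problem is: given a finite simple graph $G=(V,E)$, find an edge coloring $\sigma$ of $G$ such that every vertex is incident to edges of at most $q$ distinct colors, minimizing the size of the largest color group $\max_c |\{e\in E:\sigma(e)=c\}|$.
   Context: A coloring of the edges such that each vertex is incident to at most $q$ distinct colors is called an edge $q$-coloring. A color group is the set of all edges receiving a given color. NP-hardness refers to the decision version: given $G$ and an integer $L$, decide whether there is an edge $q$-coloring all of whose color groups have size at most $L$. *)

theory Defs
  imports Main "HOL-Computational_Algebra.Polynomial"
begin

section \<open>Deterministic multi-tape Turing machines\<close>

text \<open>
  Tapes are infinite in both directions.  Symbols are natural numbers: 0 is the blank, 1 and 2
  represent the bits, and further symbols below \<open>n_symbols\<close> are free for the machine's own use.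
  The states are the numbers up to \<open>n_states\<close>; the start state is 0 and the machine
  halts when it reaches the state \<open>n_states\<close>.
\<close>

datatype move = MoveLeft | Stay | MoveRight

fun offset :: "move \<Rightarrow> int" where
  "offset MoveLeft = -1"
| "offset Stay = 0"
| "offset MoveRight = 1"

record tm =
  n_tapes :: nat
  n_symbols :: nat
  n_states :: nat
  trans :: "nat \<Rightarrow> nat list \<Rightarrow> nat \<times> (nat \<times> move) list"

text \<open>
  The values of \<open>trans\<close> matter only on the finitely many arguments considered here: non-halting
  states together with one symbol of the alphabet per tape.
\<close>

definition wf_tm :: "tm \<Rightarrow> bool" where
  "wf_tm M \<longleftrightarrow>
     n_tapes M \<ge> 1 \<and> n_symbols M \<ge> 3 \<and>
     (\<forall>s rs. s < n_states M \<and> length rs = n_tapes M \<and> set rs \<subseteq> {..<n_symbols M} \<longrightarrow>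
        (case trans M s rs of (s', acts) \<Rightarrow>
           s' \<le> n_states M \<and> length acts = n_tapes M \<and> fst ` set acts \<subseteq> {..<n_symbols M}))"

type_synonym tape = "(int \<Rightarrow> nat) \<times> int"  \<comment> \<open>cell contents and head position\<close>
type_synonym config = "nat \<times> tape list"  \<comment> \<open>state and tapes\<close>

fun read_tape :: "tape \<Rightarrow> nat" where
  "read_tape (t, h) = t h"

fun act_tape :: "nat \<times> move \<Rightarrow> tape \<Rightarrow> tape" where
  "act_tape (a, d) (t, h) = (t(h := a), h + offset d)"

fun step :: "tm \<Rightarrow> config \<Rightarrow> config" where
  "step M (s, ts) =
     (if s < n_states M
      then (case trans M s (map read_tape ts) of (s', acts) \<Rightarrow> (s', map2 act_tape acts ts))
      else (s, ts))"

definition bit_symbol :: "bool \<Rightarrow> nat" where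
  "bit_symbol b = (if b then 2 else 1)"

definition input_tape :: "bool list \<Rightarrow> tape" where
  "input_tape w =
     ((\<lambda>i. if 0 \<le> i \<and> i < int (length w) then bit_symbol (w ! nat i) else 0), 0)"

text \<open>A machine may receive several input strings, each one on a tape of its own.\<close>

definition init_config :: "tm \<Rightarrow> bool list list \<Rightarrow> config" where
  "init_config M ws = (0, map input_tape (ws @ replicate (n_tapes M - length ws) []))"

text \<open>The output of a machine is the string on its last tape from cell 0 up to the first blank.\<close>

fun tape_output :: "tape \<Rightarrow> bool list \<Rightarrow> bool" where
  "tape_output (t, h) y \<longleftrightarrow>
     (\<forall>i < length y. t (int i) = bit_symbol (y ! i)) \<and> t (int (length y)) = 0"

definition outputs_within :: "tm \<Rightarrow> bool list list \<Rightarrow> bool list \<Rightarrow> nat \<Rightarrow> bool" where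
  "outputs_within M ws y T \<longleftrightarrow>
     length ws \<le> n_tapes M \<and>
     (\<exists>k \<le> T. case (step M ^^ k) (init_config M ws) of (s, ts) \<Rightarrow>
        s = n_states M \<and> tape_output (last ts) y)"


section \<open>NP-hardness\<close>

type_synonym language = "bool list set"

definition poly_time_computable :: "(bool list \<Rightarrow> bool list) \<Rightarrow> bool" where
  "poly_time_computable f \<longleftrightarrow>
     (\<exists>M (p :: nat poly). wf_tm M \<and> (\<forall>x. outputs_within M [x] (f x) (poly p (length x))))"

definition poly_time_decidable2 :: "(bool list \<Rightarrow> bool list \<Rightarrow> bool) \<Rightarrow> bool" where
  "poly_time_decidable2 R \<longleftrightarrow>
     (\<exists>M (p :: nat poly). wf_tm M \<and>
        (\<forall>x u. outputs_within M [x, u] [R x u] (poly p (length x + length u))))"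

definition NP :: "language set" where
  "NP = {A. \<exists>R (p :: nat poly). poly_time_decidable2 R \<and>
              (\<forall>x. x \<in> A \<longleftrightarrow> (\<exists>u. length u \<le> poly p (length x) \<and> R x u))}"

definition poly_time_reducible :: "language \<Rightarrow> language \<Rightarrow> bool"  (infix "\<le>\<^sub>p" 50) where
  "A \<le>\<^sub>p B \<longleftrightarrow> (\<exists>f. poly_time_computable f \<and> (\<forall>x. x \<in> A \<longleftrightarrow> f x \<in> B))"

definition NP_hard :: "language \<Rightarrow> bool" where
  "NP_hard B \<longleftrightarrow> (\<forall>A \<in> NP. A \<le>\<^sub>p B)"


section \<open>Edge colorings\<close>

definition simple_graph :: "'a set \<Rightarrow> 'a set set \<Rightarrow> bool" where
  "simple_graph V E \<longleftrightarrow> finite V \<and> (\<forall>e \<in> E. e \<subseteq> V \<and> card e = 2)"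

definition edge_q_coloring :: "nat \<Rightarrow> 'a set \<Rightarrow> 'a set set \<Rightarrow> ('a set \<Rightarrow> nat) \<Rightarrow> bool" where
  "edge_q_coloring q V E \<sigma> \<longleftrightarrow> (\<forall>v \<in> V. card (\<sigma> ` {e \<in> E. v \<in> e}) \<le> q)"

definition color_group :: "'a set set \<Rightarrow> ('a set \<Rightarrow> nat) \<Rightarrow> nat \<Rightarrow> 'a set set" where
  "color_group E \<sigma> c = {e \<in> E. \<sigma> e = c}"


section \<open>The decision problem\<close>

text \<open>Binary representation, least significant bit first, without leading zeros.\<close>

fun bin :: "nat \<Rightarrow> bool list" where
  "bin n = (if n = 0 then [] else odd n # bin (n div 2))"

declare bin.simps [simp del]

definition adjacency_matrix :: "nat \<Rightarrow> nat set set \<Rightarrow> bool list" where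
  "adjacency_matrix n E = concat (map (\<lambda>i. map (\<lambda>j. {i, j} \<in> E) [0..<n]) [0..<n])"

text \<open>
  Up to isomorphism, every finite graph has a vertex set of the form \<open>{0..<n}\<close>.  Such a graph
  together with a bound \<open>L\<close> on the size of the color groups is written as
  the number of vertices in unary, a delimiter, the adjacency matrix row by row, and the
  bound in binary.
\<close>

definition encode_instance :: "nat \<Rightarrow> nat set set \<Rightarrow> nat \<Rightarrow> bool list" where
  "encode_instance n E L = replicate n True @ [False] @ adjacency_matrix n E @ bin L"

definition min_max_edge_coloring :: "nat \<Rightarrow> language" where
  "min_max_edge_coloring q =
     {encode_instance n E L | n E L.
        simple_graph {0..<n} E \<and>
        (\<exists>\<sigma>. edge_q_coloring q {0..<n} E \<sigma> \<and> (\<forall>c. card (color_group E \<sigma> c) \<le> L))}"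


section \<open>Unambiguity of the encodings\<close>

lemma tape_output_unique:
  assumes "tape_output tp y" "tape_output tp z"
  shows "y = z"
proof -
  obtain t h where tp: "tp = (t, h)" by fastforce
  have *: "bit_symbol b \<noteq> 0" for b by (simp add: bit_symbol_def)
  have len: "length y = length z"
    using assms unfolding tp by (metis * linorder_neqE_nat tape_output.simps)
  have "y ! i = z ! i" if "i < length y" for i
  proof -
    have "bit_symbol (y ! i) = bit_symbol (z ! i)"
      using assms that len unfolding tp by (metis tape_output.simps)
    then show ?thesis by (auto simp: bit_symbol_def split: if_splits)
  qed
  with len show ?thesis by (rule nth_equalityI)
qed

lemma bin_inject: "bin m = bin n \<Longrightarrow> m = n"
proof (induction m arbitrary: n rule: less_induct)
  case (less m)
  show ?case
  proof (cases "m = 0 \<or> n = 0")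
    case True
    then show ?thesis using less.prems by (auto simp: bin.simps split: if_splits)
  next
    case False
    then have "odd m = odd n" and b: "bin (m div 2) = bin (n div 2)"
      using less.prems by (subst (asm) (1 2) bin.simps; simp)+
    have "m div 2 = n div 2" using less.IH[OF _ b] False by simp
    then show ?thesis using \<open>odd m = odd n\<close>
      by (metis dvd_mult_div_cancel odd_two_times_div_two_succ)
  qed
qed

lemma encode_instance_inject:
  assumes eq: "encode_instance n E L = encode_instance n' E' L'"
    and G: "simple_graph {0..<n} E" and G': "simple_graph {0..<n'} E'"
  shows "n = n' \<and> E = E' \<and> L = L'"
proof -
  have tw: "takeWhile id (replicate k True @ [False] @ xs) = replicate k True" for k xs
    by (induction k) auto
  have "replicate n True = replicate n' True"
    using arg_cong[OF eq, of "takeWhile id"] unfolding encode_instance_def tw .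
  then have n: "n = n'" by (metis length_replicate)
  have len: "length (adjacency_matrix n F) = n * n" for F
    by (simp add: adjacency_matrix_def length_concat comp_def sum_list_triv)
  have "adjacency_matrix n E = adjacency_matrix n E'" and "bin L = bin L'"
    using eq unfolding encode_instance_def n[symmetric] by (simp_all add: len)
  then have L: "L = L'" and A: "adjacency_matrix n E = adjacency_matrix n E'"
    using bin_inject by auto
  have "map (\<lambda>i. map (\<lambda>j. {i, j} \<in> E) [0..<n]) [0..<n]
      = map (\<lambda>i. map (\<lambda>j. {i, j} \<in> E') [0..<n]) [0..<n]"
    using A unfolding adjacency_matrix_def
    by (rule concat_injective) (auto simp: set_zip)
  then have ij: "{i, j} \<in> E \<longleftrightarrow> {i, j} \<in> E'" if "i < n" "j < n" for i j
    using that by simp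
  have "e \<in> E \<longleftrightarrow> e \<in> E'" for e
  proof (cases "e \<subseteq> {0..<n} \<and> card e = 2")
    case True
    then obtain i j where "e = {i, j}" by (auto simp: card_2_iff)
    with True ij show ?thesis by auto
  next
    case False
    with G G' n show ?thesis by (auto simp: simple_graph_def)
  qed
  with n L show ?thesis by auto
qed

end

theory Submission
  imports Defs
begin

text \<open>
  Let \<open>A\<close> be in NP.  As in the Cook--Levin theorem, the computations of a verifier for \<open>A\<close> are
  described by propositional clauses.  Since the machine is deterministic, implications that
  propagate true facts from one configuration to the next are enough: apart from the choice of the
  certificate, one never has to say that a fact is false, except that the verifier does not reject.

  Satisfiability is reduced to load balancing, where every item has to be put on one of two machines:
  an item of weight \<open>m\<close> for every variable fills the machine of the false literal, so the unit items
  for the occurrences of this literal in the \<open>m\<close> clauses have to go to the machines of the clauses,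
  each of which lacks room for one of its literals.  In the graph, a machine of capacity \<open>s\<close> is a
  vertex of degree \<open>q L - s\<close>: the at most \<open>q\<close> color groups at this vertex can contain at most \<open>s\<close> edges
  that are not incident to it.  An item is a vertex adjacent to its two machines, to \<open>q - 2\<close> common
  machines of capacity 0, and to a private vertex of degree \<open>q L - (L - w)\<close>.  Two of its \<open>q + 1\<close> edges
  have the same color, and \<open>L\<close> is so large that one of them has to be the edge to the private vertex,
  where its color group has at least \<open>w\<close> edges.  These \<open>w\<close> edges burden the machine at the other edge.

  Every clause and every edge is determined by bounded quantification over polynomially many numbers,
  so that unary counters suffice to compute the instance: a small language of arithmetic expressions
  is compiled to Turing machines that store each counter as the position of a head.
\<close>

section \<open>Register programs and their compilation to Turing machines\<close>

text \<open>Weights and capacities turn into vertex degrees, so load balancing has to stay hard for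
  numbers of polynomial size; here the largest weight is the number of clauses. The
  \<open>q - 2\<close> machines of capacity 0 offer an item no real alternative. They only raise its
  degree to \<open>q + 1\<close>, so that two of its edges must share a color whatever
  \<open>q\<close> is. These two edges cannot lead to two machines: every color present at a vertex
  of degree \<open>q L - s\<close> has at least \<open>L - s\<close> edges there, all of them
  foreign to the other machine, and both capacities are below half of \<open>L\<close>.

  One-directional clauses suffice because a model is forced to contain every fact of an actual run,
  while additional true variables do no harm. Forbidding the rejecting symbol in the output cell
  therefore excludes rejection, and since a verifier halts with a bit on every certificate, this
  amounts to acceptance.\<close>

datatype com =
    Skip | Inc nat | Dec nat | MvR | MvL | Out bool | IncBit nat | Scan nat
  | Seq com com  (infixr ";;" 60)
  | Loop nat com

type_synonym state = "(nat \<Rightarrow> nat) \<times> int \<times> bool list"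
  \<comment> \<open>registers, position of the head on the input, output written so far\<close>

abbreviation symb :: "bool list \<Rightarrow> int \<Rightarrow> nat" where
  "symb x \<equiv> fst (input_tape x)"

text \<open>Times are exact: each rule charges the number of steps of the compiled code, so a round
  of a loop costs two more than its body, for the test and for the jump back. A derivation also
  certifies termination.\<close>

inductive big :: "bool list \<Rightarrow> com \<Rightarrow> state \<Rightarrow> nat \<Rightarrow> state \<Rightarrow> bool" for x where
  Skip: "big x Skip s 0 s"
| Inc: "big x (Inc r) (g, p, w) 1 (g(r := Suc (g r)), p, w)"
| Dec: "big x (Dec r) (g, p, w) 1 (g(r := g r - 1), p, w)"
| MvR: "big x MvR (g, p, w) 1 (g, p + 1, w)"
| MvL: "big x MvL (g, p, w) 1 (g, p - 1, w)"
| Out: "big x (Out b) (g, p, w) 1 (g, p, w @ [b])"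
| IncBit: "big x (IncBit r) (g, p, w) 1 (g(r := g r + of_bool (symb x p = 2)), p, w)"
| ScanEnd: "symb x p = 0 \<Longrightarrow> big x (Scan r) (g, p, w) 1 (g, p, w)"
| ScanStep: "symb x p \<noteq> 0 \<Longrightarrow> big x (Scan r) (g(r := Suc (g r)), p + 1, w) t s
    \<Longrightarrow> big x (Scan r) (g, p, w) (Suc t) s"
| Seq: "big x c s t s' \<Longrightarrow> big x d s' t' s'' \<Longrightarrow> big x (c ;; d) s (t + t') s''"
| LoopEnd: "g r = 0 \<Longrightarrow> big x (Loop r c) (g, p, w) 1 (g, p, w)"
| LoopStep: "g r \<noteq> 0 \<Longrightarrow> big x c (g(r := g r - 1), p, w) t s \<Longrightarrow> big x (Loop r c) s t' s'
    \<Longrightarrow> big x (Loop r c) (g, p, w) (Suc t + Suc t') s'"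

datatype instr =
    IInc nat | IDecJ nat nat | IJmp nat | IMvR | IMvL | IOut bool | IIncBit nat | IScan nat

fun size_com :: "com \<Rightarrow> nat" where
  "size_com Skip = 0"
| "size_com (c ;; d) = size_com c + size_com d"
| "size_com (Loop r c) = size_com c + 2"
| "size_com _ = 1"

text \<open>Jump targets are absolute, hence the start address \<open>a\<close>. \<open>Dec\<close>
  continues with the next instruction in either case, so that it leaves 0 unchanged.\<close>

fun compile :: "com \<Rightarrow> nat \<Rightarrow> instr list" where
  "compile Skip a = []"
| "compile (Inc r) a = [IInc r]"
| "compile (Dec r) a = [IDecJ r (Suc a)]"
| "compile MvR a = [IMvR]"
| "compile MvL a = [IMvL]"
| "compile (Out b) a = [IOut b]"
| "compile (IncBit r) a = [IIncBit r]"
| "compile (Scan r) a = [IScan r]"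
| "compile (c ;; d) a = compile c a @ compile d (a + size_com c)"
| "compile (Loop r c) a = IDecJ r (a + size_com c + 2) # compile c (Suc a) @ [IJmp a]"

fun regs :: "com \<Rightarrow> nat set" where
  "regs (Inc r) = {r}"
| "regs (Dec r) = {r}"
| "regs (IncBit r) = {r}"
| "regs (Scan r) = {r}"
| "regs (c ;; d) = regs c \<union> regs d"
| "regs (Loop r c) = insert r (regs c)"
| "regs _ = {}"

lemma finite_regs: "finite (regs c)"
  by (induction c) auto

lemma length_compile [simp]: "length (compile c a) = size_com c"
  by (induction c arbitrary: a) auto

text \<open>
  Tape 0 is the input, tape \<open>r + 1\<close> holds register \<open>r\<close> as the distance of the head from
  a mark in cell 0, and the output tape comes last.  State 0 writes the marks; state
  \<open>a + 1\<close> executes the instruction at address \<open>a\<close>.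
\<close>

fun tm_act :: "nat \<Rightarrow> instr \<Rightarrow> nat list \<Rightarrow> nat \<Rightarrow> nat \<times> move" where
  "tm_act R (IInc r) rs j = (rs ! j, if j = Suc r then MoveRight else Stay)"
| "tm_act R (IDecJ r a) rs j = (rs ! j, if j = Suc r \<and> rs ! j \<noteq> 1 then MoveLeft else Stay)"
| "tm_act R (IJmp a) rs j = (rs ! j, Stay)"
| "tm_act R IMvR rs j = (rs ! j, if j = 0 then MoveRight else Stay)"
| "tm_act R IMvL rs j = (rs ! j, if j = 0 then MoveLeft else Stay)"
| "tm_act R (IOut b) rs j = (if j = Suc R then (bit_symbol b, MoveRight) else (rs ! j, Stay))"
| "tm_act R (IIncBit r) rs j = (rs ! j, if j = Suc r \<and> rs ! 0 = 2 then MoveRight else Stay)"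
| "tm_act R (IScan r) rs j =
    (rs ! j, if (j = 0 \<or> j = Suc r) \<and> rs ! 0 \<noteq> 0 then MoveRight else Stay)"

fun tm_next :: "instr \<Rightarrow> nat list \<Rightarrow> nat \<Rightarrow> nat" where
  "tm_next (IDecJ r a) rs s = (if rs ! Suc r = 1 then Suc a else Suc s)"
| "tm_next (IJmp a) rs s = Suc a"
| "tm_next (IScan r) rs s = (if rs ! 0 = 0 then Suc s else s)"
| "tm_next _ rs s = Suc s"

definition tm_of :: "nat \<Rightarrow> instr list \<Rightarrow> tm" where
  "tm_of R P = \<lparr> n_tapes = R + 2, n_symbols = 3, n_states = Suc (length P),
     trans = (\<lambda>s rs. if s = 0
        then (1, map (\<lambda>j. (if j = 0 \<or> j = Suc R then rs ! j else 1, Stay)) [0..<R + 2])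
        else (tm_next (P ! (s - 1)) rs s, map (tm_act R (P ! (s - 1)) rs) [0..<R + 2])) \<rparr>"

fun tape_of :: "bool list \<Rightarrow> nat \<Rightarrow> state \<Rightarrow> nat \<Rightarrow> tape" where
  "tape_of x R (g, p, w) j =
    (if j = 0 then (symb x, p) else if j \<le> R then (\<lambda>i. of_bool (i = 0), int (g (j - 1)))
     else (symb w, int (length w)))"

definition tapes_of :: "bool list \<Rightarrow> nat \<Rightarrow> state \<Rightarrow> tape list" where
  "tapes_of x R st = map (tape_of x R st) [0..<R + 2]"

lemma map2_map: "map2 f (map g xs) (map h xs) = map (\<lambda>j. f (g j) (h j)) xs"
  by (induction xs) auto

lemma step_tm_of:
  assumes "a < length P"
  shows "step (tm_of R P) (Suc a, tapes_of x R st) =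
    (let rs = map (\<lambda>j. read_tape (tape_of x R st j)) [0..<R + 2]
     in (tm_next (P ! a) rs (Suc a),
         map (\<lambda>j. act_tape (tm_act R (P ! a) rs j) (tape_of x R st j)) [0..<R + 2]))"
proof -
  have "map read_tape (tapes_of x R st) = map (\<lambda>j. read_tape (tape_of x R st j)) [0..<R + 2]"
    by (simp add: tapes_of_def)
  then show ?thesis
    using assms by (simp only: tapes_of_def step.simps Let_def) (simp add: tm_of_def map2_map)
qed

lemma tapes_eqI:
  "(\<And>j. j < R + 2 \<Longrightarrow> f j = tape_of x R st j) \<Longrightarrow> map f [0..<Suc (Suc R)] = tapes_of x R st"
  by (simp add: tapes_of_def)

lemma nth_upt_map: "j < n \<Longrightarrow> map f [0..<n] ! j = f j"
  by simp

lemmas step_simps = step_tm_of Let_def nth_upt_map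

lemma symb_snoc: "(symb w)(int (length w) := bit_symbol b) = symb (w @ [b])"
  by (rule ext) (auto simp: input_tape_def nth_append nat_less_iff)

text \<open>The code of \<open>c\<close> may lie anywhere inside a longer program \<open>P\<close>;
  the induction needs this for the parts of sequences and loops.\<close>

lemma compile_correct:
  assumes "big x c s t s'" "regs c \<subseteq> {..<R}" "a + size_com c \<le> length P"
    "\<And>i. i < size_com c \<Longrightarrow> P ! (a + i) = compile c a ! i"
  shows "(step (tm_of R P) ^^ t) (Suc a, tapes_of x R s) = (Suc (a + size_com c), tapes_of x R s')"
  using assms
proof (induction arbitrary: a rule: big.induct)
  case (Skip s)
  then show ?case by simp
next
  case (Inc r g p w)
  have "P ! a = IInc r" using Inc(3)[of 0] by simp
  then show ?case using Inc(1,2)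
    by (simp del: upt_Suc step.simps add: step_simps) (intro conjI impI tapes_eqI, auto simp: fun_eq_iff simp del: upt_Suc)
next
  case (Dec r g p w)
  have "P ! a = IDecJ r (Suc a)" using Dec(3)[of 0] by simp
  then show ?case using Dec(1,2)
    by (simp del: upt_Suc step.simps add: step_simps) (intro conjI impI tapes_eqI, auto simp: fun_eq_iff simp del: upt_Suc)
next
  case (MvR g p w)
  have "P ! a = IMvR" using MvR(3)[of 0] by simp
  then show ?case using MvR(1,2)
    by (simp del: upt_Suc step.simps add: step_simps) (intro conjI impI tapes_eqI, auto simp: fun_eq_iff simp del: upt_Suc)
next
  case (MvL g p w)
  have "P ! a = IMvL" using MvL(3)[of 0] by simp
  then show ?case using MvL(1,2)
    by (simp del: upt_Suc step.simps add: step_simps) (intro conjI impI tapes_eqI, auto simp: fun_eq_iff simp del: upt_Suc)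
next
  case (Out b g p w)
  have "P ! a = IOut b" using Out(3)[of 0] by simp
  then show ?case using Out(1,2)
    by (simp del: upt_Suc step.simps add: step_simps) (intro conjI impI tapes_eqI, auto simp: fun_eq_iff symb_snoc[symmetric] simp del: upt_Suc)
next
  case (IncBit r g p w)
  have "P ! a = IIncBit r" using IncBit(3)[of 0] by simp
  then show ?case using IncBit(1,2)
    by (simp del: upt_Suc step.simps add: step_simps) (intro conjI impI tapes_eqI, auto simp: fun_eq_iff simp del: upt_Suc)
next
  case (ScanEnd p r g w)
  have "P ! a = IScan r" using ScanEnd(4)[of 0] by simp
  then show ?case using ScanEnd
    by (simp del: upt_Suc step.simps add: step_simps) (intro conjI impI tapes_eqI, auto simp: fun_eq_iff simp del: upt_Suc)
next
  case (ScanStep p r g w t s)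
  have "P ! a = IScan r" using ScanStep.prems(3)[of 0] by simp
  then have "step (tm_of R P) (Suc a, tapes_of x R (g, p, w))
      = (Suc a, tapes_of x R (g(r := Suc (g r)), p + 1, w))"
    using ScanStep.prems ScanStep.hyps
    by (simp del: upt_Suc step.simps add: step_simps) (intro conjI impI tapes_eqI, auto simp: fun_eq_iff simp del: upt_Suc)
  then show ?case using ScanStep.IH[OF ScanStep.prems] by (simp del: step.simps funpow.simps add: funpow_Suc_right)
next
  case (Seq c s t s' d t' s'')
  have c: "P ! (a + i) = compile c a ! i" if "i < size_com c" for i
    using Seq.prems(3)[of i] that by (simp add: nth_append)
  have d: "P ! (a + size_com c + i) = compile d (a + size_com c) ! i" if "i < size_com d" for i
    using Seq.prems(3)[of "size_com c + i"] that by (simp add: nth_append add.assoc)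
  have 1: "(step (tm_of R P) ^^ t) (Suc a, tapes_of x R s) = (Suc (a + size_com c), tapes_of x R s')"
    using Seq.prems by (intro Seq.IH(1) c) auto
  have 2: "(step (tm_of R P) ^^ t') (Suc (a + size_com c), tapes_of x R s')
      = (Suc (a + size_com c + size_com d), tapes_of x R s'')"
    using Seq.prems by (intro Seq.IH(2) d) auto
  show ?case
    using 2 by (subst add.commute) (simp only: funpow_add comp_def 1 size_com.simps add.assoc)
next
  case (LoopEnd g r c p w)
  have "P ! a = IDecJ r (a + size_com c + 2)" using LoopEnd(4)[of 0] by simp
  then show ?case using LoopEnd
    by (simp del: upt_Suc step.simps add: step_simps) (intro conjI impI tapes_eqI, auto simp: fun_eq_iff simp del: upt_Suc)
next
  case (LoopStep g r c p w t s t' s')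
  let ?st = "step (tm_of R P)"
  have i: "P ! a = IDecJ r (a + size_com c + 2)" using LoopStep.prems(3)[of 0] by simp
  have j: "P ! (Suc (a + size_com c)) = IJmp a"
    using LoopStep.prems(3)[of "Suc (size_com c)"] by (simp add: nth_append)
  have c: "P ! (Suc a + i) = compile c (Suc a) ! i" if "i < size_com c" for i
    using LoopStep.prems(3)[of "Suc i"] that by (simp add: nth_append)
  have 1: "?st (Suc a, tapes_of x R (g, p, w)) = (Suc (Suc a), tapes_of x R (g(r := g r - 1), p, w))"
    using LoopStep.prems LoopStep.hyps i
    by (simp del: upt_Suc step.simps add: step_simps) (intro conjI impI tapes_eqI, auto simp: fun_eq_iff simp del: upt_Suc)
  have 2: "(?st ^^ t) (Suc (Suc a), tapes_of x R (g(r := g r - 1), p, w))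
      = (Suc (Suc a + size_com c), tapes_of x R s)"
    using LoopStep.prems by (intro LoopStep.IH(1) c) auto
  obtain g' p' w' where s: "s = (g', p', w')" by (cases s)
  have 3: "?st (Suc (Suc a + size_com c), tapes_of x R s) = (Suc a, tapes_of x R s)"
    using LoopStep.prems j
    by (simp del: upt_Suc step.simps add: step_simps s) (intro conjI impI tapes_eqI, auto simp: fun_eq_iff simp del: upt_Suc)
  have 4: "(?st ^^ t') (Suc a, tapes_of x R s) = (Suc (a + size_com (Loop r c)), tapes_of x R s')"
    by (rule LoopStep.IH(2)[OF LoopStep.prems])
  have "(?st ^^ (t' + Suc (t + Suc 0))) (Suc a, tapes_of x R (g, p, w)) = (Suc (a + size_com (Loop r c)), tapes_of x R s')"
    by (simp only: funpow_add comp_def funpow.simps id_apply 1 2 3 4)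
  then show ?case by (simp only: add_Suc add_Suc_right add.commute[of t] add_0_right)
qed

text \<open>The address right behind the program is a legal target: its state is the halting
  state.\<close>

fun targets_ok :: "nat \<Rightarrow> instr \<Rightarrow> bool" where
  "targets_ok n (IDecJ r a) = (a \<le> n)"
| "targets_ok n (IJmp a) = (a \<le> n)"
| "targets_ok n _ = True"

lemma targets_mono: "targets_ok m i \<Longrightarrow> m \<le> n \<Longrightarrow> targets_ok n i"
  by (cases i) auto

lemma targets_compile: "i \<in> set (compile c a) \<Longrightarrow> targets_ok (a + size_com c) i"
proof (induction c arbitrary: a)
  case (Seq c d)
  then show ?case
    by (auto intro: targets_mono[of "a + size_com c"] dest!: Seq.IH simp: add.assoc)
next
  case (Loop r c)
  then show ?case
    by (auto intro: targets_mono[of "Suc a + size_com c"] dest!: Loop.IH)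
qed auto

lemma wf_tm_of:
  assumes "\<And>i. i \<in> set P \<Longrightarrow> targets_ok (length P) i"
  shows "wf_tm (tm_of R P)"
proof -
  have nxt: "tm_next (P ! (s - 1)) rs s \<le> Suc (length P)" if "s \<noteq> 0" "s < Suc (length P)" for s rs
  proof -
    have "targets_ok (length P) (P ! (s - 1))" using that by (intro assms nth_mem) auto
    then show ?thesis using that by (cases "P ! (s - 1)") auto
  qed
  have sy: "rs ! j < 3" if "length rs = Suc (Suc R)" "set rs \<subseteq> {..<3}" "j < Suc (Suc R)" for rs :: "nat list" and j
    using that nth_mem[of j rs] by (metis lessThan_iff subsetD)
  have act: "fst (tm_act R i rs j) < 3"
    if "length rs = Suc (Suc R)" "set rs \<subseteq> {..<3}" "j < Suc (Suc R)" for rs i j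
    using sy[OF that] by (cases i) (auto simp: bit_symbol_def)
  show ?thesis
    unfolding wf_tm_def using nxt sy act
    by (auto simp: tm_of_def simp del: upt_Suc)
qed

lemma init_tm_of:
  "step (tm_of R P) (init_config (tm_of R P) [x]) = (1, tapes_of x R (\<lambda>_. 0, 0, []))"
proof -
  let ?t = "\<lambda>j. if j = 0 then input_tape x else (\<lambda>_. 0, 0)"
  have "map input_tape ([x] @ replicate (R + 2 - length [x]) []) = map ?t [0..<R + 2]"
    by (rule nth_equalityI) (auto simp: nth_Cons input_tape_def split: nat.splits simp del: upt_Suc)
  then have *: "init_config (tm_of R P) [x] = (0, map ?t [0..<R + 2])"
    by (simp add: init_config_def tm_of_def)
  have "map read_tape (map ?t [0..<R + 2]) = map (\<lambda>j. read_tape (?t j)) [0..<R + 2]"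
    by simp
  then show ?thesis
    unfolding * step.simps
    by (simp add: tm_of_def map2_map del: upt_Suc)
      (intro conjI impI tapes_eqI, auto simp: input_tape_def fun_eq_iff simp del: upt_Suc)
qed

text \<open>The additional step is the one in which state 0 writes the marks.\<close>

lemma outputs_compile:
  assumes "big x c (\<lambda>_. 0, 0, []) t (g, p, w)" "t \<le> T"
    and R: "regs c \<subseteq> {..<R}"
  shows "outputs_within (tm_of R (compile c 0)) [x] w (Suc T)"
proof -
  let ?M = "tm_of R (compile c 0)"
  have "(step ?M ^^ t) (1, tapes_of x R (\<lambda>_. 0, 0, [])) = (Suc (size_com c), tapes_of x R (g, p, w))"
    using compile_correct[OF assms(1) R, where a = 0 and P = "compile c 0"] by simp
  then have *: "(step ?M ^^ Suc t) (init_config ?M [x]) = (Suc (size_com c), tapes_of x R (g, p, w))"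
    by (simp only: funpow_Suc_right comp_def init_tm_of)
  have "last (tapes_of x R (g, p, w)) = (symb w, int (length w))"
    by (simp add: tapes_of_def)
  then have "tape_output (last (tapes_of x R (g, p, w))) w"
    by (simp add: input_tape_def)
  with * have "case (step ?M ^^ Suc t) (init_config ?M [x]) of (s, ts) \<Rightarrow> s = n_states ?M \<and> tape_output (last ts) w"
    by (simp add: tm_of_def)
  then show ?thesis
    unfolding outputs_within_def using assms(2)
    by (intro conjI exI[of _ "Suc t"]) (auto simp: tm_of_def)
qed

section \<open>Upper bounds for the running times of register programs\<close>

definition runs :: "bool list \<Rightarrow> com \<Rightarrow> state \<Rightarrow> nat \<Rightarrow> state \<Rightarrow> bool" where
  "runs x c s T s' \<longleftrightarrow> (\<exists>t \<le> T. big x c s t s')"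

lemma runs_mono: "runs x c s T s' \<Longrightarrow> T \<le> T' \<Longrightarrow> runs x c s T' s'"
  unfolding runs_def by (meson le_trans)

lemma runs_Seq:
  "runs x c s T s' \<Longrightarrow> runs x d s' T' s'' \<Longrightarrow> T + T' \<le> U \<Longrightarrow> runs x (c ;; d) s U s''"
  unfolding runs_def by (meson add_mono big.Seq le_trans)

lemma runs_basic:
  "runs x Skip s T s"
  "g' = g(r := Suc (g r)) \<Longrightarrow> 1 \<le> T \<Longrightarrow> runs x (Inc r) (g, p, w) T (g', p, w)"
  "g' = g(r := g r - 1) \<Longrightarrow> 1 \<le> T \<Longrightarrow> runs x (Dec r) (g, p, w) T (g', p, w)"
  "p' = p + 1 \<Longrightarrow> 1 \<le> T \<Longrightarrow> runs x MvR (g, p, w) T (g, p', w)"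
  "p' = p - 1 \<Longrightarrow> 1 \<le> T \<Longrightarrow> runs x MvL (g, p, w) T (g, p', w)"
  "w' = w @ [b] \<Longrightarrow> 1 \<le> T \<Longrightarrow> runs x (Out b) (g, p, w) T (g, p, w')"
  "g' = g(r := g r + of_bool (symb x p = 2)) \<Longrightarrow> 1 \<le> T \<Longrightarrow> runs x (IncBit r) (g, p, w) T (g', p, w)"
  unfolding runs_def by (blast intro: big.intros)+

text \<open>\<open>f i\<close>, \<open>p i\<close> and \<open>w i\<close> describe registers, head
  and output after \<open>i\<close> rounds. The test decrements the loop register first, so it
  already shows \<open>n - Suc i\<close> while round \<open>i\<close> is running.\<close>

lemma runs_for:
  assumes "\<And>i. i < n \<Longrightarrow> runs x c ((f i)(r := n - Suc i), p i, w i) B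
      ((f (Suc i))(r := n - Suc i), p (Suc i), w (Suc i))"
    and "g = (f 0)(r := n)" "p0 = p 0" "w0 = w 0"
    and "g' = (f n)(r := 0)" "p' = p n" "w' = w n"
    and "n * (B + 2) + 1 \<le> T"
  shows "runs x (Loop r c) (g, p0, w0) T (g', p', w')"
proof -
  have "runs x (Loop r c) ((f 0)(r := n), p 0, w 0) (n * (B + 2) + 1) ((f n)(r := 0), p n, w n)"
    using assms(1)
  proof (induction n arbitrary: f p w)
    case 0
    then show ?case unfolding runs_def by (intro exI[of _ 1]) (auto intro!: big.LoopEnd[unfolded One_nat_def])
  next
    case (Suc n)
    have 1: "runs x c ((f 0)(r := n), p 0, w 0) B ((f 1)(r := n), p 1, w 1)"
      using Suc.prems[of 0] by (simp add: fun_upd_def)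
    have 2: "runs x (Loop r c) ((f 1)(r := n), p 1, w 1) (n * (B + 2) + 1)
        ((f (Suc n))(r := 0), p (Suc n), w (Suc n))"
      using Suc.IH[of "\<lambda>i. f (Suc i)" "\<lambda>i. p (Suc i)" "\<lambda>i. w (Suc i)"] Suc.prems[of "Suc _"]
      by (simp add: fun_upd_def)
    from 1 obtain t where t: "t \<le> B" "big x c ((f 0)(r := n), p 0, w 0) t ((f 1)(r := n), p 1, w 1)"
      unfolding runs_def by blast
    from 2 obtain t' where t': "t' \<le> n * (B + 2) + 1"
      "big x (Loop r c) ((f 1)(r := n), p 1, w 1) t' ((f (Suc n))(r := 0), p (Suc n), w (Suc n))"
      unfolding runs_def by blast
    have "big x (Loop r c) ((f 0)(r := Suc n), p 0, w 0) (Suc t + Suc t')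
        ((f (Suc n))(r := 0), p (Suc n), w (Suc n))"
      using t(2) t'(2) by (intro big.LoopStep) auto
    then show ?case
      unfolding runs_def using t(1) t'(1) by (intro exI[of _ "Suc t + Suc t'"]) auto
  qed
  then show ?thesis using assms(2-) runs_mono by blast
qed

lemma runs_move:
  assumes "a \<noteq> b" "g' = g(a := 0, b := g b + g a)" "3 * g a + 1 \<le> T"
  shows "runs x (Loop a (Inc b)) (g, p, w) T (g', p, w)"
  by (rule runs_for[where n = "g a" and f = "\<lambda>i. g(b := g b + i)" and p = "\<lambda>_. p" and w = "\<lambda>_. w" and B = 1])
    (use assms in \<open>auto intro!: runs_basic\<close>)

lemma runs_clear:
  assumes "g' = g(a := 0)" "2 * g a + 1 \<le> T"
  shows "runs x (Loop a Skip) (g, p, w) T (g', p, w)"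
  by (rule runs_for[where n = "g a" and f = "\<lambda>i. g" and p = "\<lambda>_. p" and w = "\<lambda>_. w" and B = 0])
    (use assms in \<open>auto intro!: runs_basic\<close>)

lemma runs_diff:
  assumes "a \<noteq> b" "g' = g(a := 0, b := g b - g a)" "3 * g a + 1 \<le> T"
  shows "runs x (Loop a (Dec b)) (g, p, w) T (g', p, w)"
  by (rule runs_for[where n = "g a" and f = "\<lambda>i. g(b := g b - i)" and p = "\<lambda>_. p" and w = "\<lambda>_. w" and B = 1])
    (use assms in \<open>auto intro!: runs_basic\<close>)

text \<open>Reading a register destroys it, so its value goes to \<open>b\<close> and
  \<open>c\<close> at once and is then moved back from \<open>c\<close>.\<close>

lemma runs_copy:
  assumes "a \<noteq> b" "a \<noteq> c" "b \<noteq> c" "g b = 0" "g c = 0" "g' = g(b := g a)" "7 * g a + 2 \<le> T"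
  shows "runs x (Loop a (Inc b ;; Inc c) ;; Loop c (Inc a)) (g, p, w) T (g', p, w)"
proof (rule runs_Seq)
  have body: "runs x (Inc b ;; Inc c) (g(b := i, c := i, a := k), p, w) 2 (g(b := Suc i, c := Suc i, a := k), p, w)" for i k
  proof (rule runs_Seq)
    show "runs x (Inc b) (g(b := i, c := i, a := k), p, w) 1 (g(b := Suc i, c := i, a := k), p, w)"
      by (rule runs_basic) (use assms in \<open>auto simp: fun_eq_iff\<close>)
    show "runs x (Inc c) (g(b := Suc i, c := i, a := k), p, w) 1 (g(b := Suc i, c := Suc i, a := k), p, w)"
      by (rule runs_basic) (use assms in \<open>auto simp: fun_eq_iff\<close>)
  qed simp
  show "runs x (Loop a (Inc b ;; Inc c)) (g, p, w) (4 * g a + 1) (g(a := 0, b := g a, c := g a), p, w)"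
    by (rule runs_for[where n = "g a" and f = "\<lambda>i. g(b := i, c := i)" and p = "\<lambda>_. p" and w = "\<lambda>_. w" and B = 2, OF body])
      (use assms in \<open>auto simp: fun_eq_iff\<close>)
  show "runs x (Loop c (Inc a)) (g(a := 0, b := g a, c := g a), p, w) (3 * g a + 1) (g', p, w)"
    by (rule runs_move) (use assms in \<open>auto simp: fun_eq_iff\<close>)
qed (use assms in auto)


section \<open>Arithmetic expressions over an input string\<close>

text \<open>Variables are de Bruijn indices into an infinite environment; \<^term>\<open>Bsum a b\<close> binds index 0
  in \<open>b\<close>.\<close>

datatype exp = Var nat | Len | Cst nat | Bit exp | Add exp exp | Sub exp exp | Bsum exp exp

fun eval :: "bool list \<Rightarrow> (nat \<Rightarrow> nat) \<Rightarrow> exp \<Rightarrow> nat" where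
  "eval x s (Var k) = s k"
| "eval x s Len = length x"
| "eval x s (Cst n) = n"
| "eval x s (Bit a) = of_bool (symb x (int (eval x s a)) = 2)"
| "eval x s (Add a b) = eval x s a + eval x s b"
| "eval x s (Sub a b) = eval x s a - eval x s b"
| "eval x s (Bsum a b) = (\<Sum>i<eval x s a. eval x (case_nat i s) b)"

lemma poly_nat_mono: "m \<le> n \<Longrightarrow> poly p m \<le> poly p (n :: nat)"
  by (induction p) (auto intro: add_mono mult_mono)

text \<open>In the body of a sum the new index is smaller than the number of summands, so the
  environment there is bounded by \<open>m\<close> plus the bound for that number; this is the
  composition with \<open>[:0, 1:] + val_bound a\<close>.\<close>

fun val_bound :: "exp \<Rightarrow> nat poly" where
  "val_bound (Cst n) = [:n:]"
| "val_bound (Bit a) = 1"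
| "val_bound (Add a b) = val_bound a + val_bound b"
| "val_bound (Sub a b) = val_bound a"
| "val_bound (Bsum a b) = val_bound a * pcompose (val_bound b) ([:0, 1:] + val_bound a)"
| "val_bound _ = [:0, 1:]"

lemma case_nat_bound:
  "(\<forall>k. s k \<le> m) \<Longrightarrow> i \<le> n \<Longrightarrow> case_nat i s k \<le> m + (n :: nat)"
  by (cases k) (auto intro: trans_le_add1)

lemma eval_bound:
  "(\<forall>k. s k \<le> m) \<Longrightarrow> length x \<le> m \<Longrightarrow> eval x s e \<le> poly (val_bound e) m"
proof (induction e arbitrary: s m)
  case (Bsum a b)
  have a: "eval x s a \<le> poly (val_bound a) m" by (rule Bsum.IH(1)[OF Bsum.prems])
  have b: "eval x (case_nat i s) b \<le> poly (val_bound b) (m + poly (val_bound a) m)"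
    if "i < eval x s a" for i
    using that a Bsum.prems by (intro Bsum.IH(2) allI case_nat_bound) auto
  have "(\<Sum>i<eval x s a. eval x (case_nat i s) b) \<le> eval x s a * poly (val_bound b) (m + poly (val_bound a) m)"
    using sum_bounded_above[of "{..<eval x s a}", OF b] by simp
  also have "\<dots> \<le> poly (val_bound a) m * poly (val_bound b) (m + poly (val_bound a) m)"
    by (intro mult_right_mono a) simp
  finally show ?case by (simp add: poly_pcompose)
qed (auto intro: add_mono, meson diff_le_self le_trans)

text \<open>\<open>\<rho>\<close> assigns registers to the variables, and \<open>d\<close> is the
  first free register, which receives the result; all registers above \<open>d\<close> are 0 again
  at the end. In a sum, \<open>d\<close> accumulates the result, \<open>d + 1\<close> counts the
  remaining rounds and \<open>d + 2\<close> holds the bound index.\<close>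

fun ecomp :: "(nat \<Rightarrow> nat) \<Rightarrow> nat \<Rightarrow> exp \<Rightarrow> com" where
  "ecomp \<rho> d (Var k) = Loop (\<rho> k) (Inc d ;; Inc (d + 1)) ;; Loop (d + 1) (Inc (\<rho> k))"
| "ecomp \<rho> d Len = Loop 0 (Inc d ;; Inc (d + 1)) ;; Loop (d + 1) (Inc 0)"
| "ecomp \<rho> d (Cst n) = ((\<lambda>c. Inc d ;; c) ^^ n) Skip"
| "ecomp \<rho> d (Bit a) = ecomp \<rho> (d + 1) a ;; Loop (d + 1) (MvR ;; Inc (d + 2)) ;; IncBit d ;;
     Loop (d + 2) MvL"
| "ecomp \<rho> d (Add a b) = ecomp \<rho> d a ;; ecomp \<rho> (d + 1) b ;; Loop (d + 1) (Inc d)"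
| "ecomp \<rho> d (Sub a b) = ecomp \<rho> d a ;; ecomp \<rho> (d + 1) b ;; Loop (d + 1) (Dec d)"
| "ecomp \<rho> d (Bsum a b) = ecomp \<rho> (d + 1) a ;;
     Loop (d + 1) (ecomp (case_nat (d + 2) \<rho>) (d + 3) b ;; Loop (d + 3) (Inc d) ;; Inc (d + 2)) ;;
     Loop (d + 2) Skip"

fun time_bound :: "exp \<Rightarrow> nat poly" where
  "time_bound (Cst n) = [:n:]"
| "time_bound (Bit a) = time_bound a + smult 7 (val_bound a) + 3"
| "time_bound (Add a b) = time_bound a + time_bound b + smult 3 (val_bound b) + 1"
| "time_bound (Sub a b) = time_bound a + time_bound b + smult 3 (val_bound b) + 1"
| "time_bound (Bsum a b) = time_bound a + smult 2 (val_bound a) + 2 + val_bound a *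
     (pcompose (time_bound b + smult 3 (val_bound b)) ([:0, 1:] + val_bound a) + 4)"
| "time_bound _ = [:2, 7:]"

text \<open>The registers from \<open>d\<close> on are scratch space, register 0 keeps the input
  length throughout, and \<open>m\<close> is the number at which the polynomial bounds are
  evaluated.\<close>

definition fits :: "bool list \<Rightarrow> (nat \<Rightarrow> nat) \<Rightarrow> nat \<Rightarrow> (nat \<Rightarrow> nat) \<Rightarrow> nat \<Rightarrow> bool" where
  "fits x \<rho> d g m \<longleftrightarrow> 0 < d \<and> (\<forall>k. \<rho> k < d) \<and> (\<forall>r\<ge>d. g r = 0) \<and> g 0 = length x \<and>
     (\<forall>k. g (\<rho> k) \<le> m) \<and> length x \<le> m"

lemma fits_upd:
  assumes "fits x \<rho> d g m"
  shows "fits x \<rho> (Suc d) (g(d := v)) m"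
proof -
  have *: "0 < d" "\<And>k. \<rho> k < d" "\<And>r. d \<le> r \<Longrightarrow> g r = 0" "g 0 = length x" "\<And>k. g (\<rho> k) \<le> m" "length x \<le> m"
    using assms unfolding fits_def by blast+
  have "\<rho> k \<noteq> d" for k using *(2)[of k] by simp
  with * show ?thesis unfolding fits_def by (simp add: less_SucI)
qed

lemma comp_upd: "\<forall>k. \<rho> k < d \<Longrightarrow> g(d := v) \<circ> \<rho> = g \<circ> (\<rho> :: nat \<Rightarrow> nat)"
  by (auto simp: fun_eq_iff less_le)

lemma fits_Suc: "fits x \<rho> d g m \<Longrightarrow> fits x \<rho> (Suc d) g m"
  unfolding fits_def by (simp add: less_SucI)

lemma fits_case:
  assumes "fits x \<rho> d g m" "i \<le> n"
  shows "fits x (case_nat (d + 2) \<rho>) (d + 3) (g(d := u, d + 2 := i, d + 1 := v)) (m + n)"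
proof -
  have "case_nat (d + 2) \<rho> k < d + 3" for k
    using assms unfolding fits_def by (cases k) (auto intro: less_trans)
  moreover have "(g(d := u, d + 2 := i, d + 1 := v)) (case_nat (d + 2) \<rho> k) \<le> m + n" for k
  proof (cases k)
    case (Suc k')
    have "\<rho> k' < d" "g (\<rho> k') \<le> m" using assms unfolding fits_def by auto
    with Suc show ?thesis by simp
  qed (use assms in simp)
  ultimately show ?thesis using assms unfolding fits_def by auto
qed

lemma comp_case:
  fixes \<rho> :: "nat \<Rightarrow> nat"
  assumes "\<forall>k. \<rho> k < d"
  shows "g(d := u, d + 2 := i, d + 1 := v) \<circ> case_nat (d + 2) \<rho> = case_nat i (g \<circ> \<rho>)"
proof
  fix k
  show "(g(d := u, d + 2 := i, d + 1 := v) \<circ> case_nat (d + 2) \<rho>) k = case_nat i (g \<circ> \<rho>) k"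
  proof (cases k)
    case (Suc k')
    have "\<rho> k' < d" using assms by simp
    with Suc show ?thesis by simp
  qed simp
qed

lemma symb_nonneg: "0 \<le> p \<Longrightarrow> symb x p \<noteq> 0 \<longleftrightarrow> p < int (length x)"
  by (auto simp: input_tape_def bit_symbol_def)

lemma ecomp_runs:
  assumes "fits x \<rho> d g m"
  shows "runs x (ecomp \<rho> d e) (g, 0, w) (poly (time_bound e) m) (g(d := eval x (g \<circ> \<rho>) e), 0, w)"
  using assms
proof (induction e arbitrary: \<rho> d g m)
  case (Var k)
  then have "\<rho> k < d" "g (\<rho> k) \<le> m" unfolding fits_def by auto
  then have "\<rho> k \<noteq> d" "\<rho> k \<noteq> Suc d" "g (\<rho> k) \<le> m" by auto
  with Var show ?case unfolding ecomp.simps fits_def by (intro runs_copy) auto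
next
  case Len
  then show ?case unfolding ecomp.simps fits_def by (intro runs_copy) auto
next
  case (Cst n)
  have "runs x (((\<lambda>c. Inc d ;; c) ^^ n) Skip) (g, 0, w) n (g(d := g d + n), 0, w)" for g
  proof (induction n arbitrary: g)
    case (Suc n)
    show ?case unfolding funpow.simps comp_def
    proof (intro runs_Seq)
      show "runs x (Inc d) (g, 0, w) 1 (g(d := Suc (g d)), 0, w)" by (auto intro: runs_basic)
      show "runs x (((\<lambda>c. Inc d ;; c) ^^ n) Skip) (g(d := Suc (g d)), 0, w) n (g(d := g d + Suc n), 0, w)"
        using Suc[of "g(d := Suc (g d))"] by (simp only: fun_upd_upd fun_upd_same add_Suc add_Suc_right)
    qed simp
  qed (auto intro: runs_basic)
  from this[of g] have "runs x (((\<lambda>c. Inc d ;; c) ^^ n) Skip) (g, 0, w) n (g(d := n), 0, w)"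
    using Cst unfolding fits_def by (metis add_0 order_refl)
  then show ?case by (simp only: ecomp.simps eval.simps time_bound.simps poly_pCons poly_0 mult_zero_right add_0_right)
next
  case (Bit a)
  let ?n = "eval x (g \<circ> \<rho>) a"
  have z: "\<forall>r\<ge>d. g r = 0" and n: "?n \<le> poly (val_bound a) m"
    using Bit.prems unfolding fits_def by (auto intro!: eval_bound)
  show ?case unfolding ecomp.simps
  proof (intro runs_Seq)
    show "runs x (ecomp \<rho> (d + 1) a) (g, 0, w) (poly (time_bound a) m) (g(d + 1 := ?n), 0, w)"
      using Bit.IH[OF fits_Suc[OF Bit.prems]] by (simp only: Suc_eq_plus1)
    \<comment> \<open>While the head walks to the requested cell, register \<open>d + 2\<close>
      records the distance for the way back.\<close>
    have body: "runs x (MvR ;; Inc (d + 2)) (g(d + 2 := i, d + 1 := k), int i, w) 2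
        (g(d + 2 := Suc i, d + 1 := k), int (Suc i), w)" for i k
    proof (rule runs_Seq)
      show "runs x MvR (g(d + 2 := i, d + 1 := k), int i, w) 1 (g(d + 2 := i, d + 1 := k), int (Suc i), w)"
        by (rule runs_basic) auto
      show "runs x (Inc (d + 2)) (g(d + 2 := i, d + 1 := k), int (Suc i), w) 1
          (g(d + 2 := Suc i, d + 1 := k), int (Suc i), w)"
        by (rule runs_basic) (auto simp: fun_eq_iff)
    qed simp
    show "runs x (Loop (d + 1) (MvR ;; Inc (d + 2))) (g(d + 1 := ?n), 0, w) (4 * poly (val_bound a) m + 1)
        (g(d + 2 := ?n), int ?n, w)"
      by (rule runs_for[where n = ?n and f = "\<lambda>i. g(d + 2 := i)" and p = int and w = "\<lambda>_. w" and B = 2,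
            OF body])
        (use n z in \<open>auto simp: fun_eq_iff\<close>)
    show "runs x (IncBit d) (g(d + 2 := ?n), int ?n, w) 1
       (g(d + 2 := ?n, d := eval x (g \<circ> \<rho>) (Bit a)), int ?n, w)"
      using z by (auto intro: runs_basic)
    show "runs x (Loop (d + 2) MvL) (g(d + 2 := ?n, d := eval x (g \<circ> \<rho>) (Bit a)), int ?n, w)
       (3 * poly (val_bound a) m + 1) (g(d := eval x (g \<circ> \<rho>) (Bit a)), 0, w)"
      by (rule runs_for[where n = ?n and f = "\<lambda>i. g(d := eval x (g \<circ> \<rho>) (Bit a))"
          and p = "\<lambda>i. int ?n - int i" and w = "\<lambda>_. w" and B = 1])
        (use n z in \<open>auto intro!: runs_basic simp del: eval.simps\<close>)
  qed auto
next
  case (Add a b)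
  let ?u = "eval x (g \<circ> \<rho>) a" and ?v = "eval x (g \<circ> \<rho>) b"
  have z: "\<forall>r\<ge>d. g r = 0" and v: "?v \<le> poly (val_bound b) m" and \<rho>: "\<forall>k. \<rho> k < d"
    using Add.prems unfolding fits_def by (auto intro!: eval_bound)
  show ?case unfolding ecomp.simps
  proof (intro runs_Seq)
    show "runs x (ecomp \<rho> d a) (g, 0, w) (poly (time_bound a) m) (g(d := ?u), 0, w)"
      by (rule Add.IH(1)[OF Add.prems])
    show "runs x (ecomp \<rho> (d + 1) b) (g(d := ?u), 0, w) (poly (time_bound b) m) (g(d := ?u, d + 1 := ?v), 0, w)"
      using Add.IH(2)[OF fits_upd[OF Add.prems], of ?u] by (simp only: comp_upd[OF \<rho>] Suc_eq_plus1)
    show "runs x (Loop (d + 1) (Inc d)) (g(d := ?u, d + 1 := ?v), 0, w)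
       (3 * poly (val_bound b) m + 1) (g(d := eval x (g \<circ> \<rho>) (Add a b)), 0, w)"
      by (rule runs_move) (use z v in auto)
  qed auto
next
  case (Sub a b)
  let ?u = "eval x (g \<circ> \<rho>) a" and ?v = "eval x (g \<circ> \<rho>) b"
  have z: "\<forall>r\<ge>d. g r = 0" and v: "?v \<le> poly (val_bound b) m" and \<rho>: "\<forall>k. \<rho> k < d"
    using Sub.prems unfolding fits_def by (auto intro!: eval_bound)
  show ?case unfolding ecomp.simps
  proof (intro runs_Seq)
    show "runs x (ecomp \<rho> d a) (g, 0, w) (poly (time_bound a) m) (g(d := ?u), 0, w)"
      by (rule Sub.IH(1)[OF Sub.prems])
    show "runs x (ecomp \<rho> (d + 1) b) (g(d := ?u), 0, w) (poly (time_bound b) m) (g(d := ?u, d + 1 := ?v), 0, w)"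
      using Sub.IH(2)[OF fits_upd[OF Sub.prems], of ?u] by (simp only: comp_upd[OF \<rho>] Suc_eq_plus1)
    show "runs x (Loop (d + 1) (Dec d)) (g(d := ?u, d + 1 := ?v), 0, w)
       (3 * poly (val_bound b) m + 1) (g(d := eval x (g \<circ> \<rho>) (Sub a b)), 0, w)"
      by (rule runs_diff) (use z v in auto)
  qed auto
next
  case (Bsum a b)
  let ?n = "eval x (g \<circ> \<rho>) a" and ?v = "\<lambda>i. eval x (case_nat i (g \<circ> \<rho>)) b"
  let ?m = "poly (val_bound a) m"
  let ?B = "poly (time_bound b) (m + ?m) + 3 * poly (val_bound b) (m + ?m) + 2"
  let ?f = "\<lambda>i. g(d := \<Sum>j<i. ?v j, d + 2 := i)"
  have z: "\<forall>r\<ge>d. g r = 0" and n: "?n \<le> ?m" and \<rho>: "\<forall>k. \<rho> k < d"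
    and bd: "\<forall>k. (g \<circ> \<rho>) k \<le> m" "length x \<le> m"
    using Bsum.prems unfolding fits_def by (auto intro!: eval_bound)
  have body: "runs x (ecomp (case_nat (d + 2) \<rho>) (d + 3) b ;; Loop (d + 3) (Inc d) ;; Inc (d + 2))
      ((?f i)(d + 1 := ?n - Suc i), 0, w) ?B ((?f (Suc i))(d + 1 := ?n - Suc i), 0, w)"
    if "i < ?n" for i
  proof (intro runs_Seq)
    let ?g = "(?f i)(d + 1 := ?n - Suc i)"
    have i: "i \<le> ?m" using that n by simp
    have v: "?v i \<le> poly (val_bound b) (m + ?m)"
      using bd i by (intro eval_bound allI case_nat_bound) auto
    show "runs x (ecomp (case_nat (d + 2) \<rho>) (d + 3) b) (?g, 0, w)
        (poly (time_bound b) (m + ?m)) (?g(d + 3 := ?v i), 0, w)"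
      using Bsum.IH(2)[OF fits_case[OF Bsum.prems i]] unfolding comp_case[OF \<rho>] .
    show "runs x (Loop (d + 3) (Inc d)) (?g(d + 3 := ?v i), 0, w) (3 * poly (val_bound b) (m + ?m) + 1)
        (?g(d := \<Sum>j<Suc i. ?v j), 0, w)"
      by (rule runs_move) (use z v in \<open>auto simp: fun_eq_iff\<close>)
    show "runs x (Inc (d + 2)) (?g(d := \<Sum>j<Suc i. ?v j), 0, w) 1
        ((?f (Suc i))(d + 1 := ?n - Suc i), 0, w)"
      by (rule runs_basic) (auto simp: fun_eq_iff)
  qed auto
  \<comment> \<open>The number of rounds depends on the registers, whereas the time bound may depend
    on \<open>m\<close> only.\<close>
  have le: "?n * (?B + 2) + 1 \<le> ?m * (?B + 2) + 1"
    using n by (intro add_right_mono mult_right_mono) auto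
  show ?case unfolding ecomp.simps
  proof (intro runs_Seq)
    show "runs x (ecomp \<rho> (d + 1) a) (g, 0, w) (poly (time_bound a) m) (g(d + 1 := ?n), 0, w)"
      using Bsum.IH(1)[OF fits_Suc[OF Bsum.prems]] by (simp only: Suc_eq_plus1)
    show "runs x (Loop (d + 1) (ecomp (case_nat (d + 2) \<rho>) (d + 3) b ;; Loop (d + 3) (Inc d) ;; Inc (d + 2)))
        (g(d + 1 := ?n), 0, w) (?m * (?B + 2) + 1) ((?f ?n)(d + 1 := 0), 0, w)"
      by (rule runs_for[where n = ?n and f = ?f and p = "\<lambda>_. 0" and w = "\<lambda>_. w" and B = ?B,
            OF body _ _ _ _ _ _ le])
        (use z in \<open>auto simp: fun_eq_iff\<close>)
    show "runs x (Loop (d + 2) Skip) ((?f ?n)(d + 1 := 0), 0, w) (2 * ?m + 1)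
        (g(d := eval x (g \<circ> \<rho>) (Bsum a b)), 0, w)"
      by (rule runs_clear) (use n z in \<open>auto simp: fun_eq_iff\<close>)
  qed (auto simp: poly_pcompose algebra_simps)
qed

section \<open>Programs that print strings\<close>

datatype pr = PBit exp | PSeq pr pr | PFor exp pr

fun peval :: "bool list \<Rightarrow> (nat \<Rightarrow> nat) \<Rightarrow> pr \<Rightarrow> bool list" where
  "peval x s (PBit a) = [eval x s a \<noteq> 0]"
| "peval x s (PSeq b c) = peval x s b @ peval x s c"
| "peval x s (PFor a b) = concat (map (\<lambda>i. peval x (case_nat i s) b) [0..<eval x s a])"

text \<open>For a single bit, \<open>1 - a\<close> and \<open>1 - (1 - a)\<close> are complementary
  flags, so exactly one of the two loops prints, and it prints once.\<close>

fun pcomp :: "(nat \<Rightarrow> nat) \<Rightarrow> nat \<Rightarrow> pr \<Rightarrow> com" where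
  "pcomp \<rho> d (PBit a) = ecomp \<rho> d (Sub (Cst 1) a) ;; ecomp \<rho> (d + 1) (Sub (Cst 1) (Sub (Cst 1) a)) ;;
     Loop d (Out False) ;; Loop (d + 1) (Out True)"
| "pcomp \<rho> d (PSeq b c) = pcomp \<rho> d b ;; pcomp \<rho> d c"
| "pcomp \<rho> d (PFor a b) = ecomp \<rho> (d + 1) a ;;
     Loop (d + 1) (pcomp (case_nat (d + 2) \<rho>) (d + 3) b ;; Inc (d + 2)) ;; Loop (d + 2) Skip"

fun ptime_bound :: "pr \<Rightarrow> nat poly" where
  "ptime_bound (PBit a) = time_bound (Sub (Cst 1) a) + time_bound (Sub (Cst 1) (Sub (Cst 1) a)) + 8"
| "ptime_bound (PSeq b c) = ptime_bound b + ptime_bound c"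
| "ptime_bound (PFor a b) = time_bound a + smult 2 (val_bound a) + 2 + val_bound a *
     (pcompose (ptime_bound b) ([:0, 1:] + val_bound a) + 3)"

lemma runs_print:
  assumes "g a \<le> 1" "g' = g(a := 0)" "w' = w @ replicate (g a) b" "4 \<le> T"
  shows "runs x (Loop a (Out b)) (g, p, w) T (g', p, w')"
  by (rule runs_for[where n = "g a" and f = "\<lambda>i. g" and p = "\<lambda>_. p" and w = "\<lambda>i. w @ replicate i b" and B = 1])
    (use assms in \<open>auto intro!: runs_basic simp: replicate_append_same\<close>)

lemma pcomp_runs:
  assumes "fits x \<rho> d g m"
  shows "runs x (pcomp \<rho> d e) (g, 0, w) (poly (ptime_bound e) m) (g, 0, w @ peval x (g \<circ> \<rho>) e)"
  using assms
proof (induction e arbitrary: \<rho> d g m w)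
  case (PBit a)
  let ?a = "Sub (Cst 1) a" and ?b = "Sub (Cst 1) (Sub (Cst 1) a)"
  let ?u = "eval x (g \<circ> \<rho>) ?a" and ?v = "eval x (g \<circ> \<rho>) ?b"
  have z: "\<forall>r\<ge>d. g r = 0" and \<rho>: "\<forall>k. \<rho> k < d"
    using PBit.prems unfolding fits_def by auto
  show ?case unfolding pcomp.simps
  proof (intro runs_Seq)
    show "runs x (ecomp \<rho> d ?a) (g, 0, w) (poly (time_bound ?a) m) (g(d := ?u), 0, w)"
      by (rule ecomp_runs[OF PBit.prems])
    show "runs x (ecomp \<rho> (d + 1) ?b) (g(d := ?u), 0, w) (poly (time_bound ?b) m) (g(d := ?u, d + 1 := ?v), 0, w)"
      using ecomp_runs[OF fits_upd[OF PBit.prems], where v1 = ?u and e = ?b] by (simp only: comp_upd[OF \<rho>] Suc_eq_plus1)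
    show "runs x (Loop d (Out False)) (g(d := ?u, d + 1 := ?v), 0, w) 4
        (g(d + 1 := ?v), 0, w @ replicate ?u False)"
      by (rule runs_print) (use z in \<open>auto simp: fun_eq_iff\<close>)
    show "runs x (Loop (d + 1) (Out True)) (g(d + 1 := ?v), 0, w @ replicate ?u False) 4
        (g, 0, w @ peval x (g \<circ> \<rho>) (PBit a))"
      by (rule runs_print) (use z in \<open>auto simp: fun_eq_iff, cases "eval x (g \<circ> \<rho>) a", auto\<close>)
  qed auto
next
  case (PSeq b c)
  show ?case unfolding pcomp.simps
  proof (intro runs_Seq)
    show "runs x (pcomp \<rho> d b) (g, 0, w) (poly (ptime_bound b) m) (g, 0, w @ peval x (g \<circ> \<rho>) b)"
      by (rule PSeq.IH(1)[OF PSeq.prems])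
    show "runs x (pcomp \<rho> d c) (g, 0, w @ peval x (g \<circ> \<rho>) b) (poly (ptime_bound c) m)
        (g, 0, w @ peval x (g \<circ> \<rho>) (PSeq b c))"
      using PSeq.IH(2)[OF PSeq.prems, of "w @ peval x (g \<circ> \<rho>) b"]
      by (simp only: peval.simps append_assoc)
  qed simp
next
  case (PFor a b)
  let ?n = "eval x (g \<circ> \<rho>) a" and ?v = "\<lambda>i. peval x (case_nat i (g \<circ> \<rho>)) b"
  let ?m = "poly (val_bound a) m"
  let ?B = "poly (ptime_bound b) (m + ?m) + 1"
  let ?f = "\<lambda>i. g(d := 0, d + 2 := i)" and ?w = "\<lambda>i. w @ concat (map ?v [0..<i])"
  have z: "\<forall>r\<ge>d. g r = 0" and n: "?n \<le> ?m" and \<rho>: "\<forall>k. \<rho> k < d"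
    using PFor.prems unfolding fits_def by (auto intro!: eval_bound)
  have body: "runs x (pcomp (case_nat (d + 2) \<rho>) (d + 3) b ;; Inc (d + 2))
      ((?f i)(d + 1 := ?n - Suc i), 0, ?w i) ?B ((?f (Suc i))(d + 1 := ?n - Suc i), 0, ?w (Suc i))"
    if "i < ?n" for i
  proof (intro runs_Seq)
    let ?g = "(?f i)(d + 1 := ?n - Suc i)"
    have i: "i \<le> ?m" using that n by simp
    show "runs x (pcomp (case_nat (d + 2) \<rho>) (d + 3) b) (?g, 0, ?w i)
        (poly (ptime_bound b) (m + ?m)) (?g, 0, ?w (Suc i))"
      using PFor.IH[OF fits_case[OF PFor.prems i], where w = "?w i"] unfolding comp_case[OF \<rho>]
      by (simp only: upt_Suc_append zero_le map_append concat_append list.map concat.simps append_Nil2 append_assoc)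
    show "runs x (Inc (d + 2)) (?g, 0, ?w (Suc i)) 1
        ((?f (Suc i))(d + 1 := ?n - Suc i), 0, ?w (Suc i))"
      by (rule runs_basic) (auto simp: fun_eq_iff)
  qed auto
  have le: "?n * (?B + 2) + 1 \<le> ?m * (?B + 2) + 1"
    using n by (intro add_right_mono mult_right_mono) auto
  show ?case unfolding pcomp.simps
  proof (intro runs_Seq)
    show "runs x (ecomp \<rho> (d + 1) a) (g, 0, w) (poly (time_bound a) m) (g(d + 1 := ?n), 0, w)"
      using ecomp_runs[OF fits_Suc[OF PFor.prems]] by (simp only: Suc_eq_plus1)
    show "runs x (Loop (d + 1) (pcomp (case_nat (d + 2) \<rho>) (d + 3) b ;; Inc (d + 2)))
        (g(d + 1 := ?n), 0, w) (?m * (?B + 2) + 1) ((?f ?n)(d + 1 := 0), 0, ?w ?n)"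
      by (rule runs_for[where n = ?n and f = ?f and p = "\<lambda>_. 0" and w = ?w and B = ?B,
            OF body _ _ _ _ _ _ le])
        (use z in \<open>auto simp: fun_eq_iff\<close>)
    show "runs x (Loop (d + 2) Skip) ((?f ?n)(d + 1 := 0), 0, ?w ?n) (2 * ?m + 1)
        (g, 0, w @ peval x (g \<circ> \<rho>) (PFor a b))"
      by (simp only: peval.simps, rule runs_clear) (use n z in \<open>auto simp: fun_eq_iff\<close>)
  qed (auto simp: poly_pcompose algebra_simps)
qed

lemma scan_runs:
  "p + k = length x \<Longrightarrow> runs x (Scan r) (g, int p, w) (k + 1) (g(r := g r + k), int (length x), w)"
proof (induction k arbitrary: p g)
  case 0
  then show ?case unfolding runs_def
    by (intro exI[of _ 1]) (auto intro!: big.ScanEnd[unfolded One_nat_def] simp: input_tape_def)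
next
  case (Suc k)
  obtain t where "t \<le> k + 1"
    "big x (Scan r) (g(r := Suc (g r)), int (Suc p), w) t (g(r := g r + Suc k), int (length x), w)"
    using Suc.IH[of "Suc p" "g(r := Suc (g r))"] Suc.prems unfolding runs_def by auto
  moreover have "symb x (int p) \<noteq> 0" using Suc.prems by (subst symb_nonneg) auto
  ultimately show ?case unfolding runs_def
    by (intro exI[of _ "Suc t"]) (auto intro!: big.ScanStep simp: add.commute)
qed

text \<open>Scanning leaves the head behind the input. The head is brought back while the count
  passes through register 1, which is 0 again afterwards and then serves as the register of every
  free variable of \<open>e\<close>.\<close>

definition main_com :: "pr \<Rightarrow> com" where
  "main_com e = Scan 0 ;; Loop 0 (MvL ;; Inc 1) ;; Loop 1 (Inc 0) ;; pcomp (\<lambda>_. 1) 2 e"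

lemma main_runs:
  "\<exists>g. runs x (main_com e) (\<lambda>_. 0, 0, []) (poly ([:3, 8:] + ptime_bound e) (length x))
     (g, 0, peval x (\<lambda>_. 0) e)"
proof -
  let ?n = "length x" and ?g = "(\<lambda>_. 0)(0 := length x) :: nat \<Rightarrow> nat"
  have "runs x (main_com e) (\<lambda>_. 0, 0, []) (poly ([:3, 8:] + ptime_bound e) (length x))
     (?g, 0, [] @ peval x (?g \<circ> (\<lambda>_. 1)) e)"
    unfolding main_com_def
  proof (intro runs_Seq)
    show "runs x (Scan 0) (\<lambda>_. 0, 0, []) (?n + 1) (?g, int ?n, [])"
      using scan_runs[of 0 ?n x 0 "\<lambda>_. 0"] by simp
    have body: "runs x (MvL ;; Inc 1) ((\<lambda>_. 0)(1 := i, 0 := k), int ?n - int i, []) 2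
        ((\<lambda>_. 0)(1 := Suc i, 0 := k), int ?n - int (Suc i), [])" for i k
    proof (rule runs_Seq)
      show "runs x MvL ((\<lambda>_. 0)(1 := i, 0 := k), int ?n - int i, []) 1
          ((\<lambda>_. 0)(1 := i, 0 := k), int ?n - int (Suc i), [])"
        by (rule runs_basic) auto
      show "runs x (Inc 1) ((\<lambda>_. 0)(1 := i, 0 := k), int ?n - int (Suc i), []) 1
          ((\<lambda>_. 0)(1 := Suc i, 0 := k), int ?n - int (Suc i), [])"
        by (rule runs_basic) (auto simp: fun_eq_iff)
    qed simp
    show "runs x (Loop 0 (MvL ;; Inc 1)) (?g, int ?n, []) (4 * ?n + 1) ((\<lambda>_. 0)(1 := ?n), 0, [])"
      by (rule runs_for[where n = ?n and f = "\<lambda>i. (\<lambda>_. 0)(1 := i)"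
          and p = "\<lambda>i. int ?n - int i" and w = "\<lambda>_. []" and B = 2, OF body])
        (auto simp: fun_eq_iff)
    show "runs x (Loop 1 (Inc 0)) ((\<lambda>_. 0)(1 := ?n), 0, []) (3 * ?n + 1) (?g, 0, [])"
      by (rule runs_move) auto
    show "runs x (pcomp (\<lambda>_. 1) 2 e) (?g, 0, []) (poly (ptime_bound e) ?n)
        (?g, 0, [] @ peval x (?g \<circ> (\<lambda>_. 1)) e)"
      by (rule pcomp_runs) (auto simp: fits_def)
  qed auto
  then show ?thesis by (auto simp: comp_def)
qed

theorem poly_time_peval: "poly_time_computable (\<lambda>x. peval x (\<lambda>_. 0) e)"
proof -
  define c where "c = main_com e"
  define p where "p = 1 + ([:3, 8:] + ptime_bound e)"
  obtain R where R: "regs c \<subseteq> {..<R}"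
    using finite_nat_bounded[OF finite_regs] ..
  have 1: "wf_tm (tm_of R (compile c 0))"
    by (rule wf_tm_of) (use targets_compile[of _ c 0] in simp)
  have 2: "outputs_within (tm_of R (compile c 0)) [x] (peval x (\<lambda>_. 0) e) (poly p (length x))" for x
  proof -
    obtain g t where t: "t \<le> poly ([:3, 8:] + ptime_bound e) (length x)"
      and b: "big x c (\<lambda>_. 0, 0, []) t (g, 0, peval x (\<lambda>_. 0) e)"
      using main_runs[of x e] unfolding runs_def c_def by blast
    show ?thesis using outputs_compile[OF b t R] unfolding p_def by (simp only: poly_add poly_1 plus_1_eq_Suc)
  qed
  show ?thesis unfolding poly_time_computable_def
    by (rule exI[of _ "tm_of R (compile c 0)"], rule exI[of _ p]) (simp only: 1 2 simp_thms)
qed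

section \<open>Closure properties of expressible functions\<close>

definition expressible :: "(bool list \<Rightarrow> (nat \<Rightarrow> nat) \<Rightarrow> nat) \<Rightarrow> bool" where
  "expressible f \<longleftrightarrow> (\<exists>e. \<forall>x s. eval x s e = f x s)"

definition decidable :: "(bool list \<Rightarrow> (nat \<Rightarrow> nat) \<Rightarrow> bool) \<Rightarrow> bool" where
  "decidable P \<longleftrightarrow> expressible (\<lambda>x s. of_bool (P x s))"

definition printable :: "(bool list \<Rightarrow> (nat \<Rightarrow> nat) \<Rightarrow> bool list) \<Rightarrow> bool" where
  "printable f \<longleftrightarrow> (\<exists>e. \<forall>x s. peval x s e = f x s)"

named_theorems expr

lemma expressible_var [expr]: "expressible (\<lambda>x s. s k)"
  unfolding expressible_def by (rule exI[of _ "Var k"]) simp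

lemma expressible_length [expr]: "expressible (\<lambda>x s. length x)"
  unfolding expressible_def by (rule exI[of _ Len]) simp

lemma expressible_const [expr]: "expressible (\<lambda>x s. n)"
  unfolding expressible_def by (rule exI[of _ "Cst n"]) simp

lemma expressible_add [expr]: "expressible f \<Longrightarrow> expressible g \<Longrightarrow> expressible (\<lambda>x s. f x s + g x s)"
  unfolding expressible_def by (metis eval.simps(5))

lemma expressible_diff [expr]: "expressible f \<Longrightarrow> expressible g \<Longrightarrow> expressible (\<lambda>x s. f x s - g x s)"
  unfolding expressible_def by (metis eval.simps(6))

text \<open>The body is required with its index as variable 0 and the other variables shifted, which
  is how de Bruijn binding looks from outside the syntax. The rules for quantifiers and for printing
  have the same shape.\<close>

lemma expressible_sum [expr]:
  assumes "expressible f" "expressible (\<lambda>x s. g x (\<lambda>j. s (Suc j)) (s 0))"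
  shows "expressible (\<lambda>x s. \<Sum>i<f x s. g x s i)"
proof -
  obtain a b where "\<And>x s. eval x s a = f x s" "\<And>x s. eval x s b = g x (\<lambda>j. s (Suc j)) (s 0)"
    using assms unfolding expressible_def by blast
  then show ?thesis unfolding expressible_def by (intro exI[of _ "Bsum a b"]) simp
qed

fun rename :: "(nat \<Rightarrow> nat) \<Rightarrow> exp \<Rightarrow> exp" where
  "rename \<pi> (Var k) = Var (\<pi> k)"
| "rename \<pi> Len = Len"
| "rename \<pi> (Cst n) = Cst n"
| "rename \<pi> (Bit a) = Bit (rename \<pi> a)"
| "rename \<pi> (Add a b) = Add (rename \<pi> a) (rename \<pi> b)"
| "rename \<pi> (Sub a b) = Sub (rename \<pi> a) (rename \<pi> b)"
| "rename \<pi> (Bsum a b) = Bsum (rename \<pi> a) (rename (case_nat 0 (\<lambda>j. Suc (\<pi> j))) b)"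

text \<open>Renaming with \<open>Suc\<close> prevents the substituted expressions from capturing the
  index of the sum.\<close>

fun subst :: "(nat \<Rightarrow> exp) \<Rightarrow> exp \<Rightarrow> exp" where
  "subst \<sigma> (Var k) = \<sigma> k"
| "subst \<sigma> Len = Len"
| "subst \<sigma> (Cst n) = Cst n"
| "subst \<sigma> (Bit a) = Bit (subst \<sigma> a)"
| "subst \<sigma> (Add a b) = Add (subst \<sigma> a) (subst \<sigma> b)"
| "subst \<sigma> (Sub a b) = Sub (subst \<sigma> a) (subst \<sigma> b)"
| "subst \<sigma> (Bsum a b) = Bsum (subst \<sigma> a) (subst (case_nat (Var 0) (\<lambda>j. rename Suc (\<sigma> j))) b)"

lemma eval_rename: "eval x s (rename \<pi> e) = eval x (\<lambda>j. s (\<pi> j)) e"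
proof (induction e arbitrary: s \<pi>)
  case (Bsum a b)
  have "(\<lambda>j. case_nat i s (case_nat 0 (\<lambda>j. Suc (\<pi> j)) j)) = case_nat i (\<lambda>j. s (\<pi> j))" for i
    by (rule ext) (simp split: nat.split)
  then show ?case by (simp add: Bsum)
qed auto

lemma eval_subst: "eval x s (subst \<sigma> e) = eval x (\<lambda>j. eval x s (\<sigma> j)) e"
proof (induction e arbitrary: s \<sigma>)
  case (Bsum a b)
  have "(\<lambda>j. eval x (case_nat i s) (case_nat (Var 0) (\<lambda>j. rename Suc (\<sigma> j)) j))
      = case_nat i (\<lambda>j. eval x s (\<sigma> j))" for i
    by (rule ext) (simp split: nat.split add: eval_rename)
  then show ?case by (simp add: Bsum)
qed auto

text \<open>This allows a function that was analyzed once, in the variables \<open>s 0\<close>,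
  \<open>s 1\<close>, ..., to be applied to computed arguments without unfolding it again.\<close>

lemma expressible_comp:
  assumes "expressible f" "\<And>j. expressible (g j)"
  shows "expressible (\<lambda>x s. f x (\<lambda>j. g j x s))"
proof -
  obtain e where "\<And>x s. eval x s e = f x s"
    using assms(1) unfolding expressible_def by blast
  moreover obtain \<sigma> where "\<And>j x s. eval x s (\<sigma> j) = g j x s"
    using assms(2) unfolding expressible_def by metis
  ultimately have "eval x s (subst \<sigma> e) = f x (\<lambda>j. g j x s)" for x s
    by (simp add: eval_subst)
  then show ?thesis unfolding expressible_def by blast
qed

lemma expressible_comp4:
  assumes "expressible (\<lambda>x s. f x (s 0) (s 1) (s 2) (s 3))"
    "expressible a" "expressible b" "expressible c" "expressible d"
  shows "expressible (\<lambda>x s. f x (a x s) (b x s) (c x s) (d x s))"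
proof -
  have "expressible (if j = 0 then a else if j = 1 then b else if j = 2 then c else d)" for j :: nat
    using assms(2-5) by simp
  from expressible_comp[OF assms(1), of "\<lambda>j. if j = 0 then a else if j = 1 then b else if j = 2 then c else d", OF this]
  show ?thesis by simp
qed

lemma expressible_comp3:
  assumes "expressible (\<lambda>x s. f x (s 0) (s 1) (s 2))"
    "expressible a" "expressible b" "expressible c"
  shows "expressible (\<lambda>x s. f x (a x s) (b x s) (c x s))"
  using expressible_comp4[where f = "\<lambda>x i j k l. f x i j k", OF _ assms(2-4) expressible_const] assms(1) by simp

lemma expressible_comp2:
  assumes "expressible (\<lambda>x s. f x (s 0) (s 1))" "expressible a" "expressible b"
  shows "expressible (\<lambda>x s. f x (a x s) (b x s))"
  using expressible_comp3[where f = "\<lambda>x i j k. f x i j", OF _ assms(2-3) expressible_const] assms(1) by simp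

lemma expressible_comp1:
  assumes "expressible (\<lambda>x s. f x (s 0))" "expressible a"
  shows "expressible (\<lambda>x s. f x (a x s))"
  using expressible_comp2[where f = "\<lambda>x i j. f x i", OF _ assms(2) expressible_const] assms(1) by simp

lemmas decidable_comp2 = expressible_comp2[where f = "\<lambda>x i j. of_bool (P x i j)" for P, folded decidable_def]
  and decidable_comp3 = expressible_comp3[where f = "\<lambda>x i j k. of_bool (P x i j k)" for P, folded decidable_def]

lemma expressible_mult [expr]:
  assumes "expressible f" "expressible g"
  shows "expressible (\<lambda>x s. f x s * g x s)"
proof -
  have "expressible (\<lambda>x s. \<Sum>i<s 0. s 1)" by (intro expr)
  then have "expressible (\<lambda>x s. s 0 * s 1)" by simp
  from expressible_comp2[OF this assms] show ?thesis .
qed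

lemma expressible_of_bool [expr]: "decidable P \<Longrightarrow> expressible (\<lambda>x s. of_bool (P x s))"
  unfolding decidable_def .

lemma decidable_const [expr]: "decidable (\<lambda>x s. b)"
  unfolding decidable_def by (rule expressible_const)

lemma decidable_not [expr]:
  assumes "decidable P"
  shows "decidable (\<lambda>x s. \<not> P x s)"
proof -
  have "expressible (\<lambda>x s. 1 - of_bool (P x s))" using assms by (intro expr)
  also have "(\<lambda>x s. 1 - of_bool (P x s) :: nat) = (\<lambda>x s. of_bool (\<not> P x s))" by (auto simp: fun_eq_iff)
  finally show ?thesis unfolding decidable_def .
qed

lemma decidable_conj [expr]:
  assumes "decidable P" "decidable Q"
  shows "decidable (\<lambda>x s. P x s \<and> Q x s)"
  using expressible_mult[OF assms[unfolded decidable_def]] unfolding decidable_def by (simp add: of_bool_conj)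

lemma decidable_disj [expr]:
  assumes "decidable P" "decidable Q"
  shows "decidable (\<lambda>x s. P x s \<or> Q x s)"
  using decidable_not[OF decidable_conj[OF assms[THEN decidable_not]]] by simp

lemma decidable_imp [expr]:
  assumes "decidable P" "decidable Q"
  shows "decidable (\<lambda>x s. P x s \<longrightarrow> Q x s)"
  using decidable_disj[OF decidable_not[OF assms(1)] assms(2)] by simp

lemma decidable_le [expr]:
  assumes "expressible f" "expressible g"
  shows "decidable (\<lambda>x s. f x s \<le> g x s)"
proof -
  have "expressible (\<lambda>x s. 1 - (f x s - g x s))" using assms by (intro expr)
  also have "(\<lambda>x s. 1 - (f x s - g x s)) = (\<lambda>x s. of_bool (f x s \<le> g x s))" by (auto simp: fun_eq_iff)
  finally show ?thesis unfolding decidable_def .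
qed

lemma decidable_less [expr]:
  assumes "expressible f" "expressible g"
  shows "decidable (\<lambda>x s. f x s < g x s)"
  using decidable_not[OF decidable_le[OF assms(2,1)]] by (simp add: not_le)

lemma decidable_eq [expr]:
  assumes "expressible f" "expressible g"
  shows "decidable (\<lambda>x s. f x s = g x s)"
  using decidable_conj[OF decidable_le[OF assms] decidable_le[OF assms(2,1)]] by (simp add: eq_iff)

lemma decidable_ex [expr]:
  assumes "expressible f" "decidable (\<lambda>x s. P x (\<lambda>j. s (Suc j)) (s 0))"
  shows "decidable (\<lambda>x s. \<exists>i<f x s. P x s i)"
proof -
  have "expressible (\<lambda>x s. \<Sum>i<f x s. of_bool (P x s i))"
    using assms by (intro expr)
  then have "decidable (\<lambda>x s. 0 < (\<Sum>i<f x s. of_bool (P x s i) :: nat))"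
    by (rule decidable_less[OF expressible_const])
  also have "(\<lambda>x s. 0 < (\<Sum>i<f x s. of_bool (P x s i) :: nat)) = (\<lambda>x s. \<exists>i<f x s. P x s i)"
    by (auto simp: fun_eq_iff card_gt_0_iff)
  finally show ?thesis .
qed

lemma decidable_all [expr]:
  assumes "expressible f" "decidable (\<lambda>x s. P x (\<lambda>j. s (Suc j)) (s 0))"
  shows "decidable (\<lambda>x s. \<forall>i<f x s. P x s i)"
  using decidable_not[OF decidable_ex[OF assms(1) decidable_not[OF assms(2)]]] by simp

lemma decidable_ex_list [expr]:
  assumes "\<And>a. a \<in> set as \<Longrightarrow> decidable (P a)"
  shows "decidable (\<lambda>x s. \<exists>a\<in>set as. P a x s)"
  using assms
proof (induction as)
  case (Cons a as)
  then have "decidable (\<lambda>x s. P a x s \<or> (\<exists>a\<in>set as. P a x s))" by (intro expr) auto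
  then show ?case by simp
qed (simp add: decidable_const)

lemma expressible_if [expr]:
  assumes "decidable P" "expressible f" "expressible g"
  shows "expressible (\<lambda>x s. if P x s then f x s else g x s)"
proof -
  have "expressible (\<lambda>x s. of_bool (P x s) * f x s + of_bool (\<not> P x s) * g x s)"
    using assms by (intro expr)
  also have "(\<lambda>x s. of_bool (P x s) * f x s + of_bool (\<not> P x s) * g x s)
      = (\<lambda>x s. if P x s then f x s else g x s)" by (auto simp: fun_eq_iff)
  finally show ?thesis .
qed

lemma decidable_if [expr]:
  assumes "decidable P" "decidable Q" "decidable R"
  shows "decidable (\<lambda>x s. if P x s then Q x s else R x s)"
  using decidable_conj[OF decidable_imp[OF assms(1,2)] decidable_imp[OF decidable_not[OF assms(1)] assms(3)]]
  by (simp add: if_bool_eq_conj)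

lemma decidable_bit [expr]:
  assumes "expressible f"
  shows "decidable (\<lambda>x s. symb x (int (f x s)) = 2)"
  using assms unfolding decidable_def expressible_def by (metis eval.simps(4))

lemma expressible_poly [expr]: "expressible f \<Longrightarrow> expressible (\<lambda>x s. poly p (f x s))"
  by (induction p) (auto intro: expr)

text \<open>For a positive divisor the quotient is the number of its positive multiples up to the
  dividend, and a sum with as many terms as the dividend finds them all. The separate case reflects
  that division by 0 yields 0 in HOL.\<close>

lemma expressible_div:
  assumes "expressible f" "expressible g"
  shows "expressible (\<lambda>x s. f x s div g x s)"
proof -
  have "expressible (\<lambda>x s. if s 1 = 0 then 0 else \<Sum>i<s 0. of_bool ((i + 1) * s 1 \<le> s 0))"
    by (intro expr)
  also have "(\<lambda>x s. if s 1 = 0 then 0 else \<Sum>i<s 0. of_bool ((i + 1) * s 1 \<le> s 0))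
      = (\<lambda>(x :: bool list) (s :: nat \<Rightarrow> nat). s 0 div s 1)"
  proof (intro ext)
    fix x :: "bool list" and s :: "nat \<Rightarrow> nat"
    have "(\<Sum>i<s 0. of_bool ((i + 1) * s 1 \<le> s 0)) = s 0 div s 1" if "s 1 > 0"
    proof -
      have "{i. i < s 0 \<and> (i + 1) * s 1 \<le> s 0} = {..<s 0 div s 1}"
      proof (intro set_eqI iffI)
        fix i assume "i \<in> {i. i < s 0 \<and> (i + 1) * s 1 \<le> s 0}"
        then have "i + 1 \<le> s 0 div s 1" using that by (simp add: less_eq_div_iff_mult_less_eq)
        then show "i \<in> {..<s 0 div s 1}" by simp
      next
        fix i assume "i \<in> {..<s 0 div s 1}"
        then have "i + 1 \<le> s 0 div s 1" by simp
        then have *: "(i + 1) * s 1 \<le> s 0" using that by (simp only: less_eq_div_iff_mult_less_eq)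
        have "i + 1 \<le> (i + 1) * s 1" using mult_le_mono2[of 1 "s 1" "i + 1"] that by simp
        with * have "i < s 0" by linarith
        with * show "i \<in> {i. i < s 0 \<and> (i + 1) * s 1 \<le> s 0}" by simp
      qed
      then show ?thesis by (simp add: of_bool_def sum.If_cases Int_def)
    qed
    then show "(if s 1 = 0 then 0 else \<Sum>i<s 0. of_bool ((i + 1) * s 1 \<le> s 0)) = s 0 div s 1" by simp
  qed
  finally have "expressible (\<lambda>x s. s 0 div s 1)" .
  from expressible_comp2[OF this assms] show ?thesis .
qed

lemma decidable_dvd:
  assumes "expressible f" "expressible g"
  shows "decidable (\<lambda>x s. f x s dvd g x s)"
proof -
  have "decidable (\<lambda>x s. s 0 * (s 1 div s 0) = s 1)"
    by (intro expr expressible_div)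
  also have "(\<lambda>x s. s 0 * (s 1 div s 0) = s 1) = (\<lambda>(x :: bool list) (s :: nat \<Rightarrow> nat). s 0 dvd s 1)"
    by (auto simp: fun_eq_iff) (metis dvd_triv_left)
  finally show ?thesis using decidable_comp2[OF _ assms] by simp
qed

lemma printable_bit:
  assumes "decidable P"
  shows "printable (\<lambda>x s. [P x s])"
proof -
  obtain e where "\<And>x s. eval x s e = of_bool (P x s)"
    using assms unfolding decidable_def expressible_def by blast
  then show ?thesis unfolding printable_def by (intro exI[of _ "PBit e"]) simp
qed

lemma printable_append: "printable f \<Longrightarrow> printable g \<Longrightarrow> printable (\<lambda>x s. f x s @ g x s)"
  unfolding printable_def by (metis peval.simps(2))

lemma printable_concat:
  assumes "expressible f" "printable (\<lambda>x s. g x (\<lambda>j. s (Suc j)) (s 0))"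
  shows "printable (\<lambda>x s. concat (map (\<lambda>i. g x s i) [0..<f x s]))"
proof -
  obtain a b where "\<And>x s. eval x s a = f x s" "\<And>x s. peval x s b = g x (\<lambda>j. s (Suc j)) (s 0)"
    using assms unfolding expressible_def printable_def by blast
  then show ?thesis unfolding printable_def by (intro exI[of _ "PFor a b"]) simp
qed

lemma printable_map:
  assumes "expressible f" "decidable (\<lambda>x s. g x (\<lambda>j. s (Suc j)) (s 0))"
  shows "printable (\<lambda>x s. map (\<lambda>i. g x s i) [0..<f x s])"
proof -
  have "concat (map (\<lambda>i. [h i]) xs) = map h xs" for h :: "nat \<Rightarrow> bool" and xs
    by (induction xs) auto
  with printable_concat[OF assms(1) printable_bit[OF assms(2)]] show ?thesis by simp
qed

lemma printable_replicate:
  assumes "expressible f"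
  shows "printable (\<lambda>x s. replicate (f x s) b)"
  using printable_map[where g = "\<lambda>_ _ _. b", OF assms decidable_const] by (simp add: map_replicate_const)

lemma printable_if:
  assumes "decidable P" "printable (\<lambda>x s. f x (\<lambda>j. s (Suc j)))"
  shows "printable (\<lambda>x s. if P x s then f x s else [])"
proof -
  have "printable (\<lambda>x s. concat (map (\<lambda>_. f x s) [0..<of_bool (P x s)]))"
    using assms by (intro printable_concat expr)
  also have "(\<lambda>x s. concat (map (\<lambda>_. f x s) [0..<of_bool (P x s)])) = (\<lambda>x s. if P x s then f x s else [])"
    by (auto simp: fun_eq_iff)
  finally show ?thesis .
qed

section \<open>Printing binary numbers\<close>

lemma odd_div_power: "bin n = map (\<lambda>i. odd (n div 2 ^ i)) [0..<length (bin n)]"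
proof (induction n rule: bin.induct)
  case (1 n)
  show ?case
  proof (cases "n = 0")
    case False
    then have b: "bin n = odd n # bin (n div 2)" by (subst bin.simps) simp
    have "bin (n div 2) = map (\<lambda>i. odd (n div 2 ^ Suc i)) [0..<length (bin (n div 2))]"
      using 1[OF False] by (simp add: div_mult2_eq)
    then show ?thesis unfolding b
      by (simp only: list.size upt_conv_Cons zero_less_Suc list.map map_Suc_upt[symmetric] map_map comp_def add_Suc_right add_0_right) simp
  qed (simp add: bin.simps)
qed

lemma length_bin: "2 ^ i \<le> n \<longleftrightarrow> i < length (bin n)"
proof (induction n arbitrary: i rule: bin.induct)
  case (1 n)
  show ?case
  proof (cases "n = 0")
    case False
    then have b: "bin n = odd n # bin (n div 2)" by (subst bin.simps) simp
    show ?thesis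
    proof (cases i)
      case (Suc j)
      have "2 ^ i \<le> n \<longleftrightarrow> 2 ^ j \<le> n div 2" by (simp add: Suc less_eq_div_iff_mult_less_eq mult.commute)
      also have "\<dots> \<longleftrightarrow> j < length (bin (n div 2))" by (rule 1[OF False])
      finally show ?thesis by (simp add: b Suc)
    qed (use False b in simp)
  qed (simp add: bin.simps)
qed

text \<open>The powers of two are the numbers without an odd divisor other than 1, which allows us to
  run through them without computing exponentials.\<close>

lemma power_of_two_iff: "(\<exists>k. n = 2 ^ k) \<longleftrightarrow> n > 0 \<and> (\<forall>d<Suc n. d dvd n \<longrightarrow> d = 1 \<or> 2 dvd (d :: nat))"
proof
  assume "\<exists>k. n = 2 ^ k"
  then obtain k where n: "n = 2 ^ k" by blast
  have "d = 1 \<or> 2 dvd d" if d: "d dvd n" for d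
  proof -
    obtain i where "d = 2 ^ i" using d n divides_primepow_nat[OF two_is_prime_nat] by blast
    then show ?thesis by (cases i) auto
  qed
  then show "n > 0 \<and> (\<forall>d<Suc n. d dvd n \<longrightarrow> d = 1 \<or> 2 dvd d)" using n by simp
next
  assume n: "n > 0 \<and> (\<forall>d<Suc n. d dvd n \<longrightarrow> d = 1 \<or> 2 dvd d)"
  obtain k d where kd: "n = 2 ^ k * d" "\<not> 2 dvd d"
    using n by (metis multiplicity_decompose' not_prime_unit two_is_prime_nat less_numeral_extra(3) prime_elem_multiplicity_eq_zero_iff prime_imp_prime_elem)
  then have "d = 1" using n by (meson dvd_imp_le dvd_triv_right less_Suc_eq_le)
  then show "\<exists>k. n = 2 ^ k" using kd by auto
qed

text \<open>Digit \<open>i\<close> belongs to the power \<open>2 ^ i\<close>. By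
  \<open>length_bin\<close> the powers up to \<open>n\<close> are precisely those that have a digit,
  and the numbers \<open>Suc i\<close> with \<open>i < n\<close> pass through them in increasing
  order.\<close>

lemma bin_eq_concat:
  "bin n = concat (map (\<lambda>i. if \<exists>k. Suc i = 2 ^ k then [odd (n div Suc i)] else []) [0..<n])"
proof -
  let ?p = "\<lambda>i. \<exists>k. Suc i = 2 ^ k"
  have "concat (map (\<lambda>i. if ?p i then [h (Suc i)] else []) xs) = map h (map Suc (filter ?p xs))"
    for h :: "nat \<Rightarrow> bool" and xs
    by (induction xs) auto
  note * = this[of "\<lambda>i. odd (n div i)"]
  have "map Suc (filter ?p [0..<n]) = map (\<lambda>i. 2 ^ i) [0..<length (bin n)]"
  proof (rule sorted_distinct_set_unique)
    show "sorted (map Suc (filter ?p [0..<n]))"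
      by (metis filter_map map_Suc_upt sorted_filter sorted_map sorted_upt sorted_wrt_filter)
    show "distinct (map Suc (filter ?p [0..<n]))" by (simp add: distinct_map)
    show "sorted (map (\<lambda>i. 2 ^ i :: nat) [0..<length (bin n)])"
      by (auto simp: sorted_iff_nth_mono)
    show "distinct (map (\<lambda>i. 2 ^ i :: nat) [0..<length (bin n)])"
      by (simp add: distinct_map inj_on_def)
    show "set (map Suc (filter ?p [0..<n])) = set (map (\<lambda>i. 2 ^ i) [0..<length (bin n)])"
    proof (intro set_eqI iffI)
      fix y assume "y \<in> set (map Suc (filter ?p [0..<n]))"
      then obtain k where k: "y = 2 ^ k" "y \<le> n" by auto
      then show "y \<in> set (map (\<lambda>i. 2 ^ i) [0..<length (bin n)])" using length_bin by auto
    next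
      fix y assume "y \<in> set (map (\<lambda>i. 2 ^ i :: nat) [0..<length (bin n)])"
      then obtain k where k: "y = 2 ^ k" "y \<le> n" using length_bin by auto
      have "y \<noteq> 0" using k(1) by simp
      then obtain z where z: "y = Suc z" using not0_implies_Suc by blast
      have "?p z" using k(1) z by metis
      then have "z \<in> set (filter ?p [0..<n])" using k(2) z by simp
      then show "y \<in> set (map Suc (filter ?p [0..<n]))" unfolding z set_map by blast
    qed
  qed
  then show ?thesis unfolding * by (subst odd_div_power) (simp add: comp_def)
qed

lemma printable_bin:
  assumes "expressible (\<lambda>x s. f x)"
  shows "printable (\<lambda>x s. bin (f x))"
proof -
  have "printable (\<lambda>x s. concat (map (\<lambda>i. if Suc i > 0 \<and> (\<forall>d<Suc (Suc i). d dvd Suc i \<longrightarrow> d = 1 \<or> 2 dvd d)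
      then [\<not> 2 dvd (f x div Suc i)] else []) [0..<f x]))"
    unfolding Suc_eq_plus1
    by (intro printable_concat printable_if printable_bit assms expr decidable_dvd expressible_div)
  then show ?thesis unfolding bin_eq_concat[abs_def] power_of_two_iff .
qed

theorem printable_poly_time:
  assumes "printable (\<lambda>x s. f x)"
  shows "poly_time_computable f"
proof -
  obtain e where "\<And>x s. peval x s e = f x" using assms unfolding printable_def by blast
  then show ?thesis using poly_time_peval[of e] by simp
qed

section \<open>From load balancing to edge colorings\<close>

text \<open>The first condition on capacities places the edges to the items among the first
  \<open>L - s r\<close> edges at machine \<open>r\<close>, which can then share a color. The second
  makes the capacities of two machines add up to less than \<open>L\<close>.\<close>

locale balancing =
  fixes q nb ni L :: nat and a b w s :: "nat \<Rightarrow> nat"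
  assumes q: "q \<ge> 2"
    and ends: "i < ni \<Longrightarrow> a i < nb" "i < ni \<Longrightarrow> b i < nb" "i < ni \<Longrightarrow> a i \<noteq> b i"
    and weight: "i < ni \<Longrightarrow> 1 \<le> w i" "i < ni \<Longrightarrow> w i \<le> L"
    and capacity: "r < nb \<Longrightarrow> s r + ni \<le> L" "r < nb \<Longrightarrow> 2 * s r < L"
begin

text \<open>
  The vertices below \<open>nu\<close> are machines: \<open>nb\<close> given ones, then \<open>q - 2\<close> of capacity 0 and, from \<open>nn\<close> on,
  the private vertices of the items.  They are followed by the items and by a block of \<open>q L\<close> numbers
  for the leaves of each machine.  Every edge joins a machine \<open>u\<close> to its neighbor number \<open>k < deg u\<close>,
  which is item \<open>k\<close> (item \<open>u - nn\<close> for \<open>k = 0\<close> at a private vertex) or a leaf.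
\<close>

definition nn :: nat where "nn = nb + (q - 2)"
definition nu :: nat where "nu = nn + ni"
definition slack :: "nat \<Rightarrow> nat" where
  "slack u = (if u < nb then s u else if u < nn then 0 else L - w (u - nn))"
definition conn :: "nat \<Rightarrow> nat \<Rightarrow> bool" where
  "conn u i \<longleftrightarrow> i < ni \<and> (u = a i \<or> u = b i \<or> nb \<le> u)"
definition is_item :: "nat \<Rightarrow> nat \<Rightarrow> bool" where
  "is_item u k \<longleftrightarrow> (if u < nn then conn u k else k = 0)"
definition nbr :: "nat \<Rightarrow> nat \<Rightarrow> nat" where
  "nbr u k = (if is_item u k then nu + (if u < nn then k else u - nn) else nu + ni + u * (q * L) + k)"
definition deg :: "nat \<Rightarrow> nat" where "deg u = q * L - slack u"
definition nv :: nat where "nv = nu + ni + nu * (q * L)"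
definition edges :: "nat set set" where
  "edges = {{u, nbr u k} | u k. u < nu \<and> k < deg u}"

definition slots :: "(nat \<times> nat) set" where "slots = {(u, k). u < nu \<and> k < deg u}"
definition edge :: "nat \<times> nat \<Rightarrow> nat set" where "edge = (\<lambda>(u, k). {u, nbr u k})"

definition balanced :: "(nat \<Rightarrow> nat) \<Rightarrow> bool" where
  "balanced ch \<longleftrightarrow> (\<forall>i<ni. ch i = a i \<or> ch i = b i) \<and> (\<forall>r<nb. (\<Sum>i | i < ni \<and> ch i = r. w i) \<le> s r)"

lemma edges_slots: "edges = edge ` slots"
  unfolding edges_def slots_def edge_def by auto

lemma finite_slots: "finite slots"
proof -
  have "slots = Sigma {..<nu} (\<lambda>u. {..<deg u})" unfolding slots_def by auto
  then show ?thesis by simp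
qed

lemma deg_le: "deg u \<le> q * L"
  unfolding deg_def by simp

lemma nbr_ge: "nu \<le> nbr u k"
  unfolding nbr_def by simp

lemma nbr_less: "u < nu \<Longrightarrow> k < deg u \<Longrightarrow> nbr u k < nv"
proof -
  assume u: "u < nu" "k < deg u"
  have "Suc u * (q * L) \<le> nu * (q * L)" using u by (intro mult_right_mono) auto
  moreover have "k < q * L" using u deg_le less_le_trans by blast
  ultimately show "nbr u k < nv"
    using u unfolding nbr_def nv_def nu_def is_item_def conn_def by auto
qed

lemma simple_graph_edges: "simple_graph {0..<nv} edges"
proof -
  have "card {u, nbr u k} = 2" "{u, nbr u k} \<subseteq> {0..<nv}" if "u < nu" "k < deg u" for u k
    using that nbr_ge[of u k] nbr_less[OF that] by (auto simp: card_2_iff)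
  then show ?thesis unfolding simple_graph_def edges_def by auto
qed

text \<open>A leaf belongs to one machine, but an item is adjacent to several; only in the case of a
  leaf does the neighbor determine the machine.\<close>

lemma nbr_inject:
  assumes "nbr u k = nbr u' k'" "u < nu" "u' < nu" "k < q * L" "k' < q * L"
    and "u = u' \<or> \<not> is_item u k"
  shows "u = u' \<and> k = k'"
proof -
  have lt: "nbr v j < nu + ni \<longleftrightarrow> is_item v j" if "v < nu" for v j
    using that unfolding nbr_def is_item_def conn_def nu_def by auto
  then have eq: "is_item u k = is_item u' k'" using assms(1-3) by metis
  show ?thesis
  proof (cases "is_item u k")
    case True
    with assms(6) have "u = u'" by simp
    with True eq assms(1) show ?thesis
      unfolding nbr_def is_item_def by (auto split: if_splits)
  next
    case False
    then have e: "u * (q * L) + k = u' * (q * L) + k'" using eq assms(1) unfolding nbr_def by simp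
    have "(v * B + j) div B = v" if "j < B" for v j B :: nat using that by simp
    from this[OF assms(4)] this[OF assms(5)] have "u = u'" using e by metis
    with e show ?thesis by auto
  qed
qed

lemma inj_edge: "inj_on edge slots"
proof (rule inj_onI, clarify)
  fix u k u' k' assume h: "(u, k) \<in> slots" "(u', k') \<in> slots" "edge (u, k) = edge (u', k')"
  then have 1: "u < nu" "u' < nu" "k < q * L" "k' < q * L"
    unfolding slots_def using deg_le less_le_trans by blast+
  have "u = u'" "nbr u k = nbr u' k'"
    using h(3) 1 nbr_ge[of u k] nbr_ge[of u' k'] unfolding edge_def by (auto simp: doubleton_eq_iff)
  then show "u = u' \<and> k = k'" using nbr_inject 1 by blast
qed

text \<open>From here on edges are counted through their slots, which are grouped by
  machine.\<close>

lemma card_color_group: "card (color_group edges \<sigma> c) = card {p \<in> slots. \<sigma> (edge p) = c}"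
proof -
  have "color_group edges \<sigma> c = edge ` {p \<in> slots. \<sigma> (edge p) = c}"
    unfolding color_group_def edges_slots by auto
  then show ?thesis using inj_edge by (metis (no_types, lifting) card_image inj_on_subset mem_Collect_eq subsetI)
qed

definition item_slots :: "nat \<Rightarrow> (nat \<times> nat) set" where
  "item_slots i = insert (nn + i, 0) {(u, i) | u. u < nn \<and> conn u i}"

lemma slack_nb: "u < nb \<Longrightarrow> slack u = s u" and slack_dead: "nb \<le> u \<Longrightarrow> u < nn \<Longrightarrow> slack u = 0"
  and slack_weight: "slack (nn + i) = L - w i"
  unfolding slack_def nn_def by auto

lemma L_pos: "i < ni \<Longrightarrow> 0 < L"
  using weight[of i] by simp

lemma item_less: "i < ni \<Longrightarrow> u < nn \<Longrightarrow> i < L - slack u"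
  using slack_nb[of u] slack_dead[of u] capacity[of u] ends(1)[of i] capacity[of "a i"] by (cases "u < nb") auto

lemma slack_le: "u < nu \<Longrightarrow> slack u \<le> L"
  using slack_nb[of u] slack_dead[of u] slack_weight[of "u - nn"] capacity[of u]
  unfolding nu_def by (cases "u < nb"; cases "u < nn") auto

lemma L_le: "L \<le> q * L"
  using q by simp

lemma item_slots_sub: "i < ni \<Longrightarrow> item_slots i \<subseteq> slots"
proof -
  assume i: "i < ni"
  have "0 < deg (nn + i)" using weight[OF i] L_le unfolding deg_def slack_weight by linarith
  moreover have "i < deg u" if "u < nn" for u
    using item_less[OF i that] L_le unfolding deg_def by linarith
  ultimately show "item_slots i \<subseteq> slots"
    using i unfolding item_slots_def slots_def nu_def by auto
qed

lemma incident_big: "u < nu \<Longrightarrow> {e \<in> edges. u \<in> e} = edge ` {p \<in> slots. fst p = u}"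
proof -
  assume u: "u < nu"
  have "u \<in> edge p \<longleftrightarrow> fst p = u" for p
    using u nbr_ge[of "fst p" "snd p"] unfolding edge_def by (auto simp: case_prod_beta)
  then show ?thesis unfolding edges_slots by blast
qed

lemma incident_item:
  assumes i: "i < ni"
  shows "{e \<in> edges. nu + i \<in> e} = edge ` item_slots i"
proof (intro equalityI subsetI)
  fix e assume "e \<in> {e \<in> edges. nu + i \<in> e}"
  then obtain u k where uk: "e = edge (u, k)" "u < nu" "k < deg u" "nu + i = nbr u k"
    unfolding edges_slots slots_def edge_def by auto
  then have "(u, k) \<in> item_slots i"
    using i unfolding nbr_def item_slots_def is_item_def by (auto split: if_splits)
  with uk show "e \<in> edge ` item_slots i" by blast
next
  fix e assume "e \<in> edge ` item_slots i"
  then obtain u k where uk: "e = edge (u, k)" "(u, k) \<in> item_slots i" by auto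
  then have "(u, k) \<in> slots" using item_slots_sub[OF i] by blast
  moreover have "nbr u k = nu + i" using uk unfolding item_slots_def nbr_def is_item_def by auto
  ultimately have "e \<in> edges" "nu + i \<in> e" using uk(1) unfolding edges_slots by (blast, simp add: edge_def)
  then show "e \<in> {e \<in> edges. nu + i \<in> e}" by simp
qed

text \<open>Some numbers in the blocks for leaves are isolated vertices, namely those whose
  \<open>k\<close> stands for an item or is not below the degree.\<close>

lemma incident_leaf:
  assumes "nu + ni \<le> v"
  shows "card (f ` {e \<in> edges. v \<in> e}) \<le> 1"
proof -
  have "p = p'" if p: "p \<in> slots" "p' \<in> slots" "v \<in> edge p" "v \<in> edge p'" for p p'
  proof -
    obtain u k u' k' where pp: "p = (u, k)" "p' = (u', k')" by fastforce
    have lt: "u < nu" "u' < nu" "k < q * L" "k' < q * L"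
      using p pp deg_le less_le_trans unfolding slots_def by blast+
    have v: "v = nbr u k" "v = nbr u' k'"
      using p pp lt assms unfolding edge_def by auto
    have "\<not> is_item u k"
      using v(1) assms lt unfolding nbr_def nu_def is_item_def conn_def by (auto split: if_splits)
    then show ?thesis using nbr_inject[of u k u' k'] v lt pp by auto
  qed
  then have "{e \<in> edges. v \<in> e} \<subseteq> {e}" if "e \<in> edges" "v \<in> e" for e
    using that unfolding edges_slots by blast
  then have "{e \<in> edges. v \<in> e} = {} \<or> (\<exists>e. {e \<in> edges. v \<in> e} = {e})" by blast
  then obtain e where "{e \<in> edges. v \<in> e} \<subseteq> {e}" by blast
  then have "f ` {e \<in> edges. v \<in> e} \<subseteq> {f e}" by blast
  from card_mono[OF _ this] show ?thesis by simp
qed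

lemma conn_set:
  assumes "i < ni"
  shows "{u. u < nn \<and> conn u i} = {a i, b i} \<union> {nb..<nn}"
  using ends[OF assms] assms unfolding conn_def nn_def by auto

lemma card_conn:
  assumes "i < ni"
  shows "card {u. u < nn \<and> conn u i} = q"
proof -
  have "{a i, b i} \<inter> {nb..<nn} = {}" using ends(1,2)[OF assms] by auto
  then have "card ({a i, b i} \<union> {nb..<nn}) = card {a i, b i} + card {nb..<nn}"
    by (intro card_Un_disjoint) auto
  also have "\<dots> = q" using ends(3)[OF assms] q by (simp add: nn_def)
  finally show ?thesis unfolding conn_set[OF assms] .
qed

section \<open>From colorings to balanced assignments\<close>

context
  fixes \<sigma> :: "nat set \<Rightarrow> nat"
  assumes col: "edge_q_coloring q {0..<nv} edges \<sigma>"
    and small: "\<And>c. card (color_group edges \<sigma> c) \<le> L"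
begin

abbreviation "col p \<equiv> \<sigma> (edge p)"

definition "row u = {p \<in> slots. fst p = u}"

lemma row_eq: "u < nu \<Longrightarrow> row u = Pair u ` {..<deg u}"
  unfolding row_def slots_def by auto

lemma card_row: "u < nu \<Longrightarrow> card (row u) = deg u"
  unfolding row_eq by (simp add: card_image inj_on_def)

lemma finite_row: "finite (row u)"
  unfolding row_def using finite_slots by simp

lemma colors_row: "u < nu \<Longrightarrow> card (col ` row u) \<le> q"
proof -
  assume u: "u < nu"
  then have "u \<in> {0..<nv}" unfolding nv_def by simp
  then have "card (\<sigma> ` {e \<in> edges. u \<in> e}) \<le> q" using col unfolding edge_q_coloring_def by blast
  then show ?thesis unfolding incident_big[OF u] row_def image_image .
qed

lemma group_le: "card {p \<in> slots. col p = c} \<le> L"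
  using small card_color_group by simp

lemma card_colored_le:
  assumes "finite C" "X \<subseteq> slots" "col ` X \<subseteq> C"
  shows "card X \<le> card C * L"
proof -
  have "X \<subseteq> (\<Union>c\<in>C. {p \<in> slots. col p = c})" using assms by auto
  then have "card X \<le> card (\<Union>c\<in>C. {p \<in> slots. col p = c})"
    using finite_slots assms(1) by (intro card_mono) auto
  also have "\<dots> \<le> (\<Sum>c\<in>C. card {p \<in> slots. col p = c})" by (rule card_UN_le[OF assms(1)])
  also have "\<dots> \<le> card C * L" using sum_bounded_above[of C _ L] group_le by simp
  finally show ?thesis .
qed

text \<open>A vertex of degree \<open>q L - t\<close> leaves room for only \<open>t\<close> further edges in the color groups
  it is incident to.\<close>

lemma external_le:
  assumes u: "u < nu" and X: "X \<subseteq> slots" "X \<inter> row u = {}" "col ` X \<subseteq> col ` row u"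
  shows "card X \<le> slack u"
proof -
  have "card (X \<union> row u) \<le> card (col ` row u) * L"
    using X finite_row by (intro card_colored_le) (auto simp: row_def)
  also have "\<dots> \<le> q * L" using colors_row[OF u] by (intro mult_right_mono) auto
  finally have "card X + deg u \<le> q * L"
    using X finite_row card_row[OF u] finite_subset[OF X(1) finite_slots] by (simp add: card_Un_disjoint)
  moreover have "slack u \<le> q * L" using slack_le[OF u] L_le by linarith
  ultimately show ?thesis unfolding deg_def by linarith
qed

text \<open>The other colors at \<open>u\<close>, at most \<open>q - 1\<close> of them, cover at
  most \<open>(q - 1) * L\<close> of the \<open>q * L - slack u\<close> edges.\<close>

lemma class_ge:
  assumes u: "u < nu" and p: "p \<in> row u"
  shows "L - slack u \<le> card {p' \<in> row u. col p' = col p}"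
proof -
  let ?C = "col ` row u - {col p}" and ?X = "{p' \<in> row u. col p' \<noteq> col p}"
  have "card ?X \<le> card ?C * L"
    using finite_row by (intro card_colored_le) (auto simp: row_def)
  moreover have "card ?C \<le> q - 1"
    using colors_row[OF u] p finite_row by (subst card_Diff_singleton) auto
  ultimately have "card ?X \<le> (q - 1) * L"
    by (meson le_trans mult_le_mono1)
  moreover have "card (row u) = card {p' \<in> row u. col p' = col p} + card ?X"
    using finite_row by (subst card_Un_disjoint[symmetric]) (auto intro: arg_cong[of _ _ card])
  ultimately have "q * L - slack u \<le> card {p' \<in> row u. col p' = col p} + (q - 1) * L"
    unfolding card_row[OF u] deg_def by linarith
  moreover have "q * L = L + (q - 1) * L" using q by (cases q) auto
  ultimately show ?thesis by linarith
qed

text \<open>If two machines had a color in common, its at least \<open>L - slack u'\<close> edges at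
  \<open>u'\<close> would be external to \<open>u\<close>, so that
  \<open>L \<le> slack u + slack u'\<close>. The item \<open>i\<close> guarantees
  \<open>0 < L\<close>, which settles machines of capacity 0.\<close>

lemma bigs_not_joined:
  assumes "u < nn" "u' < nn" "u \<noteq> u'" "p \<in> row u" "p' \<in> row u'" "i < ni"
  shows "col p \<noteq> col p'"
proof
  assume eq: "col p = col p'"
  have lt: "u < nu" "u' < nu" using assms unfolding nu_def by auto
  have "L - slack u' \<le> card {p'' \<in> row u'. col p'' = col p'}"
    by (rule class_ge[OF lt(2) assms(5)])
  also have "\<dots> \<le> slack u"
  proof (rule external_le[OF lt(1)])
    show "col ` {p'' \<in> row u'. col p'' = col p'} \<subseteq> col ` row u"
      using imageI[OF assms(4), of col] eq by auto
  qed (use assms(3) in \<open>auto simp: row_def\<close>)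
  finally have "L \<le> slack u + slack u'" by simp
  moreover have "2 * slack v < L" if "v < nn" for v
    using that capacity(2)[of v] L_pos[OF assms(6)] slack_nb[of v] slack_dead[of v] by (cases "v < nb") auto
  from this[OF assms(1)] this[OF assms(2)] have "slack u + slack u' < L" by linarith
  ultimately show False by simp
qed

lemma item_choice:
  assumes i: "i < ni"
  obtains r where "r = a i \<or> r = b i" "col (nn + i, 0) = col (r, i)"
proof -
  define U where "U = {u. u < nn \<and> conn u i}"
  have "item_slots i = insert (nn + i, 0) ((\<lambda>u. (u, i)) ` U)"
    unfolding item_slots_def U_def by auto
  also have "card \<dots> = Suc (card ((\<lambda>u. (u, i)) ` U))"
    by (rule card_insert_disjoint) (auto simp: U_def)
  also have "card ((\<lambda>u. (u, i)) ` U) = card U"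
    by (simp add: card_image inj_on_def)
  finally have "card (item_slots i) = Suc (card {u. u < nn \<and> conn u i})" unfolding U_def .
  then have c: "card (item_slots i) = Suc q" by (simp add: card_conn[OF i])
  have "nu + i \<in> {0..<nv}" using i unfolding nv_def by simp
  then have "card (\<sigma> ` {e \<in> edges. nu + i \<in> e}) \<le> q" using col unfolding edge_q_coloring_def by blast
  then have "card (col ` item_slots i) \<le> q" unfolding incident_item[OF i] image_image .
  \<comment> \<open>The item has \<open>q + 1\<close> edges but sees at most \<open>q\<close>
    colors.\<close>
  with c have "\<not> inj_on col (item_slots i)" by (intro pigeonhole) simp
  then obtain p p' where p: "p \<in> item_slots i" "p' \<in> item_slots i" "p \<noteq> p'" "col p = col p'"
    unfolding inj_on_def by blast
  have row: "p \<in> row (fst p)" if "p \<in> item_slots i" for p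
    using that item_slots_sub[OF i] unfolding row_def by auto
  have "\<exists>u. u < nn \<and> conn u i \<and> col (nn + i, 0) = col (u, i)"
  proof (cases "p = (nn + i, 0) \<or> p' = (nn + i, 0)")
    case True
    then show ?thesis using p unfolding item_slots_def by auto
  next
    case False
    then have "fst p < nn" "fst p' < nn" "fst p \<noteq> fst p'" using p(1-3) unfolding item_slots_def by auto
    then show ?thesis using bigs_not_joined row p i by blast
  qed
  then obtain u where u: "u < nn" "conn u i" "col (nn + i, 0) = col (u, i)" by blast
  have sl: "(nn + i, 0) \<in> slots" "(u, i) \<in> slots"
    using item_slots_sub[OF i] u unfolding item_slots_def by auto
  \<comment> \<open>A machine of capacity 0 has no room even for the single edge between the item
    and its private vertex.\<close>
  have "\<not> nb \<le> u"
  proof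
    assume "nb \<le> u"
    then have "slack u = 0" using slack_dead u by simp
    moreover have "card {(nn + i, 0 :: nat)} \<le> slack u"
    proof (rule external_le)
      show "u < nu" using u unfolding nu_def by simp
      show "col ` {(nn + i, 0)} \<subseteq> col ` row u" using u sl unfolding row_def by auto
    qed (use u sl in \<open>auto simp: row_def\<close>)
    ultimately show False by simp
  qed
  with u that show thesis unfolding conn_def by blast
qed

lemma balanced_of_coloring: "\<exists>ch. balanced ch"
proof -
  have "\<forall>i. \<exists>r. i < ni \<longrightarrow> (r = a i \<or> r = b i) \<and> col (nn + i, 0) = col (r, i)"
    using item_choice by metis
  then obtain ch where ch: "\<And>i. i < ni \<Longrightarrow> ch i = a i \<or> ch i = b i"
      "\<And>i. i < ni \<Longrightarrow> col (nn + i, 0) = col (ch i, i)" by metis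
  have "(\<Sum>i | i < ni \<and> ch i = r. w i) \<le> s r" if r: "r < nb" for r
  proof -
    let ?I = "{i. i < ni \<and> ch i = r}"
    let ?K = "\<lambda>i. {p \<in> row (nn + i). col p = col (nn + i, 0)}"
    have lt: "nn + i < nu" if "i < ni" for i using that unfolding nu_def by simp
    have sl: "(nn + i, 0) \<in> row (nn + i)" "(ch i, i) \<in> row (ch i)" if "i < ni" for i
      using that item_slots_sub[OF that] ch(1)[OF that] ends[OF that] conn_set[OF that]
      unfolding item_slots_def row_def by auto
    \<comment> \<open>The slack of a private vertex is \<open>L - w i\<close>, so by
      \<open>class_ge\<close> each of its colors occurs on at least \<open>w i\<close> of its
      edges.\<close>
    have "(\<Sum>i\<in>?I. w i) \<le> (\<Sum>i\<in>?I. card (?K i))"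
    proof (rule sum_mono)
      fix i assume "i \<in> ?I"
      then have i: "i < ni" by simp
      show "w i \<le> card (?K i)"
        using class_ge[OF lt sl(1), OF i i] weight(2)[OF i] by (simp add: slack_weight)
    qed
    also have "\<dots> = card (\<Union>i\<in>?I. ?K i)"
      using finite_slots by (subst card_UN_disjoint) (auto simp: row_def)
    \<comment> \<open>All these edges lie at private vertices, yet their colors are also seen at
      machine \<open>r\<close>.\<close>
    also have "\<dots> \<le> slack r"
    proof (rule external_le)
      show "r < nu" using r unfolding nu_def nn_def by simp
      have "col (nn + i, 0) \<in> col ` row r" if "i \<in> ?I" for i
        using that ch(2)[of i] imageI[OF sl(2)[of i], of col] by auto
      then show "col ` (\<Union>i\<in>?I. ?K i) \<subseteq> col ` row r" by auto
      show "(\<Union>i\<in>?I. ?K i) \<inter> row r = {}" using r unfolding row_def nn_def by auto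
    qed (auto simp: row_def)
    finally show ?thesis using slack_nb[OF r] by simp
  qed
  with ch(1) show ?thesis unfolding balanced_def by blast
qed

end

text \<open>Machine \<open>u\<close> gives color \<open>u * q\<close> to its first
  \<open>L - slack u\<close> edges and cuts the others into blocks of \<open>L\<close> edges with
  colors \<open>u * q + 1\<close> to \<open>u * q + (q - 1)\<close>. A private vertex proceeds
  likewise, except that its first \<open>w i\<close> edges take the color of machine
  \<open>ch i\<close>. The group of color \<open>r * q\<close> thus consists of
  \<open>L - s r\<close> edges at \<open>r\<close> and of the weights of the items assigned to
  \<open>r\<close>.\<close>

lemma coloring_of_balanced:
  assumes bal: "balanced ch"
  shows "\<exists>\<sigma>. edge_q_coloring q {0..<nv} edges \<sigma> \<and> (\<forall>c. card (color_group edges \<sigma> c) \<le> L)"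
proof -
  have ch: "ch i = a i \<or> ch i = b i" "ch i < nb" if "i < ni" for i
    using bal that ends[OF that] unfolding balanced_def by auto
  have load: "(\<Sum>i | i < ni \<and> ch i = r. w i) \<le> s r" if "r < nb" for r
    using bal that unfolding balanced_def by blast
  define root where "root u = (if u < nn then u else ch (u - nn))" for u
  define c where "c = (\<lambda>(u, k). if k < L - slack u then root u * q
      else u * q + Suc ((k - (L - slack u)) div L))"
  define \<sigma> where "\<sigma> e = c (inv_into slots edge e)" for e
  have \<sigma>: "\<sigma> (edge p) = c p" if "p \<in> slots" for p
    unfolding \<sigma>_def using that inj_edge by simp
  \<comment> \<open>At most \<open>(q - 1) * L\<close> edges remain after the first
    \<open>L - slack u\<close>, so \<open>q - 1\<close> further blocks are enough.\<close>
  have blk: "Suc ((k - (L - slack u)) div L) < q" if "(u, k) \<in> slots" "\<not> k < L - slack u" for u k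
  proof -
    have h: "u < nu" "k < q * L - slack u" using that unfolding slots_def deg_def by auto
    have "q * L = L + (q - 1) * L" using q by (cases q) auto
    then have "k - (L - slack u) < (q - 1) * L" using h slack_le[OF h(1)] that(2) by linarith
    then have "(k - (L - slack u)) div L < q - 1" by (simp add: less_mult_imp_div_less)
    then show ?thesis by simp
  qed
  have "card (\<sigma> ` {e \<in> edges. v \<in> e}) \<le> q" if "v < nv" for v
  proof -
    consider "v < nu" | i where "i < ni" "v = nu + i" | "nu + ni \<le> v"
      by (metis add_diff_inverse_nat nat_add_left_cancel_less not_less)
    then show ?thesis
    proof cases
      case 1
      have "\<sigma> ` {e \<in> edges. v \<in> e} \<subseteq> insert (root v * q) ((\<lambda>j. v * q + j) ` {1..<q})"
        using \<sigma> blk unfolding incident_big[OF 1] image_image by (auto simp: c_def)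
      then have "card (\<sigma> ` {e \<in> edges. v \<in> e}) \<le> card (insert (root v * q) ((\<lambda>j. v * q + j) ` {1..<q}))"
        by (intro card_mono) auto
      also have "\<dots> \<le> Suc (card ((\<lambda>j. v * q + j) ` {1..<q}))" by (rule card_insert_le_m1) auto
      also have "\<dots> \<le> Suc (q - 1)" using card_image_le[of "{1..<q}" "\<lambda>j. v * q + j"] by simp
      finally show ?thesis using q by simp
    next
      case 2
      note i = 2(1)
      \<comment> \<open>The edge to the private vertex repeats the color of the edge to
        \<open>ch i\<close>, so the \<open>q + 1\<close> edges at the item show only the colors of
        its \<open>q\<close> machines.\<close>
      have 0: "c (nn + i, 0) = ch i * q"
        using weight[OF i] by (simp add: c_def root_def slack_weight)
      have 1: "ch i < nn" "conn (ch i) i"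
        using ch[OF i] i unfolding nn_def conn_def by auto
      have u: "c (u, i) = u * q" if "u < nn" for u
        using item_less[OF i that] that by (simp add: c_def root_def)
      have "c p \<in> (\<lambda>u. u * q) ` {u. u < nn \<and> conn u i}" if p: "p \<in> item_slots i" for p
      proof (cases "p = (nn + i, 0)")
        case True
        then show ?thesis using 0 1 by blast
      next
        case False
        then obtain u where "p = (u, i)" "u < nn" "conn u i" using p unfolding item_slots_def by auto
        then show ?thesis using u by blast
      qed
      then have "\<sigma> ` {e \<in> edges. v \<in> e} \<subseteq> (\<lambda>u. u * q) ` {u. u < nn \<and> conn u i}"
        using \<sigma> item_slots_sub[OF 2(1)] unfolding 2(2) incident_item[OF 2(1)] image_image
        by (auto simp: subset_iff)
      then have "card (\<sigma> ` {e \<in> edges. v \<in> e}) \<le> card ((\<lambda>u. u * q) ` {u. u < nn \<and> conn u i})"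
        by (intro card_mono) auto
      also have "\<dots> \<le> q" using card_image_le[of "{u. u < nn \<and> conn u i}" "\<lambda>u. u * q"] card_conn[OF 2(1)] by simp
      finally show ?thesis .
    next
      case 3
      then show ?thesis using incident_leaf[of v \<sigma>] q by linarith
    qed
  qed
  moreover have "card (color_group edges \<sigma> x) \<le> L" for x
  proof -
    let ?r = "x div q" and ?j = "x mod q"
    have eq: "{p \<in> slots. \<sigma> (edge p) = x} = {p \<in> slots. c p = x}" using \<sigma> by auto
    have dm: "r = ?r \<and> j = ?j" if "r * q + j = x" "j < q" for r j
      using that by auto
    \<comment> \<open>Remainder 0 is reserved for the first blocks; any other remainder identifies a
      single block at a single vertex.\<close>
    show ?thesis unfolding card_color_group eq
    proof (cases "?j = 0")
      case False
      let ?l = "L - slack ?r + (?j - 1) * L"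
      have "{p \<in> slots. c p = x} \<subseteq> Pair ?r ` {?l..<?l + L}"
      proof (rule subsetI)
        fix p assume p: "p \<in> {p \<in> slots. c p = x}"
        obtain u k where p': "p = (u, k)" by (cases p)
        with p have uk: "(u, k) \<in> slots" "c (u, k) = x" by auto
        have k: "\<not> k < L - slack u"
        proof
          assume "k < L - slack u"
          then have "root u * q + 0 = x" using uk by (simp add: c_def)
          then show False using dm[of "root u" 0] q False by simp
        qed
        then have "u * q + Suc ((k - (L - slack u)) div L) = x" using uk by (simp add: c_def)
        note d = dm[OF this blk[OF uk(1) k]]
        from d have u: "u = ?r" ..
        have "(k - (L - slack u)) div L = Suc ((k - (L - slack u)) div L) - 1" by simp
        also have "\<dots> = ?j - 1" using d by metis
        finally have j: "(k - (L - slack u)) div L = ?j - 1" .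
        have "0 < L"
        proof (rule ccontr)
          assume "\<not> 0 < L"
          then show False using uk(1) unfolding slots_def deg_def by simp
        qed
        then have "(?j - 1) * L \<le> k - (L - slack u)" "k - (L - slack u) < (?j - 1) * L + L"
          unfolding j[symmetric] by (simp_all add: dividend_less_div_times add.commute)
        then have "?l \<le> k" "k < ?l + L" using k unfolding u by linarith+
        then have "k \<in> {?l..<?l + L}" by simp
        then show "p \<in> Pair ?r ` {?l..<?l + L}" unfolding p' u by (rule imageI)
      qed
      then have "card {p \<in> slots. c p = x} \<le> card (Pair ?r ` {?l..<?l + L})" by (intro card_mono) auto
      also have "\<dots> \<le> L" using card_image_le[of "{?l..<?l + L}" "Pair ?r"] by simp
      finally show "card {p \<in> slots. c p = x} \<le> L" .
    next
      case True
      let ?U = "{u. u < nu \<and> root u = ?r}"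
      have "{p \<in> slots. c p = x} \<subseteq> Sigma ?U (\<lambda>u. {..<L - slack u})"
      proof (rule subsetI)
        fix p assume p: "p \<in> {p \<in> slots. c p = x}"
        obtain u k where p': "p = (u, k)" by (cases p)
        with p have uk: "(u, k) \<in> slots" "c (u, k) = x" by auto
        have k: "k < L - slack u"
        proof (rule ccontr)
          assume k: "\<not> k < L - slack u"
          then have "u * q + Suc ((k - (L - slack u)) div L) = x" using uk by (simp add: c_def)
          then show False using dm[OF _ blk[OF uk(1) k]] True by auto
        qed
        then have "root u * q + 0 = x" using uk by (simp add: c_def)
        then have "root u = ?r" using dm[of "root u" 0] q by simp
        with uk k show "p \<in> Sigma ?U (\<lambda>u. {..<L - slack u})" unfolding slots_def p' by simp
      qed
      then have "card {p \<in> slots. c p = x} \<le> card (Sigma ?U (\<lambda>u. {..<L - slack u}))"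
        by (intro card_mono) auto
      also have "\<dots> = (\<Sum>u\<in>?U. L - slack u)" by simp
      also have "\<dots> \<le> L"
      proof (cases "?r < nb")
        case r: True
        let ?I = "{i. i < ni \<and> ch i = ?r}"
        \<comment> \<open>Besides \<open>?r\<close> itself, the vertices with this root are the
          private vertices of the items assigned to it.\<close>
        have U: "?U = insert ?r ((\<lambda>i. nn + i) ` ?I)"
        proof (intro set_eqI iffI)
          fix u assume u: "u \<in> ?U"
          show "u \<in> insert ?r ((\<lambda>i. nn + i) ` ?I)"
          proof (cases "u < nn")
            case False
            with u have "u = nn + (u - nn)" "u - nn \<in> ?I" unfolding root_def nu_def by auto
            then show ?thesis by blast
          qed (use u root_def in auto)
        qed (use r in \<open>auto simp: root_def nu_def nn_def\<close>)
        have "(\<Sum>u\<in>?U. L - slack u) = L - slack ?r + (\<Sum>u\<in>(\<lambda>i. nn + i) ` ?I. L - slack u)"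
          unfolding U by (rule sum.insert) (use r in \<open>auto simp: nn_def\<close>)
        also have "(\<Sum>u\<in>(\<lambda>i. nn + i) ` ?I. L - slack u) = (\<Sum>i\<in>?I. w i)"
          using weight by (subst sum.reindex) (auto simp: slack_weight intro!: sum.cong)
        also have "\<dots> \<le> slack ?r" using load[OF r] slack_nb[OF r] by simp
        finally have "(\<Sum>u\<in>?U. L - slack u) \<le> L - slack ?r + slack ?r" by simp
        also have "\<dots> = L" using slack_nb[OF r] capacity[OF r] by simp
        finally show ?thesis .
      next
        case False
        \<comment> \<open>Items are assigned to given machines only, so at most one vertex has this
          root.\<close>
        have "u = ?r" if "u \<in> ?U" for u
        proof (rule ccontr)
          assume "u \<noteq> ?r"
          then have "u - nn < ni" "ch (u - nn) = ?r"
            using that unfolding root_def nu_def by (auto split: if_splits)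
          then show False using ch(2) False by metis
        qed
        then have "?U \<subseteq> {?r}" by blast
        then have "(\<Sum>u\<in>?U. L - slack u) \<le> (\<Sum>u\<in>{?r}. L - slack u)" by (intro sum_mono2) auto
        then show ?thesis by simp
      qed
      finally show "card {p \<in> slots. c p = x} \<le> L" .
    qed
  qed
  ultimately show ?thesis unfolding edge_q_coloring_def by (intro exI[of _ \<sigma>]) auto
qed

theorem coloring_iff_balanced:
  "(\<exists>\<sigma>. edge_q_coloring q {0..<nv} edges \<sigma> \<and> (\<forall>c. card (color_group edges \<sigma> c) \<le> L)) \<longleftrightarrow> (\<exists>ch. balanced ch)"
  using balanced_of_coloring coloring_of_balanced by blast

end

section \<open>Satisfiability as load balancing\<close>

locale cnf =
  fixes q N m :: nat and occ :: "nat \<Rightarrow> nat \<Rightarrow> bool"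
  assumes two_le_q: "q \<ge> 2" and N_pos: "N \<ge> 1" and m_pos: "m \<ge> 1"
begin

text \<open>
  The literals of variable \<open>v\<close> are \<open>2 v\<close> and \<open>2 v + 1\<close>.  There is a machine for each literal,
  then one for each clause, then one of capacity 0.  The first \<open>N\<close> items are assigned to the
  false literal of their variable, which fills its machine; the other items stand for pairs of
  a literal and a clause and have to go to the clause unless the literal is true and occurs in it.
\<close>

definition num_bigs :: nat where "num_bigs = 2 * N + m + 1"
definition num_items :: nat where "num_items = N + 2 * N * m"
text \<open>The remainder of \<open>i - N\<close> modulo \<open>m\<close> is spelled out because
  quotients, products and differences are expressible. A pair whose literal does not occur has the
  machine of capacity 0 as its alternative, which forces it to its clause.\<close>

definition end1 :: "nat \<Rightarrow> nat" where
  "end1 i = (if i < N then 2 * i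
     else if occ ((i - N) - (i - N) div m * m) ((i - N) div m) then (i - N) div m else 2 * N + m)"
definition end2 :: "nat \<Rightarrow> nat" where
  "end2 i = (if i < N then 2 * i + 1 else 2 * N + ((i - N) - (i - N) div m * m))"
definition load :: "nat \<Rightarrow> nat" where "load i = (if i < N then m else 1)"
definition cap :: "nat \<Rightarrow> nat" where
  "cap r = (if r < 2 * N then m else if r < 2 * N + m then 2 * N - 1 else 0)"
text \<open>No capacity exceeds \<open>2 * N + m\<close>, which makes both capacity conditions of
  \<open>balancing\<close> hold.\<close>

definition bound :: nat where "bound = 2 * (2 * N + m) + num_items + 1"

definition lit_true :: "(nat \<Rightarrow> bool) \<Rightarrow> nat \<Rightarrow> bool" where
  "lit_true \<alpha> l \<longleftrightarrow> (\<alpha> (l div 2) \<longleftrightarrow> even l)"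
definition satisfiable :: bool where
  "satisfiable \<longleftrightarrow> (\<exists>\<alpha>. \<forall>c<m. \<exists>l<2 * N. occ c l \<and> lit_true \<alpha> l)"

lemma item_cases:
  assumes "i < num_items"
  obtains "i < N" | l c where "i = N + l * m + c" "l < 2 * N" "c < m"
proof (cases "i < N")
  case False
  let ?l = "(i - N) div m" and ?c = "(i - N) mod m"
  have "i - N < 2 * N * m" using assms False unfolding num_items_def by simp
  then have "?l < 2 * N" by (simp add: less_mult_imp_div_less)
  moreover have "?c < m" using m_pos by simp
  moreover have "i = N + ?l * m + ?c" using False div_mult_mod_eq[of "i - N" m] by simp
  ultimately show ?thesis using that(2) by blast
qed (use that in blast)

lemma pair_item:
  assumes "l < 2 * N" "c < m"
  shows "N + l * m + c < num_items" "end1 (N + l * m + c) = (if occ c l then l else 2 * N + m)"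
    "end2 (N + l * m + c) = 2 * N + c" "load (N + l * m + c) = 1"
proof -
  have "Suc l * m \<le> 2 * N * m" using assms by (intro mult_right_mono) auto
  then show "N + l * m + c < num_items" using assms unfolding num_items_def by simp
  have "(l * m + c) div m = l" using assms by simp
  then show "end1 (N + l * m + c) = (if occ c l then l else 2 * N + m)"
    "end2 (N + l * m + c) = 2 * N + c"
    unfolding end1_def end2_def by (simp_all add: add.assoc)
qed (simp add: load_def)

sublocale balancing q num_bigs num_items bound end1 end2 load cap
proof
  show "q \<ge> 2" by (rule two_le_q)
  fix i assume i: "i < num_items"
  show "end1 i < num_bigs" "end2 i < num_bigs" "end1 i \<noteq> end2 i" "1 \<le> load i" "load i \<le> bound"
  proof -
    have "end1 i < num_bigs \<and> end2 i < num_bigs \<and> end1 i \<noteq> end2 i"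
      using i
    proof (cases rule: item_cases)
      case 1
      then show ?thesis by (auto simp: end1_def end2_def num_bigs_def)
    next
      case (2 l c)
      then show ?thesis by (auto simp: pair_item num_bigs_def)
    qed
    then show "end1 i < num_bigs" "end2 i < num_bigs" "end1 i \<noteq> end2 i" by auto
    show "1 \<le> load i" "load i \<le> bound" using m_pos unfolding load_def bound_def by auto
  qed
next
  fix r assume "r < num_bigs"
  show "cap r + num_items \<le> bound" "2 * cap r < bound" unfolding cap_def bound_def by auto
qed

text \<open>The machine of a true literal is free for the \<open>m\<close> pairs of this literal,
  that of a false literal is filled by the item of its variable, and a clause is relieved of its
  pair with one true literal.\<close>

lemma balanced_of_satisfiable:
  assumes "satisfiable"
  shows "\<exists>ch. balanced ch"
proof -
  obtain \<alpha> where \<alpha>: "\<And>c. c < m \<Longrightarrow> \<exists>l<2 * N. occ c l \<and> lit_true \<alpha> l"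
    using assms unfolding satisfiable_def by blast
  define ch where "ch i = (if i < N then (if \<alpha> i then end2 i else end1 i)
      else if end1 i < 2 * N \<and> lit_true \<alpha> (end1 i) then end1 i else end2 i)" for i
  have var: "ch i < 2 * N \<and> ch i div 2 = i \<and> \<not> lit_true \<alpha> (ch i)" if "i < N" for i
    using that unfolding ch_def end1_def end2_def lit_true_def by auto
  have pair: "ch (N + l * m + c) = (if occ c l \<and> lit_true \<alpha> l then l else 2 * N + c)"
    if "l < 2 * N" "c < m" for l c
    using that unfolding ch_def pair_item[OF that] by auto
  have "(\<Sum>i | i < num_items \<and> ch i = r. load i) \<le> cap r" if r: "r < num_bigs" for r
  proof -
    let ?I = "{i. i < num_items \<and> ch i = r}"
    have bound: "(\<Sum>i\<in>?I. load i) \<le> card X" if "?I \<subseteq> f ` X" "finite X" "\<And>i. i \<in> X \<Longrightarrow> load (f i) = 1" for f and X :: "nat set"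
    proof -
      have "(\<Sum>i\<in>?I. load i) \<le> (\<Sum>i\<in>f ` X. load i)" using that by (intro sum_mono2) auto
      also have "\<dots> = (\<Sum>i\<in>f ` X. 1)" using that(3) by (intro sum.cong) auto
      also have "\<dots> \<le> card X" using card_image_le[OF that(2)] by simp
      finally show ?thesis .
    qed
    consider "r < 2 * N" "lit_true \<alpha> r" | "r < 2 * N" "\<not> lit_true \<alpha> r"
      | c where "r = 2 * N + c" "c < m" | "r = 2 * N + m"
      using r unfolding num_bigs_def by (metis add_diff_inverse_nat less_Suc_eq nat_add_left_cancel_less Suc_eq_plus1)
    then show ?thesis
    proof cases
      case 1
      have "?I \<subseteq> (\<lambda>c. N + r * m + c) ` {..<m}"
      proof
        fix i assume "i \<in> ?I"
        then have i: "i < num_items" "ch i = r" by auto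
        from i(1) show "i \<in> (\<lambda>c. N + r * m + c) ` {..<m}"
        proof (cases rule: item_cases)
          case (2 l c)
          then show ?thesis using pair[of l c] i 1 by (auto split: if_splits)
        qed (use var[of i] i 1 in auto)
      qed
      from bound[OF this] show ?thesis using 1 pair_item(4) by (simp add: cap_def)
    next
      case 2
      have "?I \<subseteq> {r div 2}"
      proof
        fix i assume "i \<in> ?I"
        then have i: "i < num_items" "ch i = r" by auto
        from i(1) show "i \<in> {r div 2}"
        proof (cases rule: item_cases)
          case (2 l c)
          then show ?thesis using pair[of l c] i \<open>r < 2 * N\<close> \<open>\<not> lit_true \<alpha> r\<close> by (auto split: if_splits)
        qed (use var[of i] i in auto)
      qed
      then have "(\<Sum>i\<in>?I. load i) \<le> (\<Sum>i\<in>{r div 2}. load i)" by (intro sum_mono2) auto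
      moreover have "r div 2 < N" using 2 by linarith
      then have "load (r div 2) = m" by (simp add: load_def)
      ultimately show ?thesis using 2 by (simp add: cap_def)
    next
      case (3 c)
      obtain l0 where l0: "l0 < 2 * N" "occ c l0" "lit_true \<alpha> l0" using \<alpha>[OF 3(2)] by blast
      have "?I \<subseteq> (\<lambda>l. N + l * m + c) ` ({..<2 * N} - {l0})"
      proof
        fix i assume "i \<in> ?I"
        then have i: "i < num_items" "ch i = r" by auto
        from i(1) show "i \<in> (\<lambda>l. N + l * m + c) ` ({..<2 * N} - {l0})"
        proof (cases rule: item_cases)
          case (2 l c')
          then show ?thesis using pair[of l c'] i 3 l0 by (auto split: if_splits)
        qed (use var[of i] i 3 in auto)
      qed
      from bound[OF this] show ?thesis using 3 l0 pair_item(4) by (simp add: cap_def)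
    next
      case 4
      have "i \<notin> ?I" for i
      proof
        assume "i \<in> ?I"
        then have i: "i < num_items" "ch i = r" by auto
        from i(1) show False
        proof (cases rule: item_cases)
          case (2 l c)
          then show ?thesis using pair[of l c] i 4 by (auto split: if_splits)
        qed (use var[of i] i 4 in auto)
      qed
      then have "?I = {}" by blast
      then show ?thesis by (simp only: sum.empty zero_le)
    qed
  qed
  moreover have "ch i = end1 i \<or> ch i = end2 i" for i unfolding ch_def by auto
  ultimately show ?thesis unfolding balanced_def by blast
qed

text \<open>A clause without a true literal would receive all of its \<open>2 * N\<close> pairs: for
  a literal that does not occur, the alternative has capacity 0, and for one that occurs, the
  alternative is already filled by the item of the variable.\<close>

lemma satisfiable_of_balanced:
  assumes bal: "balanced ch"
  shows satisfiable
proof -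
  have ch: "ch i = end1 i \<or> ch i = end2 i" if "i < num_items" for i
    using bal that unfolding balanced_def by blast
  have le: "(\<Sum>i\<in>X. load i) \<le> cap r"
    if "r < num_bigs" "X \<subseteq> {..<num_items}" "\<And>i. i \<in> X \<Longrightarrow> ch i = r" for r X
  proof -
    have "(\<Sum>i\<in>X. load i) \<le> (\<Sum>i | i < num_items \<and> ch i = r. load i)"
      using that by (intro sum_mono2) auto
    also have "\<dots> \<le> cap r" using bal that(1) unfolding balanced_def by blast
    finally show ?thesis .
  qed
  \<comment> \<open>The literal on whose machine the item of a variable lies is the false one;
    \<open>end2 v\<close> is the machine of the negated variable.\<close>
  define \<alpha> where "\<alpha> v \<longleftrightarrow> ch v = end2 v" for v
  have "\<exists>l<2 * N. occ c l \<and> lit_true \<alpha> l" if c: "c < m" for c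
  proof (rule ccontr)
    assume no: "\<not> ?thesis"
    have "ch (N + l * m + c) = 2 * N + c" if l: "l < 2 * N" for l
    proof (rule ccontr)
      let ?i = "N + l * m + c"
      note pi = pair_item[OF l c]
      assume "ch ?i \<noteq> 2 * N + c"
      then have e: "ch ?i = (if occ c l then l else 2 * N + m)" using ch[OF pi(1)] pi by simp
      show False
      proof (cases "occ c l")
        case False
        then have "(\<Sum>i\<in>{?i}. load i) \<le> cap (2 * N + m)"
          using e pi by (intro le) (auto simp: num_bigs_def)
        then show False using pi by (simp add: cap_def)
      next
        case True
        let ?v = "l div 2"
        have v: "?v < N" "?v < num_items" using l unfolding num_items_def by auto
        have "\<not> lit_true \<alpha> l" using no True l by blast
        then have "ch ?v = l"
          using ch[OF v(2)] v(1) unfolding lit_true_def \<alpha>_def end1_def end2_def by (cases "even l") auto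
        then have "(\<Sum>i\<in>{?v, ?i}. load i) \<le> cap l"
          using e pi True v l by (intro le) (auto simp: num_bigs_def)
        moreover have "?v \<noteq> ?i" using v(1) by linarith
        ultimately show False using pi v(1) l by (simp add: cap_def load_def)
      qed
    qed
    then have "(\<Sum>i\<in>(\<lambda>l. N + l * m + c) ` {..<2 * N}. load i) \<le> cap (2 * N + c)"
      using c pair_item(1) by (intro le) (auto simp: num_bigs_def)
    moreover have "inj_on (\<lambda>l. N + l * m + c) {..<2 * N}" using m_pos by (auto simp: inj_on_def)
    then have "(\<Sum>i\<in>(\<lambda>l. N + l * m + c) ` {..<2 * N}. load i) = (\<Sum>l<2 * N. 1)"
      using c by (subst sum.reindex) (auto simp: pair_item intro!: sum.cong)
    ultimately show False using c N_pos by (simp add: cap_def)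
  qed
  then show ?thesis unfolding satisfiable_def by blast
qed

theorem coloring_iff_satisfiable:
  "encode_instance nv edges bound \<in> min_max_edge_coloring q \<longleftrightarrow> satisfiable"
proof -
  have "encode_instance nv edges bound \<in> min_max_edge_coloring q \<longleftrightarrow>
      (\<exists>\<sigma>. edge_q_coloring q {0..<nv} edges \<sigma> \<and> (\<forall>c. card (color_group edges \<sigma> c) \<le> bound))"
  proof
    assume "encode_instance nv edges bound \<in> min_max_edge_coloring q"
    then obtain n E L where eq: "encode_instance nv edges bound = encode_instance n E L"
      and G: "simple_graph {0..<n} E"
      and ex: "\<exists>\<sigma>. edge_q_coloring q {0..<n} E \<sigma> \<and> (\<forall>c. card (color_group E \<sigma> c) \<le> L)"
      unfolding min_max_edge_coloring_def by blast
    \<comment> \<open>A string encodes at most one graph and bound.\<close>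
    have "nv = n" and "edges = E" and "bound = L"
      using encode_instance_inject[OF eq simple_graph_edges G] by blast+
    then show "\<exists>\<sigma>. edge_q_coloring q {0..<nv} edges \<sigma> \<and> (\<forall>c. card (color_group edges \<sigma> c) \<le> bound)"
      using ex by metis
  qed (use simple_graph_edges in \<open>auto simp: min_max_edge_coloring_def\<close>)
  then show ?thesis
    using coloring_iff_balanced balanced_of_satisfiable satisfiable_of_balanced by blast
qed

end

section \<open>Computing the graph in polynomial time\<close>

lemma (in cnf) is_balancing: "balancing q num_bigs num_items bound end1 end2 load cap"
  by (rule balancing_axioms)

text \<open>Adjacency in terms of bounded quantifiers is open to the rules \<open>expr\<close>, in
  contrast to membership in a set of sets.\<close>

lemma (in cnf) edge_iff:
  "{i, j} \<in> edges \<longleftrightarrow>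
     (\<exists>u<nu. \<exists>k<deg u. i = u \<and> j = nbr u k \<or> j = u \<and> i = nbr u k)"
  unfolding edges_def by (auto simp: doubleton_eq_iff)

lemma (in cnf) encode_eq:
  "encode_instance nv edges bound = replicate nv True @ [False] @
     concat (map (\<lambda>i. map (\<lambda>j. \<exists>u<nu. \<exists>k<deg u. i = u \<and> j = nbr u k \<or> j = u \<and> i = nbr u k)
       [0..<nv]) [0..<nv]) @ bin bound"
  unfolding encode_instance_def adjacency_matrix_def edge_iff ..

text \<open>All quantities of the construction are composed of arithmetic operations and case
  distinctions, so their computability follows from the shape of their definitions.\<close>

theorem poly_time_encode_cnf:
  fixes N m :: "bool list \<Rightarrow> nat" and occ :: "bool list \<Rightarrow> nat \<Rightarrow> nat \<Rightarrow> bool"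
  assumes cnf: "\<And>x. cnf q (N x) (m x)"
    and N: "expressible (\<lambda>x s. N x)" and m: "expressible (\<lambda>x s. m x)"
    and occ: "decidable (\<lambda>x s. occ x (s 0) (s 1))"
  defines "nb \<equiv> \<lambda>x. cnf.num_bigs (N x) (m x)" and "ni \<equiv> \<lambda>x. cnf.num_items (N x) (m x)"
    and "L \<equiv> \<lambda>x. cnf.bound (N x) (m x)" and "e1 \<equiv> \<lambda>x. cnf.end1 (N x) (m x) (occ x)"
    and "e2 \<equiv> \<lambda>x. cnf.end2 (N x) (m x)" and "ld \<equiv> \<lambda>x. cnf.load (N x) (m x)"
    and "cp \<equiv> \<lambda>x. cnf.cap (N x) (m x)"
  shows "poly_time_computable (\<lambda>x. encode_instance (balancing.nv q (nb x) (ni x) (L x))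
      (balancing.edges q (nb x) (ni x) (L x) (e1 x) (e2 x) (ld x) (cp x)) (L x))"
proof -
  note defs = nb_def ni_def L_def e1_def e2_def ld_def cp_def
  have bal: "balancing q (nb x) (ni x) (L x) (e1 x) (e2 x) (ld x) (cp x)" for x
    unfolding defs by (rule cnf.is_balancing[OF cnf])
  note [expr] = N m
  have occ': "decidable (\<lambda>x s. occ x (f x s) (g x s))" if "expressible f" "expressible g" for f g
    by (rule decidable_comp2[where P = occ, OF occ that])
  have [expr]: "expressible (\<lambda>x s. nb x)" "expressible (\<lambda>x s. ni x)"
    unfolding defs cnf.num_bigs_def[OF cnf] cnf.num_items_def[OF cnf] by (intro expr)+
  then have [expr]: "expressible (\<lambda>x s. L x)"
    unfolding defs cnf.bound_def[OF cnf] by (intro expr)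
  have "expressible (\<lambda>x s. e1 x (s 0))" "expressible (\<lambda>x s. e2 x (s 0))"
    "expressible (\<lambda>x s. ld x (s 0))" "expressible (\<lambda>x s. cp x (s 0))"
    unfolding defs cnf.end1_def[OF cnf] cnf.end2_def[OF cnf] cnf.load_def[OF cnf] cnf.cap_def[OF cnf]
    by (intro expr expressible_div occ')+
  note 1 = this[THEN expressible_comp1]
  have e1: "expressible (\<lambda>x s. e1 x (f x s))" and e2: "expressible (\<lambda>x s. e2 x (f x s))"
    and ld: "expressible (\<lambda>x s. ld x (f x s))" and cp: "expressible (\<lambda>x s. cp x (f x s))"
    if "expressible f" for f
    by (rule 1[OF that])+
  let ?nu = "\<lambda>x. balancing.nu q (nb x) (ni x)" and ?nv = "\<lambda>x. balancing.nv q (nb x) (ni x) (L x)"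
  let ?deg = "\<lambda>x. balancing.deg q (nb x) (L x) (ld x) (cp x)"
  let ?nbr = "\<lambda>x. balancing.nbr q (nb x) (ni x) (L x) (e1 x) (e2 x)"
  have [expr]: "expressible (\<lambda>x s. balancing.nn q (nb x))"
    unfolding balancing.nn_def[OF bal] by (intro expr)
  have [expr]: "expressible (\<lambda>x s. ?nu x)"
    unfolding balancing.nu_def[OF bal] by (intro expr)
  have [expr]: "expressible (\<lambda>x s. ?nv x)"
    unfolding balancing.nv_def[OF bal] by (intro expr)
  have "expressible (\<lambda>x s. ?deg x (s 0))"
    unfolding balancing.deg_def[OF bal] balancing.slack_def[OF bal] by (intro expr ld cp)
  from expressible_comp1[OF this]
  have deg: "expressible (\<lambda>x s. ?deg x (f x s))" if "expressible f" for f using that .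
  have "expressible (\<lambda>x s. ?nbr x (s 0) (s 1))"
    unfolding balancing.nbr_def[OF bal] balancing.is_item_def[OF bal] balancing.conn_def[OF bal]
    by (intro expr e1 e2)
  from expressible_comp2[OF this]
  have nbr: "expressible (\<lambda>x s. ?nbr x (f x s) (g x s))" if "expressible f" "expressible g" for f g using that .
  have "printable (\<lambda>x s. replicate (?nv x) True @ [False] @
     concat (map (\<lambda>i. map (\<lambda>j. \<exists>u<?nu x. \<exists>k<?deg x u. i = u \<and> j = ?nbr x u k \<or> j = u \<and> i = ?nbr x u k)
       [0..<?nv x]) [0..<?nv x]) @ bin (L x))"
    by (intro printable_append printable_replicate printable_bit printable_concat printable_map
        printable_bin expr deg nbr)
  then show ?thesis
    unfolding defs cnf.encode_eq[OF cnf] by (rule printable_poly_time)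
qed

corollary cnf_reducible:
  fixes N m :: "bool list \<Rightarrow> nat" and occ :: "bool list \<Rightarrow> nat \<Rightarrow> nat \<Rightarrow> bool"
  assumes cnf: "\<And>x. cnf q (N x) (m x)"
    and "expressible (\<lambda>x s. N x)" "expressible (\<lambda>x s. m x)" "decidable (\<lambda>x s. occ x (s 0) (s 1))"
    and A: "\<And>x. x \<in> A \<longleftrightarrow> cnf.satisfiable (N x) (m x) (occ x)"
  shows "A \<le>\<^sub>p min_max_edge_coloring q"
  unfolding poly_time_reducible_def
  using poly_time_encode_cnf[OF assms(1-4)] cnf.coloring_iff_satisfiable[OF cnf] A by blast

section \<open>Clause schemas\<close>

text \<open>
  A literal \<open>(b, \<kappa>, i, j, d)\<close> of a rule, instantiated at time \<open>t\<close> and positions \<open>p\<close> and \<open>r\<close>, says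
  that the variable of kind \<open>\<kappa>\<close> at time \<open>t + i\<close> and position \<open>place j d p r\<close> has the value \<open>b\<close>.
  A rule is a guard together with the literals of its clauses.
\<close>

type_synonym 'k literal = "bool \<times> 'k \<times> nat \<times> nat \<times> nat"
type_synonym guard = "bool list \<Rightarrow> nat \<Rightarrow> nat \<Rightarrow> nat \<Rightarrow> bool"
type_synonym 'k rule = "guard \<times> 'k literal list"

definition place :: "nat \<Rightarrow> nat \<Rightarrow> nat \<Rightarrow> nat \<Rightarrow> nat" where
  "place j d p r = (if j = 0 then p + d else if j = 1 then r else 0)"

fun holds :: "('k \<Rightarrow> nat \<Rightarrow> nat \<Rightarrow> bool) \<Rightarrow> nat \<Rightarrow> nat \<Rightarrow> nat \<Rightarrow> 'k literal \<Rightarrow> bool" where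
  "holds \<alpha> t p r (b, \<kappa>, i, j, d) \<longleftrightarrow> (\<alpha> \<kappa> (t + i) (place j d p r) \<longleftrightarrow> b)"

definition models ::
  "'k rule list \<Rightarrow> nat \<Rightarrow> nat \<Rightarrow> bool list \<Rightarrow> ('k \<Rightarrow> nat \<Rightarrow> nat \<Rightarrow> bool) \<Rightarrow> bool" where
  "models rules T P x \<alpha> \<longleftrightarrow> (\<forall>(g, ls) \<in> set rules. \<forall>t<T. \<forall>p<P. \<forall>r<P.
     g x t p r \<longrightarrow> (\<exists>l \<in> set ls. holds \<alpha> t p r l))"

fun literal_ok :: "'k literal \<Rightarrow> bool" where
  "literal_ok (b, \<kappa>, i, j, d) \<longleftrightarrow> i \<le> 1 \<and> d \<le> 2"

definition rule_ok :: "'k rule \<Rightarrow> bool" where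
  "rule_ok R \<longleftrightarrow> decidable (\<lambda>x s. fst R x (s 0) (s 1) (s 2)) \<and> (\<forall>l \<in> set (snd R). literal_ok l)"

section \<open>Numbering the variables and the clauses\<close>

lemma radix_less: "a < A \<Longrightarrow> b < B \<Longrightarrow> a * B + b < A * (B :: nat)"
proof -
  assume "a < A" "b < B"
  moreover from this have "Suc a * B \<le> A * B" by (intro mult_right_mono) auto
  ultimately show ?thesis by simp
qed

lemma radix_ex:
  assumes "c < A * (B :: nat)"
  shows "\<exists>a<A. \<exists>b<B. c = a * B + b"
proof -
  have "B > 0" using assms by (cases B) auto
  then show ?thesis using assms
    by (intro exI[of _ "c div B"] conjI exI[of _ "c mod B"]) (auto simp: less_mult_imp_div_less)
qed

lemma radix_inject: "a * B + b = a' * B + b' \<Longrightarrow> b < B \<Longrightarrow> b' < B \<Longrightarrow> a = a' \<and> b = (b' :: nat)"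
  by (metis add.commute add_left_cancel div_mult_self1 div_less add_0_right less_nat_zero_code)

text \<open>Literals look one step ahead in time and up to two positions to the right, hence
  \<open>T + 1\<close> times and \<open>P + 2\<close> positions.\<close>

definition var_code :: "nat \<Rightarrow> nat \<Rightarrow> nat \<Rightarrow> nat \<Rightarrow> nat \<Rightarrow> nat" where
  "var_code T P k t p = (k * (T + 1) + t) * (P + 2) + p"

definition clause_code :: "nat \<Rightarrow> nat \<Rightarrow> nat \<Rightarrow> nat \<Rightarrow> nat \<Rightarrow> nat \<Rightarrow> nat" where
  "clause_code T P a t p r = ((a * T + t) * P + p) * P + r"

lemma var_code_inject:
  "var_code T P k t p = var_code T P k' t' p' \<Longrightarrow> t \<le> T \<Longrightarrow> t' \<le> T \<Longrightarrow> p < P + 2 \<Longrightarrow> p' < P + 2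
    \<Longrightarrow> k = k' \<and> t = t' \<and> p = p'"
  unfolding var_code_def by (metis radix_inject Suc_eq_plus1 less_Suc_eq_le)

lemma clause_code_inject:
  "clause_code T P a t p r = clause_code T P a' t' p' r' \<Longrightarrow> t < T \<Longrightarrow> t' < T \<Longrightarrow> p < P \<Longrightarrow> p' < P
    \<Longrightarrow> r < P \<Longrightarrow> r' < P \<Longrightarrow> a = a' \<and> t = t' \<and> p = p' \<and> r = r'"
  unfolding clause_code_def by (metis radix_inject)

fun literal_code :: "('k \<Rightarrow> nat) \<Rightarrow> nat \<Rightarrow> nat \<Rightarrow> nat \<Rightarrow> nat \<Rightarrow> nat \<Rightarrow> 'k literal \<Rightarrow> nat" where
  "literal_code h T P t p r (b, \<kappa>, i, j, d) =
     2 * var_code T P (h \<kappa>) (t + i) (place j d p r) + (if b then 0 else 1)"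

text \<open>If the guard of a clause is false, then all literals occur in the clause.\<close>

definition occurs ::
  "('k \<Rightarrow> nat) \<Rightarrow> 'k rule list \<Rightarrow> nat \<Rightarrow> nat \<Rightarrow> bool list \<Rightarrow> nat \<Rightarrow> nat \<Rightarrow> bool" where
  "occurs h rules T P x c l \<longleftrightarrow> (\<exists>(a, g, ls) \<in> set (List.enumerate 0 rules). \<exists>t<T. \<exists>p<P. \<exists>r<P.
     c = clause_code T P a t p r \<and> (g x t p r \<longrightarrow> (\<exists>k \<in> set ls. l = literal_code h T P t p r k)))"

lemma in_set_enumerate_0: "(a, R) \<in> set (List.enumerate 0 xs) \<longleftrightarrow> a < length xs \<and> xs ! a = R"
  by (auto simp: in_set_enumerate_eq)

text \<open>The list of rules does not depend on the input, so the choice of a rule is a finite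
  disjunction, and only the time and the two positions are quantified.\<close>

lemma decidable_occurs:
  assumes ok: "\<And>R. R \<in> set rules \<Longrightarrow> rule_ok R"
    and T: "expressible (\<lambda>x s. T x)" and P: "expressible (\<lambda>x s. P x)"
  shows "decidable (\<lambda>x s. occurs h rules (T x) (P x) x (s 0) (s 1))"
proof -
  note [expr] = T P
  have code: "expressible (\<lambda>x s. literal_code h (T x) (P x) (a x s) (b x s) (c x s) k)"
    if "expressible a" "expressible b" "expressible c" for a b c k
    using that by (cases k) (simp only: literal_code.simps var_code_def place_def, intro expr, assumption+)
  have "decidable (\<lambda>x s. case R of (a, g, ls) \<Rightarrow> \<exists>t<T x. \<exists>p<P x. \<exists>r<P x.
     s 0 = clause_code (T x) (P x) a t p r \<and>
     (g x t p r \<longrightarrow> (\<exists>k \<in> set ls. s 1 = literal_code h (T x) (P x) t p r k)))"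
    if "R \<in> set (List.enumerate 0 rules)" for R
  proof -
    obtain a g ls where R: "R = (a, g, ls)" by (cases R) auto
    with that have "a < length rules" "rules ! a = (g, ls)" by (simp_all add: in_set_enumerate_0)
    then have "(g, ls) \<in> set rules" using nth_mem by fastforce
    from ok[OF this] have "decidable (\<lambda>x s. g x (s 0) (s 1) (s 2))" unfolding rule_ok_def by simp
    from decidable_comp3[where P = g, OF this]
    have g: "decidable (\<lambda>x s. g x (f1 x s) (f2 x s) (f3 x s))"
      if "expressible f1" "expressible f2" "expressible f3" for f1 f2 f3 using that .
    show ?thesis unfolding R prod.case clause_code_def by (intro expr g code)
  qed
  then show ?thesis unfolding occurs_def by (rule decidable_ex_list)
qed

lemma occursI:
  assumes "(a, g, ls) \<in> set (List.enumerate 0 rules)" "t < T" "p < P" "r < P"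
    and "g x t p r \<Longrightarrow> \<exists>k \<in> set ls. l = literal_code h T P t p r k"
  shows "occurs h rules T P x (clause_code T P a t p r) l"
  unfolding occurs_def by (rule bexI[OF _ assms(1)]) (use assms in auto)

lemma occursE:
  assumes "occurs h rules T P x c l"
  obtains a g ls t p r where "(a, g, ls) \<in> set (List.enumerate 0 rules)" "t < T" "p < P" "r < P"
    "c = clause_code T P a t p r" "g x t p r \<longrightarrow> (\<exists>k \<in> set ls. l = literal_code h T P t p r k)"
proof -
  obtain R where R: "R \<in> set (List.enumerate 0 rules)" "case R of (a, g, ls) \<Rightarrow> \<exists>t<T. \<exists>p<P. \<exists>r<P.
     c = clause_code T P a t p r \<and> (g x t p r \<longrightarrow> (\<exists>k \<in> set ls. l = literal_code h T P t p r k))"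
    using assms unfolding occurs_def by blast
  obtain a g ls where "R = (a, g, ls)" by (cases R) auto
  with R that show thesis by blast
qed

lemma modelsD:
  assumes "models rules T P x \<alpha>" "(g, ls) \<in> set rules" "t < T" "p < P" "r < P" "g x t p r"
  shows "\<exists>l \<in> set ls. holds \<alpha> t p r l"
  using bspec[OF assms(1)[unfolded models_def] assms(2)] assms(3-) by simp

theorem models_reducible:
  fixes rules :: "'k rule list"
  assumes q: "q \<ge> 2" and ne: "rules \<noteq> []" "\<And>R. R \<in> set rules \<Longrightarrow> snd R \<noteq> []"
    and ok: "\<And>R. R \<in> set rules \<Longrightarrow> rule_ok R"
    and T: "expressible (\<lambda>x s. T x)" "\<And>x. T x \<ge> 1" and P: "expressible (\<lambda>x s. P x)" "\<And>x. P x \<ge> 1"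
    and A: "\<And>x. x \<in> A \<longleftrightarrow> (\<exists>\<alpha>. models rules (T x) (P x) x \<alpha>)"
  shows "A \<le>\<^sub>p min_max_edge_coloring q"
proof -
  \<comment> \<open>The type of kinds may be infinite, but finitely many of them appear in the rules
    and can be numbered.\<close>
  define kinds where "kinds = (\<Union>R \<in> set rules. (\<lambda>l. fst (snd l)) ` set (snd R))"
  have fin: "finite kinds" unfolding kinds_def by auto
  obtain h and K :: nat where h: "h ` kinds = {i. i < K}" "inj_on h kinds"
    using finite_imp_inj_to_nat_seg[OF fin] by auto
  have kind: "\<kappa> \<in> kinds" "h \<kappa> < K" if "(g, ls) \<in> set rules" "(b, \<kappa>, i, j, d) \<in> set ls" for g ls b \<kappa> i j d
  proof -
    show "\<kappa> \<in> kinds" unfolding kinds_def using that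
      by (intro UN_I[of "(g, ls)"] image_eqI[of _ _ "(b, \<kappa>, i, j, d)"]) auto
    then show "h \<kappa> < K" using h(1) by blast
  qed
  have "kinds \<noteq> {}"
  proof -
    obtain g ls l where "(g, ls) \<in> set rules" "l \<in> set ls"
      using ne by (metis list.set_intros(1) neq_Nil_conv prod.collapse)
    then show ?thesis using kind by (cases l) blast
  qed
  then have K: "K \<ge> 1" using h by fastforce
  define N where "N x = K * (T x + 1) * (P x + 2)" for x
  define m where "m x = length rules * T x * P x * P x" for x
  let ?occ = "\<lambda>x. occurs h rules (T x) (P x) x"
  have cnf: "cnf q (N x) (m x)" for x
  proof
    show "1 \<le> N x" using K unfolding N_def by simp
    show "1 \<le> m x" using T(2)[of x] P(2)[of x] ne unfolding m_def by (simp add: Suc_leI)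
  qed (rule q)
  have var_less: "var_code (T x) (P x) k t p < N x" if "k < K" "t \<le> T x" "p < P x + 2" for x k t p
    using that unfolding var_code_def N_def by (intro radix_less) auto
  have lit: "t + i \<le> T x" "place j d p r < P x + 2"
    if R: "(g, ls) \<in> set rules" "(b, \<kappa>, i, j, d) \<in> set ls" and "t < T x" "p < P x" "r < P x"
    for g ls b \<kappa> i j d t p r x
  proof -
    have "literal_ok (b, \<kappa>, i, j, d)" using ok[OF R(1)] R(2) unfolding rule_ok_def by (metis snd_conv)
    then have "i \<le> 1" "d \<le> 2" by simp_all
    then show "t + i \<le> T x" "place j d p r < P x + 2" using that unfolding place_def by auto
  qed
  have "(\<exists>\<alpha>. models rules (T x) (P x) x \<alpha>) \<longleftrightarrow> cnf.satisfiable (N x) (m x) (?occ x)" for x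
  proof
    assume "\<exists>\<alpha>. models rules (T x) (P x) x \<alpha>"
    then obtain \<alpha> where \<alpha>: "models rules (T x) (P x) x \<alpha>" by blast
    define \<beta> where "\<beta> v \<longleftrightarrow> (\<exists>\<kappa>\<in>kinds. \<exists>t\<le>T x. \<exists>p<P x + 2. v = var_code (T x) (P x) (h \<kappa>) t p \<and> \<alpha> \<kappa> t p)" for v
    have \<beta>: "\<beta> (var_code (T x) (P x) (h \<kappa>) t p) \<longleftrightarrow> \<alpha> \<kappa> t p"
      if "\<kappa> \<in> kinds" "t \<le> T x" "p < P x + 2" for \<kappa> t p
    proof
      assume "\<beta> (var_code (T x) (P x) (h \<kappa>) t p)"
      then obtain \<kappa>' t' p' where *: "\<kappa>' \<in> kinds" "t' \<le> T x" "p' < P x + 2" "\<alpha> \<kappa>' t' p'"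
        "var_code (T x) (P x) (h \<kappa>) t p = var_code (T x) (P x) (h \<kappa>') t' p'"
        unfolding \<beta>_def by blast
      from var_code_inject[OF *(5) that(2) *(2) that(3) *(3)] have "h \<kappa> = h \<kappa>'" "t = t'" "p = p'" by auto
      then show "\<alpha> \<kappa> t p" using *(1,4) that(1) h(2) by (metis inj_onD)
    qed (use that in \<open>auto simp: \<beta>_def\<close>)
    have "\<exists>l<2 * N x. ?occ x c l \<and> cnf.lit_true \<beta> l" if c_less: "c < m x" for c
    proof -
      obtain a t p r where c: "c = clause_code (T x) (P x) a t p r"
        and lt: "a < length rules" "t < T x" "p < P x" "r < P x"
      proof -
        obtain c1 r where 1: "c1 < length rules * T x * P x" "r < P x" "c = c1 * P x + r"
          using c_less unfolding m_def using radix_ex by blast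
        obtain c2 p where 2: "c2 < length rules * T x" "p < P x" "c1 = c2 * P x + p"
          using radix_ex[OF 1(1)] by blast
        obtain a t where 3: "a < length rules" "t < T x" "c2 = a * T x + t"
          using radix_ex[OF 2(1)] by blast
        show thesis by (rule that[OF _ 3(1,2) 2(2) 1(2)]) (simp only: clause_code_def 1 2 3)
      qed
      obtain g ls where R: "rules ! a = (g, ls)" by fastforce
      with lt(1) have mem: "(a, g, ls) \<in> set (List.enumerate 0 rules)" "(g, ls) \<in> set rules"
        using nth_mem[of a rules] by (simp_all add: in_set_enumerate_0)
      show ?thesis
      proof (cases "g x t p r")
        case False
        then have occ: "?occ x c l" for l
          unfolding c by (intro occursI[OF mem(1) lt(2-4)]) simp
        \<comment> \<open>All literals occur in this clause, among them the true literal of variable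
          0.\<close>
        have "N x > 0" using cnf.N_pos[OF cnf, of x] by simp
        then show ?thesis
          using occ by (intro exI[of _ "if \<beta> 0 then 0 else 1"]) (auto simp: cnf.lit_true_def[OF cnf])
      next
        case True
        then obtain k where k: "k \<in> set ls" "holds \<alpha> t p r k"
          using modelsD[OF \<alpha> mem(2) lt(2-4)] by blast
        obtain b \<kappa> i j d where kk: "k = (b, \<kappa>, i, j, d)" by (cases k)
        note k' = k(1)[unfolded kk]
        let ?v = "var_code (T x) (P x) (h \<kappa>) (t + i) (place j d p r)"
        let ?l = "literal_code h (T x) (P x) t p r k"
        have v: "?v < N x" by (intro var_less kind(2)[OF mem(2) k'] lit[OF mem(2) k' lt(2-4)])
        have "\<beta> ?v \<longleftrightarrow> b"
          using k(2) \<beta>[OF kind(1)[OF mem(2) k'] lit[OF mem(2) k' lt(2-4)]] unfolding kk by simp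
        then have "cnf.lit_true \<beta> ?l" unfolding cnf.lit_true_def[OF cnf] kk by simp
        moreover have "?l < 2 * N x" using v unfolding kk by simp
        moreover have "?occ x c ?l" unfolding c using k(1) by (intro occursI[OF mem(1) lt(2-4)]) blast
        ultimately show ?thesis by blast
      qed
    qed
    then show "cnf.satisfiable (N x) (m x) (?occ x)"
      unfolding cnf.satisfiable_def[OF cnf] by blast
  next
    assume "cnf.satisfiable (N x) (m x) (?occ x)"
    then obtain \<beta> where \<beta>: "\<And>c. c < m x \<Longrightarrow> \<exists>l<2 * N x. ?occ x c l \<and> cnf.lit_true \<beta> l"
      unfolding cnf.satisfiable_def[OF cnf] by blast
    define \<alpha> where "\<alpha> \<kappa> t p = \<beta> (var_code (T x) (P x) (h \<kappa>) t p)" for \<kappa> t p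
    have "\<exists>l\<in>set ls. holds \<alpha> t p r l"
      if mem: "(g, ls) \<in> set rules" and lt: "t < T x" "p < P x" "r < P x" and g: "g x t p r" for g ls t p r
    proof -
      obtain a where a: "a < length rules" "rules ! a = (g, ls)" using mem by (meson in_set_conv_nth)
      let ?c = "clause_code (T x) (P x) a t p r"
      have "?c < m x" unfolding clause_code_def m_def by (intro radix_less a lt)
      then obtain l where l: "?occ x ?c l" "cnf.lit_true \<beta> l" using \<beta> by blast
      from l(1) obtain a' g' ls' t' p' r' where o: "(a', g', ls') \<in> set (List.enumerate 0 rules)"
        "t' < T x" "p' < P x" "r' < P x" "?c = clause_code (T x) (P x) a' t' p' r'"
        "g' x t' p' r' \<longrightarrow> (\<exists>k\<in>set ls'. l = literal_code h (T x) (P x) t' p' r' k)"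
        by (rule occursE)
      have eq: "a' = a" "t' = t" "p' = p" "r' = r"
        using clause_code_inject[OF o(5) lt(1) o(2) lt(2) o(3) lt(3) o(4)] by auto
      then have "g' = g" "ls' = ls" using o(1) a(2) by (auto simp: in_set_enumerate_0)
      with o(6) g eq obtain k where k: "k \<in> set ls" "l = literal_code h (T x) (P x) t p r k" by blast
      have "holds \<alpha> t p r k"
        using l(2) unfolding k(2) cnf.lit_true_def[OF cnf] by (cases k) (auto simp: \<alpha>_def split: if_splits)
      with k(1) show ?thesis by blast
    qed
    then have "models rules (T x) (P x) x \<alpha>" unfolding models_def by auto
    then show "\<exists>\<alpha>. models rules (T x) (P x) x \<alpha>" by blast
  qed
  then have A': "x \<in> A \<longleftrightarrow> cnf.satisfiable (N x) (m x) (?occ x)" for x using A by simp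
  note [expr] = T(1) P(1)
  have "expressible (\<lambda>x s. N x)" "expressible (\<lambda>x s. m x)"
    unfolding N_def m_def by (intro expr)+
  from cnf_reducible[OF cnf this decidable_occurs[OF ok T(1) P(1)] A'] show ?thesis .
qed

section \<open>Computations as models of clause schemas\<close>

text \<open>\<open>Read i a\<close> records the symbol scanned on tape \<open>i\<close> without the
  position of the head. A rule for an action can thus combine the symbols of all tapes and still
  mention just one position. Variables without a position of their own are kept at position
  0.\<close>

datatype kind = State nat | Head nat | Cell nat nat | Read nat nat

locale verifier =
  fixes M :: tm
  assumes wf: "wf_tm M" and two_tapes: "2 \<le> n_tapes M"
begin

text \<open>A halted machine is regarded as rewriting the scanned symbols in place, so the same
  clauses preserve its configuration until the time bound.\<close>

definition next_action :: "nat \<Rightarrow> nat list \<Rightarrow> nat \<times> (nat \<times> move) list" where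
  "next_action s rs = (if s < n_states M then trans M s rs else (s, map (\<lambda>a. (a, Stay)) rs))"

definition cfg :: "bool list \<Rightarrow> bool list \<Rightarrow> nat \<Rightarrow> config" where
  "cfg x u t = (step M ^^ t) (init_config M [x, u])"
definition st :: "bool list \<Rightarrow> bool list \<Rightarrow> nat \<Rightarrow> nat" where
  "st x u t = fst (cfg x u t)"
definition cell :: "bool list \<Rightarrow> bool list \<Rightarrow> nat \<Rightarrow> nat \<Rightarrow> int \<Rightarrow> nat" where
  "cell x u t i = fst (snd (cfg x u t) ! i)"
definition head :: "bool list \<Rightarrow> bool list \<Rightarrow> nat \<Rightarrow> nat \<Rightarrow> int" where
  "head x u t i = snd (snd (cfg x u t) ! i)"
definition reads :: "bool list \<Rightarrow> bool list \<Rightarrow> nat \<Rightarrow> nat list" where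
  "reads x u t = map (\<lambda>i. cell x u t i (head x u t i)) [0..<n_tapes M]"

lemma next_action_ok:
  assumes "s \<le> n_states M" "length rs = n_tapes M" "set rs \<subseteq> {..<n_symbols M}" "next_action s rs = (s', acts)"
  shows "s' \<le> n_states M" "length acts = n_tapes M" "i < n_tapes M \<Longrightarrow> fst (acts ! i) < n_symbols M"
proof -
  have "s' \<le> n_states M \<and> length acts = n_tapes M \<and> fst ` set acts \<subseteq> {..<n_symbols M}"
  proof (cases "s < n_states M")
    case True
    with assms wf show ?thesis unfolding wf_tm_def next_action_def by (auto split: prod.splits)
  next
    case False
    with assms show ?thesis unfolding next_action_def by (auto simp: image_image)
  qed
  then show "s' \<le> n_states M" "length acts = n_tapes M" "i < n_tapes M \<Longrightarrow> fst (acts ! i) < n_symbols M"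
    by (auto simp: image_subset_iff)
qed

lemma step_next_action:
  "step M (s, ts) = (case next_action s (map read_tape ts) of (s', acts) \<Rightarrow> (s', map2 act_tape acts ts))"
proof (cases "s < n_states M")
  case False
  have "map2 act_tape (map (\<lambda>a. (a, Stay)) (map read_tape ts)) ts = ts"
    by (induction ts) auto
  with False show ?thesis unfolding next_action_def by simp
qed (simp add: next_action_def)

lemma cfg_0:
  "st x u 0 = 0" "i < n_tapes M \<Longrightarrow> head x u 0 i = 0"
  "cell x u 0 0 = symb x" "cell x u 0 1 = symb u" "2 \<le> i \<Longrightarrow> i < n_tapes M \<Longrightarrow> cell x u 0 i j = 0"
  "length (snd (cfg x u 0)) = n_tapes M"
proof -
  have *: "cfg x u 0 = (0, input_tape x # input_tape u # replicate (n_tapes M - 2) (input_tape []))"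
    unfolding cfg_def init_config_def by simp
  show "st x u 0 = 0" "cell x u 0 0 = symb x" "cell x u 0 1 = symb u"
    "length (snd (cfg x u 0)) = n_tapes M"
    using two_tapes unfolding st_def cell_def * by simp_all
  have n: "(input_tape x # input_tape u # replicate (n_tapes M - 2) (input_tape [])) ! i =
      (if i = 0 then input_tape x else if i = 1 then input_tape u else input_tape [])" if "i < n_tapes M" for i
    using that by (simp add: nth_Cons' numeral_2_eq_2)
  show "i < n_tapes M \<Longrightarrow> head x u 0 i = 0" "2 \<le> i \<Longrightarrow> i < n_tapes M \<Longrightarrow> cell x u 0 i j = 0"
    unfolding head_def cell_def * snd_conv by (simp_all only: n) (auto simp: input_tape_def)
qed

lemma cfg_Suc_aux:
  assumes len: "length (snd (cfg x u t)) = n_tapes M"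
    and na: "next_action (st x u t) (reads x u t) = (s', acts)" "length acts = n_tapes M"
  shows "cfg x u (Suc t) = (s', map2 act_tape acts (snd (cfg x u t)))"
    and "i < n_tapes M \<Longrightarrow> cell x u (Suc t) i = (cell x u t i)(head x u t i := fst (acts ! i))"
    and "i < n_tapes M \<Longrightarrow> head x u (Suc t) i = head x u t i + offset (snd (acts ! i))"
proof -
  have "map read_tape (snd (cfg x u t)) = reads x u t"
  proof (rule nth_equalityI)
    fix i assume "i < length (map read_tape (snd (cfg x u t)))"
    then have "i < n_tapes M" using len by simp
    then show "map read_tape (snd (cfg x u t)) ! i = reads x u t ! i"
      using len unfolding reads_def cell_def head_def by (cases "snd (cfg x u t) ! i") simp
  qed (simp add: len reads_def)
  moreover have "cfg x u (Suc t) = step M (st x u t, snd (cfg x u t))"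
    unfolding cfg_def st_def by simp
  ultimately show *: "cfg x u (Suc t) = (s', map2 act_tape acts (snd (cfg x u t)))"
    unfolding step_next_action by (simp add: na)
  show "i < n_tapes M \<Longrightarrow> cell x u (Suc t) i = (cell x u t i)(head x u t i := fst (acts ! i))"
    "i < n_tapes M \<Longrightarrow> head x u (Suc t) i = head x u t i + offset (snd (acts ! i))"
    unfolding cell_def head_def * using len na(2)
    by (cases "snd (cfg x u t) ! i"; cases "acts ! i"; simp)+
qed

lemma cfg_inv:
  "length (snd (cfg x u t)) = n_tapes M \<and> st x u t \<le> n_states M \<and> (\<forall>i<n_tapes M. \<forall>j. cell x u t i j < n_symbols M)"
proof (induction t)
  case 0
  have "n_symbols M \<ge> 3" using wf unfolding wf_tm_def by blast
  then have "symb v j < n_symbols M" for v j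
    by (auto simp: input_tape_def bit_symbol_def)
  then have "cell x u 0 i j < n_symbols M" if "i < n_tapes M" for i j
  proof -
    consider "i = 0" | "i = 1" | "2 \<le> i" by linarith
    then show ?thesis
      using \<open>n_symbols M \<ge> 3\<close> \<open>\<And>v j. symb v j < n_symbols M\<close> that
      by cases (auto simp: cfg_0 cfg_0[unfolded One_nat_def])
  qed
  then show ?case using cfg_0(1,6) by simp
next
  case (Suc t)
  have rs: "length (reads x u t) = n_tapes M" "set (reads x u t) \<subseteq> {..<n_symbols M}"
    using Suc unfolding reads_def by auto
  obtain s' acts where na: "next_action (st x u t) (reads x u t) = (s', acts)" by fastforce
  note ok = next_action_ok[OF _ rs na]
  have "length acts = n_tapes M" using ok Suc by blast
  note nx = cfg_Suc_aux[OF _ na this]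
  have "cfg x u (Suc t) = (s', map2 act_tape acts (snd (cfg x u t)))" using nx(1) Suc by blast
  moreover have "cell x u (Suc t) i j < n_symbols M" if "i < n_tapes M" for i j
    using nx(2)[OF _ that] ok(3) Suc that by auto
  ultimately show ?case using ok Suc unfolding st_def by simp
qed

lemma reads_ok: "length (reads x u t) = n_tapes M" "set (reads x u t) \<subseteq> {..<n_symbols M}"
  using cfg_inv[of x u t] unfolding reads_def by auto

lemma cfg_Suc:
  assumes na: "next_action (st x u t) (reads x u t) = (s', acts)"
  shows "st x u (Suc t) = s'"
    and "i < n_tapes M \<Longrightarrow> cell x u (Suc t) i = (cell x u t i)(head x u t i := fst (acts ! i))"
    and "i < n_tapes M \<Longrightarrow> head x u (Suc t) i = head x u t i + offset (snd (acts ! i))"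
proof -
  note inv = cfg_inv[of x u t]
  note ok = next_action_ok[OF _ reads_ok na]
  have len: "length (snd (cfg x u t)) = n_tapes M" "length acts = n_tapes M" using inv ok by blast+
  note nx = cfg_Suc_aux[OF len(1) na len(2)]
  show "st x u (Suc t) = s'" unfolding st_def nx(1) by simp
  show "i < n_tapes M \<Longrightarrow> cell x u (Suc t) i = (cell x u t i)(head x u t i := fst (acts ! i))"
    "i < n_tapes M \<Longrightarrow> head x u (Suc t) i = head x u t i + offset (snd (acts ! i))"
    using nx(2,3) by blast+
qed

lemma head_bound: "i < n_tapes M \<Longrightarrow> \<bar>head x u t i\<bar> \<le> int t"
proof (induction t)
  case (Suc t)
  obtain s' acts where na: "next_action (st x u t) (reads x u t) = (s', acts)" by fastforce
  have "\<bar>offset d\<bar> \<le> 1" for d by (cases d) auto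
  from this[of "snd (acts ! i)"] show ?case using Suc cfg_Suc(3)[OF na Suc.prems] by simp
qed (simp add: cfg_0)

text \<open>A halting configuration is a fixed point of \<open>step\<close>, so the output may be
  inspected at a common time \<open>T\<close> for all certificates.\<close>

lemma final_output:
  assumes "outputs_within M [x, u] [b] T'" "T' \<le> T"
  shows "cell x u T (n_tapes M - 1) 0 = bit_symbol b"
proof -
  obtain k where k: "k \<le> T'" "fst (cfg x u k) = n_states M" "tape_output (last (snd (cfg x u k))) [b]"
    using assms(1) unfolding outputs_within_def cfg_def case_prod_unfold by blast
  have "cfg x u (k + j) = cfg x u k" for j
  proof (induction j)
    case (Suc j)
    have "cfg x u (k + Suc j) = step M (cfg x u (k + j))" unfolding cfg_def by simp
    also have "\<dots> = cfg x u k" unfolding Suc using k(2) by (cases "cfg x u k") simp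
    finally show ?case .
  qed simp
  from this[of "T - k"] have T: "cfg x u T = cfg x u k" using k(1) assms(2) by simp
  have "snd (cfg x u k) \<noteq> []" using cfg_inv[of x u k] two_tapes by auto
  then have "last (snd (cfg x u k)) = snd (cfg x u k) ! (n_tapes M - 1)"
    using cfg_inv[of x u k] by (simp add: last_conv_nth)
  then show ?thesis using k(3) unfolding cell_def T
    by (cases "snd (cfg x u k) ! (n_tapes M - 1)") simp
qed

text \<open>
  Cell \<open>c\<close> of a tape is described at position \<open>c + T x + 1\<close>, so that no head leaves the positions
  below \<open>2 T x + 3\<close> within \<open>T x\<close> steps.
\<close>

context
  fixes T mu :: "bool list \<Rightarrow> nat"
begin

section \<open>Clauses for the start, the tapes and the actions\<close>

definition "input_at x p = (if T x + 1 \<le> p \<and> p - (T x + 1) < length x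
    then if symb x (int (p - (T x + 1))) = 2 then 2 else 1 else (0 :: nat))"

lemma input_at_eq: "input_at x p = symb x (int p - int (T x + 1))"
  unfolding input_at_def input_tape_def by (auto simp: bit_symbol_def of_nat_diff)

definition at_start :: guard where "at_start = (\<lambda>x t p r. t = 0)"
definition at_origin :: guard where "at_origin = (\<lambda>x t p r. t = 0 \<and> p = T x + 1)"
definition at_input :: "nat \<Rightarrow> guard" where "at_input a = (\<lambda>x t p r. t = 0 \<and> input_at x p = a)"
definition in_cert :: guard where
  "in_cert = (\<lambda>x t p r. t = 0 \<and> T x + 1 \<le> p \<and> p < T x + 1 + mu x)"
definition off_cert :: guard where
  "off_cert = (\<lambda>x t p r. t = 0 \<and> (p < T x + 1 \<or> T x + 1 + mu x \<le> p))"
definition from_origin :: guard where "from_origin = (\<lambda>x t p r. t = 0 \<and> T x + 1 \<le> p)"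
definition always :: guard where "always = (\<lambda>x t p r. True)"
definition apart :: guard where "apart = (\<lambda>x t p r. p \<noteq> r)"
definition at_end :: guard where "at_end = (\<lambda>x t p r. t = T x \<and> p = T x + 1)"

text \<open>The certificate is guessed by the clauses for \<open>in_cert\<close>. Those for
  \<open>from_origin\<close> spread blanks to the right, so that the symbols before the first blank
  form a string.\<close>

definition start_rules :: "kind rule list" where
  "start_rules =
     [(at_start, [(True, State 0, 0, 2, 0)])] @
     map (\<lambda>i. (at_origin, [(True, Head i, 0, 0, 0)])) [0..<n_tapes M] @
     map (\<lambda>i. (at_start, [(True, Cell i 0, 0, 0, 0)])) [2..<n_tapes M] @
     map (\<lambda>a. (at_input a, [(True, Cell 0 a, 0, 0, 0)])) [0, 1, 2] @
     [(in_cert, map (\<lambda>a. (True, Cell 1 a, 0, 0, 0)) [0, 1, 2]),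
      (off_cert, [(True, Cell 1 0, 0, 0, 0)]),
      (from_origin, [(False, Cell 1 0, 0, 0, 0), (True, Cell 1 0, 0, 0, 1)])]"

definition tape_rules :: "kind rule list" where
  "tape_rules = concat (map (\<lambda>i. concat (map (\<lambda>a.
     [(always, [(False, Head i, 0, 0, 0), (False, Cell i a, 0, 0, 0), (True, Read i a, 0, 2, 0)]),
      (apart, [(False, Head i, 0, 1, 0), (False, Cell i a, 0, 0, 0), (True, Cell i a, 1, 0, 0)])])
     [0..<n_symbols M])) [0..<n_tapes M])"

definition pre_literals :: "nat \<Rightarrow> nat list \<Rightarrow> kind literal list" where
  "pre_literals s rs = (False, State s, 0, 2, 0) # map (\<lambda>i. (False, Read i (rs ! i), 0, 2, 0)) [0..<n_tapes M]"

text \<open>Displacements of positions are natural numbers. For a move to the left to be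
  expressible, the rule takes the head to be at \<open>p + 1\<close> and puts it at
  \<open>p\<close>, \<open>p + 1\<close> or \<open>p + 2\<close>.\<close>

definition action_rules :: "nat \<Rightarrow> nat list \<Rightarrow> kind rule list" where
  "action_rules s rs = (case next_action s rs of (s', acts) \<Rightarrow>
     (always, (True, State s', 1, 2, 0) # pre_literals s rs) #
     map (\<lambda>i. (always, (False, Head i, 0, 0, 1) #
       (True, Head i, 1, 0, nat (1 + offset (snd (acts ! i)))) # pre_literals s rs)) [0..<n_tapes M] @
     map (\<lambda>i. (always, (False, Head i, 0, 0, 0) #
       (True, Cell i (fst (acts ! i)), 1, 0, 0) # pre_literals s rs)) [0..<n_tapes M])"

text \<open>The last rule is the one that excludes rejection: symbol 1 is the bit
  \<open>False\<close>, and position \<open>T x + 1\<close> is cell 0 of the output tape.\<close>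

definition rules :: "kind rule list" where
  "rules = start_rules @ tape_rules @
     concat (map (\<lambda>s. concat (map (action_rules s) (List.n_lists (n_tapes M) [0..<n_symbols M])))
       [0..<Suc (n_states M)]) @
     [(at_end, [(False, Cell (n_tapes M - 1) 1, 0, 0, 0)])]"

lemma offset_cases: "nat (1 + offset d) \<le> 2" "0 \<le> 1 + offset d"
  by (cases d; simp)+

lemma rules_ne: "rules \<noteq> []"
  unfolding rules_def by simp

lemma rules_ok:
  assumes T: "expressible (\<lambda>x s. T x)" and mu: "expressible (\<lambda>x s. mu x)" and R: "R \<in> set rules"
  shows "snd R \<noteq> [] \<and> rule_ok R"
proof -
  note [expr] = T mu
  let ?dec = "\<lambda>g :: guard. decidable (\<lambda>x s. g x (s 0) (s 1) (s 2))"
  have "expressible (\<lambda>x s. input_at x (s 1))"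
    unfolding input_at_def by (intro expr)
  then have g: "?dec at_start" "?dec at_origin" "?dec (at_input a)" "?dec in_cert" "?dec off_cert"
    "?dec from_origin" "?dec always" "?dec apart" "?dec at_end" for a
    unfolding at_start_def at_origin_def at_input_def in_cert_def off_cert_def from_origin_def
      always_def apart_def at_end_def by (intro expr, assumption?)+
  have pre: "i \<le> 1 \<and> d \<le> 2" if "(b, \<kappa>, i, j, d) \<in> set (pre_literals s rs)" for b \<kappa> i j d s rs
    using that unfolding pre_literals_def by auto
  have act: "snd R \<noteq> [] \<and> rule_ok R" if "R \<in> set (action_rules s rs)" for s rs
    using that g offset_cases unfolding action_rules_def rule_ok_def
    by (auto split: prod.splits dest: pre[unfolded One_nat_def])
  have start: "snd R \<noteq> [] \<and> rule_ok R" if "R \<in> set start_rules"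
    using that g unfolding start_rules_def rule_ok_def by auto
  have tape: "snd R \<noteq> [] \<and> rule_ok R" if "R \<in> set tape_rules"
    using that g unfolding tape_rules_def rule_ok_def by auto
  have final: "snd R \<noteq> [] \<and> rule_ok R" if "R = (at_end, [(False, Cell (n_tapes M - 1) 1, 0, 0, 0)])"
    using that g unfolding rule_ok_def by auto
  show ?thesis using R act start tape final unfolding rules_def by auto
qed

section \<open>Accepting runs and models\<close>

definition assignment :: "bool list \<Rightarrow> bool list \<Rightarrow> kind \<Rightarrow> nat \<Rightarrow> nat \<Rightarrow> bool" where
  "assignment x u \<kappa> t p = (case \<kappa> of
     State s \<Rightarrow> st x u t = s
   | Head i \<Rightarrow> head x u t i = int p - int (T x + 1)
   | Cell i a \<Rightarrow> cell x u t i (int p - int (T x + 1)) = a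
   | Read i a \<Rightarrow> cell x u t i (head x u t i) = a)"

lemma models_assignment:
  assumes len: "length u \<le> mu x" and acc: "cell x u (T x) (n_tapes M - 1) 0 \<noteq> 1"
  shows "models rules T' P x (assignment x u)"
proof -
  let ?\<alpha> = "assignment x u"
  have start: "\<exists>l\<in>set ls. holds ?\<alpha> t p r l" if "(g, ls) \<in> set start_rules" "g x t p r" for g ls t p r
  proof -
    have "cell x u 0 1 (int p - int (T x + 1)) \<in> {0, 1, 2}"
      unfolding cfg_0 by (auto simp: input_tape_def bit_symbol_def)
    moreover have "cell x u 0 1 (int p - int (T x + 1)) = 0" if "p < T x + 1 \<or> T x + 1 + mu x \<le> p" for p
      using that len unfolding cfg_0 by (auto simp: input_tape_def)
    moreover have "cell x u 0 1 (int p - int (T x + 1)) = 0 \<longrightarrow> cell x u 0 1 (int (p + 1) - int (T x + 1)) = 0"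
      if "T x + 1 \<le> p" for p
      using that unfolding cfg_0 by (auto simp: input_tape_def bit_symbol_def split: if_splits)
    ultimately show ?thesis
      using that cfg_0 unfolding start_rules_def at_start_def at_origin_def at_input_def in_cert_def
        off_cert_def from_origin_def input_at_eq
      by (auto simp: place_def assignment_def)
  qed
  have tape: "\<exists>l\<in>set ls. holds ?\<alpha> t p r l" if "(g, ls) \<in> set tape_rules" "g x t p r" for g ls t p r
  proof -
    have "cell x u (Suc t) i j = cell x u t i j" if "i < n_tapes M" "j \<noteq> head x u t i" for i j
    proof -
      obtain s' acts where na: "next_action (st x u t) (reads x u t) = (s', acts)" by fastforce
      show ?thesis using cfg_Suc(2)[OF na that(1)] that(2) by simp
    qed
    then show ?thesis
      using that unfolding tape_rules_def always_def apart_def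
      by (auto simp: place_def assignment_def)
  qed
  have action: "\<exists>l\<in>set ls. holds ?\<alpha> t p r l"
    if R: "(g, ls) \<in> set (action_rules s rs)" and rs: "length rs = n_tapes M" for g ls t p r s rs
  proof (cases "\<exists>l\<in>set (pre_literals s rs). holds ?\<alpha> t p r l")
    case True
    moreover have "set (pre_literals s rs) \<subseteq> set ls"
      using R unfolding action_rules_def by (auto split: prod.splits)
    ultimately show ?thesis by blast
  next
    case False
    \<comment> \<open>If no premise is violated, the rule speaks about the actual state and the
      symbols actually read.\<close>
    then have s: "st x u t = s" and "\<forall>i<n_tapes M. cell x u t i (head x u t i) = rs ! i"
      unfolding pre_literals_def by (auto simp: assignment_def)
    then have rs': "rs = reads x u t"
      using rs by (intro nth_equalityI) (auto simp: reads_def)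
    obtain s' acts where na: "next_action s rs = (s', acts)" by fastforce
    note nx = cfg_Suc[OF na[folded s, unfolded rs']]
    show ?thesis
      using R nx offset_cases(2) unfolding action_rules_def na
      by (auto simp: place_def assignment_def)
  qed
  have "\<exists>l\<in>set ls. holds ?\<alpha> t p r l" if "(g, ls) \<in> set rules" "g x t p r" for g ls t p r
  proof -
    have "(g, ls) \<in> set start_rules \<or> (g, ls) \<in> set tape_rules \<or>
        (\<exists>s rs. (g, ls) \<in> set (action_rules s rs) \<and> length rs = n_tapes M) \<or>
        g = at_end \<and> ls = [(False, Cell (n_tapes M - 1) 1, 0, 0, 0)]"
      using that(1) unfolding rules_def by (auto simp: set_n_lists simp del: upt_Suc)
    then consider "(g, ls) \<in> set start_rules" | "(g, ls) \<in> set tape_rules"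
      | s rs where "(g, ls) \<in> set (action_rules s rs)" "length rs = n_tapes M"
      | "g = at_end" "ls = [(False, Cell (n_tapes M - 1) 1, 0, 0, 0)]"
      by blast
    then show ?thesis
    proof cases
      case 4
      then show ?thesis using that(2) acc by (simp add: at_end_def place_def assignment_def)
    qed (use start tape action that(2) in blast)+
  qed
  then show ?thesis unfolding models_def by auto
qed

text \<open>The model may contain more than the facts of one run, but by induction on the time it
  contains all facts of the run on the extracted \<open>u\<close>. Hence the variable of the actual
  output symbol is true, and this symbol differs from 1.\<close>

lemma certificate_of_model:
  assumes mod: "models rules (T x + 1) (2 * T x + 3) x \<alpha>" and mu: "mu x \<le> T x"
  obtains u where "length u \<le> mu x" "cell x u (T x) (n_tapes M - 1) 0 \<noteq> 1"
proof -
  let ?k = "n_tapes M" and ?P = "2 * T x + 3" and ?c = "T x + 1"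
  have D: "\<exists>l\<in>set ls. holds \<alpha> t p r l"
    if "(g, ls) \<in> set rules" "g x t p r" "t \<le> T x" "p < ?P" "r < ?P" for g ls t p r
    using modelsD[OF mod that(1)] that(2-) by simp
  have start: "(g, ls) \<in> set start_rules \<Longrightarrow> (g, ls) \<in> set rules" for g ls
    unfolding rules_def by simp
  have state0: "\<alpha> (State 0) 0 0"
    using D[OF start, of at_start "[(True, State 0, 0, 2, 0)]" 0 0 0]
    by (simp add: start_rules_def at_start_def place_def)
  have head0: "\<alpha> (Head i) 0 ?c" if "i < ?k" for i
    using D[OF start, of at_origin "[(True, Head i, 0, 0, 0)]" 0 ?c 0] that
    by (auto simp: start_rules_def at_origin_def place_def)
  have blank0: "\<alpha> (Cell i 0) 0 p" if "2 \<le> i" "i < ?k" "p < ?P" for i p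
    using D[OF start, of at_start "[(True, Cell i 0, 0, 0, 0)]" 0 p 0] that
    by (auto simp: start_rules_def at_start_def place_def)
  have input0: "\<alpha> (Cell 0 (input_at x p)) 0 p" if "p < ?P" for p
  proof -
    have "input_at x p \<in> {0, 1, 2}" unfolding input_at_def by auto
    then show ?thesis
      using D[OF start, of "at_input (input_at x p)" "[(True, Cell 0 (input_at x p), 0, 0, 0)]" 0 p 0] that
      by (auto simp: start_rules_def at_input_def place_def)
  qed
  have guess: "\<alpha> (Cell 1 0) 0 p \<or> \<alpha> (Cell 1 1) 0 p \<or> \<alpha> (Cell 1 2) 0 p"
    if "?c \<le> p" "p < ?c + mu x" for p
    using D[OF start, of in_cert "map (\<lambda>a. (True, Cell 1 a, 0, 0, 0)) [0, 1, 2]" 0 p 0] that mu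
    by (auto simp: start_rules_def in_cert_def place_def)
  have off: "\<alpha> (Cell 1 0) 0 p" if "p < ?c \<or> ?c + mu x \<le> p" "p < ?P" for p
    using D[OF start, of off_cert "[(True, Cell 1 0, 0, 0, 0)]" 0 p 0] that
    by (auto simp: start_rules_def off_cert_def place_def)
  have spread: "\<alpha> (Cell 1 0) 0 (Suc p)" if "?c \<le> p" "p < ?P" "\<alpha> (Cell 1 0) 0 p" for p
    using D[OF start, of from_origin "[(False, Cell 1 0, 0, 0, 0), (True, Cell 1 0, 0, 0, 1)]" 0 p 0] that
    by (auto simp: start_rules_def from_origin_def place_def)
  have read: "\<alpha> (Read i a) t 0"
    if "\<alpha> (Head i) t p" "\<alpha> (Cell i a) t p" "i < ?k" "a < n_symbols M" "t \<le> T x" "p < ?P" for i a t p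
  proof -
    have "(always, [(False, Head i, 0, 0, 0), (False, Cell i a, 0, 0, 0), (True, Read i a, 0, 2, 0)]) \<in> set rules"
      using that unfolding rules_def tape_rules_def by auto
    from D[OF this, of t p 0] that show ?thesis by (auto simp: always_def place_def)
  qed
  have keep: "\<alpha> (Cell i a) (Suc t) p"
    if "\<alpha> (Head i) t r" "\<alpha> (Cell i a) t p" "p \<noteq> r" "i < ?k" "a < n_symbols M" "t \<le> T x" "p < ?P" "r < ?P"
    for i a t p r
  proof -
    have "(apart, [(False, Head i, 0, 1, 0), (False, Cell i a, 0, 0, 0), (True, Cell i a, 1, 0, 0)]) \<in> set rules"
      using that unfolding rules_def tape_rules_def by auto
    from D[OF this, of t p r] that show ?thesis by (auto simp: apart_def place_def)
  qed

  \<comment> \<open>The certificate ends before the first cell that the model declares blank. A cell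
    may carry both bit symbols; symbol 1 is chosen then.\<close>
  define n where "n = (LEAST i. \<alpha> (Cell 1 0) 0 (?c + i))"
  define u where "u = map (\<lambda>i. \<not> \<alpha> (Cell 1 1) 0 (?c + i)) [0..<n]"
  have ex: "\<alpha> (Cell 1 0) 0 (?c + mu x)" using off[of "?c + mu x"] mu by simp
  then have n: "n \<le> mu x" "\<alpha> (Cell 1 0) 0 (?c + n)"
    unfolding n_def by (rule Least_le, rule LeastI)
  have cert0: "\<alpha> (Cell 1 (symb u (int p - int ?c))) 0 p" if p: "p < ?P" for p
  proof -
    consider "p < ?c" | i where "p = ?c + i" "i < n" | i where "p = ?c + i" "n \<le> i"
      by (metis add_diff_inverse_nat not_less)
    then show ?thesis
    proof cases
      case 1
      then show ?thesis using off[of p] p by (simp add: input_tape_def)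
    next
      case (2 i)
      have "\<not> \<alpha> (Cell 1 0) 0 p" using not_less_Least[of i] 2 unfolding n_def by blast
      then have "\<alpha> (Cell 1 1) 0 p \<or> \<alpha> (Cell 1 2) 0 p" using guess[of p] 2 n(1) by auto
      then show ?thesis using 2 by (auto simp: input_tape_def u_def bit_symbol_def)
    next
      case (3 i)
      have "\<alpha> (Cell 1 0) 0 (?c + i)" using 3(2) p[unfolded 3(1)]
      proof (induction i rule: dec_induct)
        case (step i)
        then show ?case using spread[of "?c + i"] by simp
      qed (use n in simp)
      then show ?thesis using 3 by (simp add: input_tape_def u_def)
    qed
  qed

  have inv: "\<alpha> (State (st x u t)) t 0 \<and> (\<forall>i<?k. \<alpha> (Head i) t (nat (head x u t i + int ?c))) \<and>
      (\<forall>i<?k. \<forall>p<?P. \<alpha> (Cell i (cell x u t i (int p - int ?c))) t p)" if "t \<le> T x" for t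
    using that
  proof (induction t)
    case 0
    have "\<alpha> (Cell i (cell x u 0 i (int p - int ?c))) 0 p" if "i < ?k" "p < ?P" for i p
    proof -
      consider "i = 0" | "i = 1" | "2 \<le> i" by linarith
      then show ?thesis
        using that blank0 input0[unfolded input_at_eq] cert0
        by cases (auto simp: cfg_0 cfg_0[unfolded One_nat_def])
    qed
    moreover have "\<alpha> (Head i) 0 (nat (head x u 0 i + int ?c))" if "i < ?k" for i
      using head0[OF that] by (simp only: cfg_0(2)[OF that] add_0_left nat_int)
    moreover have "\<alpha> (State (st x u 0)) 0 0" using state0 by (simp only: cfg_0(1))
    ultimately show ?case by blast
  next
    case (Suc t)
    then have t: "t \<le> T x" by simp
    note IH = Suc.IH[OF t]
    define h where "h i = nat (head x u t i + int ?c)" for i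
    \<comment> \<open>Within the time bound all heads stay at positions from 1 to
      \<open>2 * T x + 1\<close>. By the lower bound, the rule for moving a head can be instantiated
      at \<open>h i - 1\<close>.\<close>
    have h: "int (h i) = head x u t i + int ?c" "1 \<le> h i" "h i < ?P" if "i < ?k" for i
      using head_bound[OF that, of x u t] t unfolding h_def by linarith+
    have sym: "cell x u t i j < n_symbols M" if "i < ?k" for i j
      using cfg_inv that by blast
    have rd: "\<alpha> (Read i (reads x u t ! i)) t 0" if "i < ?k" for i
    proof -
      have "\<alpha> (Cell i (cell x u t i (int (h i) - int ?c))) t (h i)" using IH h that by blast
      then have "\<alpha> (Cell i (reads x u t ! i)) t (h i)" using that h by (simp add: reads_def)
      then show ?thesis
        using IH h that t sym unfolding h_def by (intro read) (auto simp: reads_def)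
    qed
    have pre: "\<not> holds \<alpha> t p r l" if "l \<in> set (pre_literals (st x u t) (reads x u t))" for l p r
      using that IH rd unfolding pre_literals_def by (auto simp: place_def)
    obtain s' acts where na: "next_action (st x u t) (reads x u t) = (s', acts)" by fastforce
    note nx = cfg_Suc[OF na]
    have mem: "R \<in> set rules" if "R \<in> set (action_rules (st x u t) (reads x u t))" for R
      using that reads_ok[of x u t] cfg_inv[of x u t] unfolding rules_def
      by (auto simp: set_n_lists less_Suc_eq_le intro!: bexI[of _ "st x u t"] exI[of _ "reads x u t"])
    have "(always, (True, State s', 1, 2, 0) # pre_literals (st x u t) (reads x u t)) \<in> set rules"
      by (rule mem) (simp add: action_rules_def na)
    from D[OF this, of t 0 0] have "\<alpha> (State s') (Suc t) 0"
      using t pre by (auto simp: always_def place_def)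
    moreover have "\<alpha> (Head i) (Suc t) (nat (head x u (Suc t) i + int ?c))" if i: "i < ?k" for i
    proof -
      have "(always, (False, Head i, 0, 0, 1) # (True, Head i, 1, 0, nat (1 + offset (snd (acts ! i)))) #
          pre_literals (st x u t) (reads x u t)) \<in> set rules"
        using i by (intro mem) (simp add: action_rules_def na)
      from D[OF this, of t "h i - 1" 0] have "\<alpha> (Head i) (Suc t) (h i - 1 + nat (1 + offset (snd (acts ! i))))"
        using t pre IH i h[OF i] by (auto simp: always_def place_def h_def)
      moreover have "h i - 1 + nat (1 + offset (snd (acts ! i))) = nat (head x u (Suc t) i + int ?c)"
        using h[OF i] nx(3)[OF i] offset_cases(2)[of "snd (acts ! i)"] by linarith
      ultimately show ?thesis by simp
    qed
    moreover have "\<alpha> (Cell i (cell x u (Suc t) i (int p - int ?c))) (Suc t) p" if i: "i < ?k" "p < ?P" for i p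
    proof (cases "p = h i")
      case True
      have "(always, (False, Head i, 0, 0, 0) # (True, Cell i (fst (acts ! i)), 1, 0, 0) #
          pre_literals (st x u t) (reads x u t)) \<in> set rules"
        using i by (intro mem) (simp add: action_rules_def na)
      from D[OF this, of t p 0] have "\<alpha> (Cell i (fst (acts ! i))) (Suc t) p"
        using t pre IH i True by (auto simp: always_def place_def h_def)
      then show ?thesis using nx(2)[OF i(1)] h(1)[OF i(1)] True by simp
    next
      case False
      then have "int p - int ?c \<noteq> head x u t i" using h(1)[OF i(1)] by linarith
      then have "cell x u (Suc t) i (int p - int ?c) = cell x u t i (int p - int ?c)"
        using nx(2)[OF i(1)] by simp
      moreover have "\<alpha> (Cell i (cell x u t i (int p - int ?c))) (Suc t) p"
      proof (rule keep[OF _ _ False i(1) sym[OF i(1)] t i(2) h(3)[OF i(1)]])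
        show "\<alpha> (Head i) t (h i)" using IH i(1) unfolding h_def by blast
        show "\<alpha> (Cell i (cell x u t i (int p - int ?c))) t p" using IH i by blast
      qed
      ultimately show ?thesis by simp
    qed
    ultimately show ?case using nx(1) by simp
  qed
  have "?k - 1 < ?k" "?c < ?P" using two_tapes by auto
  then have "\<alpha> (Cell (?k - 1) (cell x u (T x) (?k - 1) (int ?c - int ?c))) (T x) ?c"
    using inv[OF order_refl] by blast
  moreover have "\<not> \<alpha> (Cell (?k - 1) 1) (T x) ?c"
    using D[of at_end "[(False, Cell (n_tapes M - 1) 1, 0, 0, 0)]" "T x" ?c 0]
    by (simp add: rules_def at_end_def place_def)
  ultimately have "cell x u (T x) (?k - 1) 0 \<noteq> 1" by auto
  moreover have "length u \<le> mu x" using n unfolding u_def by simp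
  ultimately show thesis by (rule that[rotated])
qed

end

end

theorem theorem2:
  fixes q :: nat
  assumes "q \<ge> 2"
  shows "NP_hard (min_max_edge_coloring q)"
  unfolding NP_hard_def
proof
  fix A assume "A \<in> NP"
  then obtain R and p :: "nat poly" where R: "poly_time_decidable2 R"
    and A: "\<And>x. x \<in> A \<longleftrightarrow> (\<exists>u. length u \<le> poly p (length x) \<and> R x u)"
    unfolding NP_def by blast
  from R obtain M and pt :: "nat poly" where wf: "wf_tm M"
    and out: "\<And>x u. outputs_within M [x, u] [R x u] (poly pt (length x + length u))"
    unfolding poly_time_decidable2_def by blast
  \<comment> \<open>\<open>outputs_within\<close> requires a tape for each of the two input
    strings.\<close>
  have "2 \<le> n_tapes M" using out[of "[]" "[]"] unfolding outputs_within_def by simp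
  with wf interpret verifier M by unfold_locales
  define mu where "mu x = poly p (length x)" for x :: "bool list"
  \<comment> \<open>The first summand bounds the running time for all admissible certificates; the
    second one keeps the cells of the certificate within the described positions.\<close>
  define T where "T x = poly pt (length x + mu x) + mu x" for x :: "bool list"
  have mu: "expressible (\<lambda>x s. mu x)" and T: "expressible (\<lambda>x s. T x)"
    unfolding T_def mu_def by (intro expr)+
  \<comment> \<open>The verifier halts with a bit on every certificate, so not rejecting means
    accepting.\<close>
  have accept: "cell x u (T x) (n_tapes M - 1) 0 \<noteq> 1 \<longleftrightarrow> R x u" if "length u \<le> mu x" for x u
  proof -
    have "poly pt (length x + length u) \<le> T x"
      unfolding T_def by (rule trans_le_add1, rule poly_nat_mono) (use that in simp)
    from final_output[OF out this] show ?thesis by (simp add: bit_symbol_def)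
  qed
  have "x \<in> A \<longleftrightarrow> (\<exists>\<alpha>. models (rules T mu) (T x + 1) (2 * T x + 3) x \<alpha>)" for x
  proof
    assume "x \<in> A"
    then obtain u where "length u \<le> mu x" "R x u" using A unfolding mu_def by blast
    then show "\<exists>\<alpha>. models (rules T mu) (T x + 1) (2 * T x + 3) x \<alpha>"
      using models_assignment accept by blast
  next
    assume "\<exists>\<alpha>. models (rules T mu) (T x + 1) (2 * T x + 3) x \<alpha>"
    then obtain \<alpha> where "models (rules T mu) (T x + 1) (2 * T x + 3) x \<alpha>" by blast
    moreover have "mu x \<le> T x" unfolding T_def by simp
    ultimately obtain u where "length u \<le> mu x" "cell x u (T x) (n_tapes M - 1) 0 \<noteq> 1"
      by (rule certificate_of_model)
    then show "x \<in> A" using accept A unfolding mu_def by blast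
  qed
  moreover have "expressible (\<lambda>x s. T x + 1)" "expressible (\<lambda>x s. 2 * T x + 3)"
    using T by (intro expr, assumption?)+
  ultimately show "A \<le>\<^sub>p min_max_edge_coloring q"
    using rules_ok[OF T mu] by (intro models_reducible[OF assms rules_ne]) auto
qed

end
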